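(* Fix an integer $n\ge3$ and $q>\frac n2$. Let $\Omega$ be a bounded domain in $\mathbb{R}^n$ with $\partial\Omega\in C^1$, and let $u\in W^{1,2}(\Omega)$ be a $W^{1,2}$ weak solution to the equation $$-\sum_{i,j=1}^nD_j\bigl(a_{ij}(x)D_iu\bigr)+c(x)u=\varphi(x)$$ in $\Omega$, where $a_{ij}\in L^\infty(\Omega)$, $c\in L^{\frac n2}(\Omega)$ and $\varphi\in L^{\frac n2}(\log L)^q(\Omega)$ are given functions such that $c\ge0$ and $(a_{ij})\ge\varepsilon\mathbf{I}_n$ for a positive constant $\varepsilon$. Then $$\|u\|_{L^\infty(\Omega)}\le\inf\Bigl\{s\ge0\ \Bigm|\ \bigl(|u|-s\bigr)_+\in W^{1,2}_0(\Omega)\Bigr\}+C\|\varphi\|_{L^{\frac n2}(\log L)^q(\Omega)},$$ where $\inf\varnothing:=+\infty$ and $C$ is a positive constant depending only on $\Omega$, $n$, $q$ and $\frac1\varepsilon$.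
   Context: $\Omega$ carries Lebesgue measure. For $p\ge1$, $q\ge0$ put $\Phi_{p,q}(t)=t^p\log^q(1+t)$, $t\ge0$ (where $\log^qx=(\log x)^q$). The space $L^p(\log L)^q(\Omega)$ is the Orlicz space of all measurable functions $h$ on $\Omega$ for which there is $c>0$ with $\int_\Omega\Phi_{p,q}(|h|/c)\,dx\le1$, with the Luxemburg norm $\|h\|_{L^p(\log L)^q(\Omega)}=\inf\{c>0:\int_\Omega\Phi_{p,q}(|h|/c)\,dx\le1\}$. $u\in W^{1,2}(\Omega)$ is a $W^{1,2}$ weak solution if $\int_\Omega\bigl(\sum_{i,j}a_{ij}D_iu\,D_jv+cuv\bigr)dx=\int_\Omega\varphi v\,dx$ for all $v\in W^{1,2}_0(\Omega)$. The condition $(a_{ij})\ge\varepsilon\mathbf{I}_n$ means $\sum_{i,j}a_{ij}(x)\xi_i\xi_j\ge\varepsilon|\xi|^2$ for a.e. $x\in\Omega$ and all $\xi\in\mathbb{R}^n$. $(\cdot)_+$ denotes the positive part. *)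

theory Defs
  imports "HOL-Analysis.Analysis" "HOL-Probability.Essential_Supremum"
begin

section \<open>Domains with boundary of class $C^1$\<close>

primrec C_k :: "nat \<Rightarrow> ('a::euclidean_space \<Rightarrow> real) \<Rightarrow> bool" where
  "C_k 0 f \<longleftrightarrow> continuous_on UNIV f"
| "C_k (Suc k) f \<longleftrightarrow>
     (\<forall>x. f differentiable (at x)) \<and> (\<forall>v. C_k k (\<lambda>x. frechet_derivative f (at x) v))"

definition domain :: "'a::euclidean_space set \<Rightarrow> bool" where
  "domain \<Omega> \<longleftrightarrow> open \<Omega> \<and> connected \<Omega> \<and> \<Omega> \<noteq> {}"

text \<open>
  Near every boundary point the domain is the region strictly above a \<open>C\<^sup>1\<close> graph, after
  a rotation of the axes. The unit vector \<open>e\<close> is the rotated last coordinate direction;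
  a function on the hyperplane orthogonal to \<open>e\<close> is encoded as a function on the whole
  space that is constant along \<open>e\<close>.
\<close>

definition C1_boundary :: "'a::euclidean_space set \<Rightarrow> bool" where
  "C1_boundary \<Omega> \<longleftrightarrow>
     (\<forall>x0 \<in> frontier \<Omega>. \<exists>r>0. \<exists>e \<gamma>. norm e = 1 \<and> C_k 1 \<gamma> \<and>
        (\<forall>x t. \<gamma> (x + t *\<^sub>R e) = \<gamma> x) \<and>
        \<Omega> \<inter> ball x0 r = {x \<in> ball x0 r. \<gamma> x < x \<bullet> e})"


section \<open>Lebesgue and Orlicz spaces\<close>

text \<open>
  Members of these spaces are functions on the whole type rather than classes of functions
  on \<open>\<Omega>\<close>; their values outside \<open>\<Omega>\<close> are irrelevant, since all conditions refer to
  \<open>lebesgue_on \<Omega>\<close> only.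
\<close>

definition Lp_on :: "real \<Rightarrow> 'a::euclidean_space set \<Rightarrow> ('a \<Rightarrow> real) set" where
  "Lp_on p \<Omega> = {h \<in> borel_measurable (lebesgue_on \<Omega>).
     integrable (lebesgue_on \<Omega>) (\<lambda>x. \<bar>h x\<bar> powr p)}"

definition Linf_on :: "'a::euclidean_space set \<Rightarrow> ('a \<Rightarrow> real) set" where
  "Linf_on \<Omega> = {h \<in> borel_measurable (lebesgue_on \<Omega>).
     \<exists>K. AE x in lebesgue_on \<Omega>. \<bar>h x\<bar> \<le> K}"

definition Linf_norm :: "'a::euclidean_space set \<Rightarrow> ('a \<Rightarrow> real) \<Rightarrow> ereal" where
  "Linf_norm \<Omega> h = esssup (lebesgue_on \<Omega>) (\<lambda>x. ereal \<bar>h x\<bar>)"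

definition Phi :: "real \<Rightarrow> real \<Rightarrow> real \<Rightarrow> real" where
  "Phi p q t = t powr p * ln (1 + t) powr q"

definition LlogL_admissible ::
  "real \<Rightarrow> real \<Rightarrow> 'a::euclidean_space set \<Rightarrow> ('a \<Rightarrow> real) \<Rightarrow> real set" where
  "LlogL_admissible p q \<Omega> h =
     {c. c > 0 \<and> (\<integral>\<^sup>+x. ennreal (Phi p q (\<bar>h x\<bar> / c)) \<partial>lebesgue_on \<Omega>) \<le> 1}"

definition LlogL_on :: "real \<Rightarrow> real \<Rightarrow> 'a::euclidean_space set \<Rightarrow> ('a \<Rightarrow> real) set" where
  "LlogL_on p q \<Omega> = {h \<in> borel_measurable (lebesgue_on \<Omega>). LlogL_admissible p q \<Omega> h \<noteq> {}}"

text \<open>The infimum is real-valued, so the norm is meaningful on \<open>LlogL_on p q \<Omega>\<close> only.\<close>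

definition LlogL_norm ::
  "real \<Rightarrow> real \<Rightarrow> 'a::euclidean_space set \<Rightarrow> ('a \<Rightarrow> real) \<Rightarrow> real" where
  "LlogL_norm p q \<Omega> h = Inf (LlogL_admissible p q \<Omega> h)"


section \<open>Sobolev spaces\<close>

definition test_functions :: "'a::euclidean_space set \<Rightarrow> ('a \<Rightarrow> real) set" where
  "test_functions \<Omega> = {\<psi>. (\<forall>k. C_k k \<psi>) \<and>
     compact (closure {x. \<psi> x \<noteq> 0}) \<and> closure {x. \<psi> x \<noteq> 0} \<subseteq> \<Omega>}"

definition locally_integrable_on :: "('a::euclidean_space \<Rightarrow> real) \<Rightarrow> 'a set \<Rightarrow> bool" where
  "locally_integrable_on h \<Omega> \<longleftrightarrow> (\<forall>K. compact K \<and> K \<subseteq> \<Omega> \<longrightarrow> h absolutely_integrable_on K)"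

definition has_weak_partial ::
  "(real^'n) set \<Rightarrow> 'n::finite \<Rightarrow> (real^'n \<Rightarrow> real) \<Rightarrow> (real^'n \<Rightarrow> real) \<Rightarrow> bool" where
  "has_weak_partial \<Omega> i u g \<longleftrightarrow> locally_integrable_on u \<Omega> \<and> locally_integrable_on g \<Omega> \<and>
     (\<forall>\<psi> \<in> test_functions \<Omega>.
        (\<integral>x. u x * frechet_derivative \<psi> (at x) (axis i 1) \<partial>lebesgue_on \<Omega>)
          = - (\<integral>x. g x * \<psi> x \<partial>lebesgue_on \<Omega>))"

text \<open>
  A weak derivative is unique only up to null sets; an arbitrary representative is chosen,
  and the operator is used under integrals only.
\<close>

definition weak_partial ::
  "(real^'n) set \<Rightarrow> 'n::finite \<Rightarrow> (real^'n \<Rightarrow> real) \<Rightarrow> real^'n \<Rightarrow> real" where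
  "weak_partial \<Omega> i u = (SOME g. has_weak_partial \<Omega> i u g)"

definition W12 :: "(real^'n::finite) set \<Rightarrow> (real^'n \<Rightarrow> real) set" where
  "W12 \<Omega> = {u \<in> Lp_on 2 \<Omega>. \<forall>i. \<exists>g \<in> Lp_on 2 \<Omega>. has_weak_partial \<Omega> i u g}"

definition W12_norm :: "(real^'n::finite) set \<Rightarrow> (real^'n \<Rightarrow> real) \<Rightarrow> real" where
  "W12_norm \<Omega> u = sqrt ((\<integral>x. (u x)\<^sup>2 \<partial>lebesgue_on \<Omega>) +
     (\<Sum>i\<in>UNIV. \<integral>x. (weak_partial \<Omega> i u x)\<^sup>2 \<partial>lebesgue_on \<Omega>))"

definition W12_0 :: "(real^'n::finite) set \<Rightarrow> (real^'n \<Rightarrow> real) set" where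
  "W12_0 \<Omega> = {v \<in> W12 \<Omega>. \<forall>\<delta>>0. \<exists>\<psi> \<in> test_functions \<Omega>. W12_norm \<Omega> (\<lambda>x. v x - \<psi> x) < \<delta>}"


section \<open>Weak solutions\<close>

definition uniformly_elliptic ::
  "(real^'n) set \<Rightarrow> ('n::finite \<Rightarrow> 'n \<Rightarrow> real^'n \<Rightarrow> real) \<Rightarrow> real \<Rightarrow> bool" where
  "uniformly_elliptic \<Omega> a \<epsilon> \<longleftrightarrow>
     (AE x in lebesgue_on \<Omega>. \<forall>\<xi>::real^'n.
        (\<Sum>i\<in>UNIV. \<Sum>j\<in>UNIV. a i j x * \<xi> $ i * \<xi> $ j) \<ge> \<epsilon> * (norm \<xi>)\<^sup>2)"

definition W12_weak_solution ::
  "(real^'n) set \<Rightarrow> ('n::finite \<Rightarrow> 'n \<Rightarrow> real^'n \<Rightarrow> real) \<Rightarrow> (real^'n \<Rightarrow> real) \<Rightarrow>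
   (real^'n \<Rightarrow> real) \<Rightarrow> (real^'n \<Rightarrow> real) \<Rightarrow> bool" where
  "W12_weak_solution \<Omega> a c \<phi> u \<longleftrightarrow> u \<in> W12 \<Omega> \<and>
     (\<forall>v \<in> W12_0 \<Omega>.
        (\<integral>x. (\<Sum>i\<in>UNIV. \<Sum>j\<in>UNIV. a i j x * weak_partial \<Omega> i u x * weak_partial \<Omega> j v x)
               + c x * u x * v x \<partial>lebesgue_on \<Omega>)
          = (\<integral>x. \<phi> x * v x \<partial>lebesgue_on \<Omega>))"

end

theory Submission
  imports Defs "HOL-Real_Asymp.Real_Asymp"
begin

text \<open>
  The proof is a De Giorgi iteration over the superlevel sets \<open>A k = {\<bar>u\<bar> > k}\<close>. Testing the equation
  with a truncation of \<open>u\<close> between the levels \<open>k\<close> and \<open>k + 2h\<close> bounds the energy on that layer by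
  \<open>h/\<epsilon>\<close> times the integral of \<open>\<bar>\<phi>\<bar>\<close> over \<open>A k\<close>; a weak-type Sobolev inequality, derived from
  Loomis--Whitney, turns this into a decay estimate for the measure of \<open>A (k + 2h)\<close>. Both sides have the same
  homogeneity because \<open>n/2\<close> is the critical exponent, and only the logarithm in the Orlicz norm makes the
  iteration converge: if the measure of \<open>A k\<close> is at most \<open>e\<^sup>-\<^sup>p\<^sup>j\<close> with \<open>p = n/2\<close>, then the next
  measure is smaller by the factor \<open>e\<^sup>-\<^sup>p\<close> after a step \<open>h\<close> of order \<open>\<parallel>\<phi>\<parallel> j\<^sup>-\<^sup>q\<^sup>/\<^sup>p\<close>, and these steps
  are summable since \<open>q > p\<close>.
\<close>

section \<open>Smooth functions\<close>

text \<open>Let F(k) be the integral of |\<phi>| over A(k). Cauchy-Schwarz on A(k) turns the energy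
  bound into an L1 bound sqrt(h \<mu>(k) F(k) / \<epsilon>) for each partial derivative, and
  Sobolev's inequality for L1 gradients gives (h/4)^(n/2) \<mu>(k + 2h)^(n-1) \<le> (\<mu>(k) F(k) /
  \<epsilon>)^(n/2). If \<mu>(k) is of order e^(-pj), cutting \<phi> at height lam T with T = e^j
  j^(-\<alpha>), \<alpha> = q/p, makes both parts of F(k) of order lam e^(-(p-1)j) j^(-\<alpha>),
  and all exponentials cancel against the next target e^(-p(j+1)). Two obstacles shape the rest. The
  Bochner integral of a non-integrable function is 0, so the term c u v can be split off and dropped
  by its sign only once it is known to be integrable; hence the test functions that return to 0 for
  large |u|. And the boundary condition speaks of the positive part of |u| - s alone, so every
  truncation of u must be shown to lie in \<open>W12_0\<close> from approximations of that one
  function; truncations of class C^1 at levels above s keep this within a classical chain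
  rule.\<close>

definition smooth :: "('a::euclidean_space \<Rightarrow> real) \<Rightarrow> bool" where
  "smooth f \<longleftrightarrow> (\<forall>k. C_k k f)"

lemma differentiable_imp_continuous_UNIV:
  fixes f :: "'a::euclidean_space \<Rightarrow> real"
  assumes "\<And>x. f differentiable (at x)"
  shows "continuous_on UNIV f"
  using assms differentiable_imp_continuous_within
  by (fastforce simp: continuous_on_eq_continuous_at)

lemma C_k_SucD: "C_k (Suc k) f \<Longrightarrow> C_k k f"
proof (induction k arbitrary: f)
  case 0
  then show ?case by (simp add: differentiable_imp_continuous_UNIV)
qed auto

text \<open>Coinduction: \<open>C_k k\<close> follows for all members at once by induction on k. It
  serves where the derivatives of a function are known only as members of the same family, as for
  convolutions.\<close>

lemma smoothI_family:
  assumes "f \<in> S"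
    and "\<And>f x. f \<in> S \<Longrightarrow> f differentiable (at x)"
    and "\<And>f v. f \<in> S \<Longrightarrow> (\<lambda>x. frechet_derivative f (at x) v) \<in> S"
  shows "smooth f"
proof -
  have "C_k k f" if "f \<in> S" for k f
    using that
  proof (induction k arbitrary: f)
    case 0
    then show ?case using assms(2) by (simp add: differentiable_imp_continuous_UNIV)
  next
    case (Suc k)
    then show ?case using assms(2,3) by simp
  qed
  then show ?thesis using assms(1) by (auto simp: smooth_def)
qed

lemma C_kD:
  assumes "C_k (Suc k) f"
  shows "(f has_derivative frechet_derivative f (at x)) (at x)"
    and "C_k k (\<lambda>x. frechet_derivative f (at x) v)"
  using assms by (auto simp: frechet_derivative_works[symmetric])

lemma C_k_continuous: "C_k k f \<Longrightarrow> continuous_on UNIV f"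
  by (induction k) (auto dest: C_k_SucD intro: differentiable_imp_continuous_UNIV)

text \<open>\<open>C_k\<close> is phrased with the operator \<open>frechet_derivative\<close>;
  uniqueness of derivatives lets an explicit formula D take its place, so that each closure property
  below reduces to one derivative rule.\<close>

lemma C_k_SucI:
  assumes "\<And>x. (f has_derivative D x) (at x)" and "\<And>v. C_k k (\<lambda>x. D x v)"
  shows "C_k (Suc k) f"
proof -
  have "frechet_derivative f (at x) = D x" for x
    using assms(1) frechet_derivative_at by metis
  then show ?thesis
    using assms by (auto simp: differentiable_def)
qed

lemma C_k_const: "C_k k (\<lambda>x. c)"
proof (induction k arbitrary: c)
  case (Suc k)
  show ?case by (rule C_k_SucI[where D="\<lambda>x v. 0"]) (use Suc in auto)
qed simp

lemma C_k_inner: "C_k k (\<lambda>x. x \<bullet> e)"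
proof (cases k)
  case (Suc k)
  show ?thesis unfolding Suc
    by (rule C_k_SucI[where D="\<lambda>x v. v \<bullet> e"]) (auto intro!: derivative_eq_intros C_k_const)
qed (simp add: continuous_intros)

lemma C_k_add: "C_k k f \<Longrightarrow> C_k k g \<Longrightarrow> C_k k (\<lambda>x. f x + g x)"
proof (induction k arbitrary: f g)
  case (Suc k)
  show ?case
    by (rule C_k_SucI[where D="\<lambda>x v. frechet_derivative f (at x) v + frechet_derivative g (at x) v"])
      (intro has_derivative_add C_kD[OF Suc.prems(1)] C_kD[OF Suc.prems(2)] Suc.IH)+
qed (simp add: continuous_intros)

lemma C_k_mult: "C_k k f \<Longrightarrow> C_k k g \<Longrightarrow> C_k k (\<lambda>x. f x * g x)"
proof (induction k arbitrary: f g)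
  case (Suc k)
  show ?case
    by (rule C_k_SucI[where D="\<lambda>x v. f x * frechet_derivative g (at x) v + frechet_derivative f (at x) v * g x"])
      (intro has_derivative_mult C_kD[OF Suc.prems(1)] C_kD[OF Suc.prems(2)] C_k_add Suc.IH
        C_k_SucD[OF Suc.prems(1)] C_k_SucD[OF Suc.prems(2)])+
qed (simp add: continuous_intros)

lemma C_k_cmult: "C_k k f \<Longrightarrow> C_k k (\<lambda>x. c * f x)"
  by (intro C_k_mult C_k_const)

lemma C_k_diff: "C_k k f \<Longrightarrow> C_k k g \<Longrightarrow> C_k k (\<lambda>x. f x - g x)"
  using C_k_add[OF _ C_k_cmult[of k g "-1"]] by simp

lemma C_k_sum: "(\<And>i. i \<in> I \<Longrightarrow> C_k k (f i)) \<Longrightarrow> C_k k (\<lambda>x. \<Sum>i\<in>I. f i x)"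
  by (induction I rule: infinite_finite_induct) (auto intro: C_k_const C_k_add)

lemma C_k_prod: "(\<And>i. i \<in> I \<Longrightarrow> C_k k (f i)) \<Longrightarrow> C_k k (\<lambda>x. \<Prod>i\<in>I. f i x)"
  by (induction I rule: infinite_finite_induct) (auto intro: C_k_const C_k_mult)

text \<open>The outer function comes with all its derivatives, as a sequence F. The index j has to
  vary in the induction because the derivative of \<open>F j\<close> composed with f involves
  \<open>F (Suc j)\<close>.\<close>

lemma C_k_compose:
  fixes F :: "nat \<Rightarrow> real \<Rightarrow> real"
  assumes F: "\<And>j t. (F j has_real_derivative F (Suc j) t) (at t)"
  shows "C_k k f \<Longrightarrow> C_k k (\<lambda>x. F j (f x))"
proof (induction k arbitrary: j)
  case 0
  have "continuous_on UNIV (F j)"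
    using F by (meson DERIV_isCont continuous_at_imp_continuous_on)
  then show ?case using 0 by (auto intro: continuous_on_compose2)
next
  case (Suc k)
  show ?case
  proof (rule C_k_SucI[where D="\<lambda>x v. F (Suc j) (f x) * frechet_derivative f (at x) v"])
    show "((\<lambda>x. F j (f x)) has_derivative (\<lambda>v. F (Suc j) (f x) * frechet_derivative f (at x) v)) (at x)" for x
      using has_derivative_compose[OF C_kD(1)[OF Suc.prems] F[unfolded has_field_derivative_def]] .
    show "C_k k (\<lambda>x. F (Suc j) (f x) * frechet_derivative f (at x) v)" for v
      by (intro C_k_mult Suc.IH C_k_SucD[OF Suc.prems] C_kD(2)[OF Suc.prems])
  qed
qed

lemma C_1_compose:
  fixes h :: "real \<Rightarrow> real"
  assumes h: "\<And>t. (h has_real_derivative h' t) (at t)" "continuous_on UNIV h'" and f: "C_k 1 f"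
  shows "C_k 1 (\<lambda>x. h (f x))"
    and "frechet_derivative (\<lambda>x. h (f x)) (at x) v = h' (f x) * frechet_derivative f (at x) v"
proof -
  have f1: "C_k (Suc 0) f" using f by simp
  have D: "((\<lambda>x. h (f x)) has_derivative (\<lambda>v. h' (f x) * frechet_derivative f (at x) v)) (at x)" for x
    using has_derivative_compose[OF C_kD(1)[OF f1] h(1)[unfolded has_field_derivative_def]] .
  then show "frechet_derivative (\<lambda>x. h (f x)) (at x) v = h' (f x) * frechet_derivative f (at x) v"
    using frechet_derivative_at by metis
  have "C_k (Suc 0) (\<lambda>x. h (f x))"
    by (rule C_k_SucI[OF D]) (use C_kD(2)[OF f1] h(2) C_k_continuous[OF f]
        in \<open>auto intro!: continuous_intros intro: continuous_on_compose2\<close>)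
  then show "C_k 1 (\<lambda>x. h (f x))" by simp
qed

lemma smooth_const: "smooth (\<lambda>x. c)"
  and smooth_inner: "smooth (\<lambda>x. x \<bullet> e)"
  and smooth_diff: "smooth f \<Longrightarrow> smooth g \<Longrightarrow> smooth (\<lambda>x. f x - g x)"
  and smooth_mult: "smooth f \<Longrightarrow> smooth g \<Longrightarrow> smooth (\<lambda>x. f x * g x)"
  and smooth_cmult: "smooth f \<Longrightarrow> smooth (\<lambda>x. c * f x)"
  by (auto simp: smooth_def intro: C_k_const C_k_inner C_k_add C_k_diff C_k_mult)

lemma smooth_sum: "(\<And>i. i \<in> I \<Longrightarrow> smooth (f i)) \<Longrightarrow> smooth (\<lambda>x. \<Sum>i\<in>I. f i x)"
  and smooth_prod: "(\<And>i. i \<in> I \<Longrightarrow> smooth (f i)) \<Longrightarrow> smooth (\<lambda>x. \<Prod>i\<in>I. f i x)"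
  by (auto simp: smooth_def intro: C_k_sum C_k_prod)

lemma smooth_C_k: "smooth f \<Longrightarrow> C_k k f"
  by (simp add: smooth_def)

lemma smooth_has_derivative: "smooth f \<Longrightarrow> (f has_derivative frechet_derivative f (at x)) (at x)"
  using C_kD(1)[of 0 f] by (simp add: smooth_def)

lemma smooth_derivative: "smooth f \<Longrightarrow> smooth (\<lambda>x. frechet_derivative f (at x) v)"
  unfolding smooth_def using C_kD(2) by blast

lemma smooth_continuous: "smooth f \<Longrightarrow> continuous_on S f"
  using C_k_continuous continuous_on_subset by (metis smooth_def subset_UNIV)

lemma smooth_borel [measurable (raw)]: "smooth f \<Longrightarrow> f \<in> borel_measurable borel"
  by (intro borel_measurable_continuous_onI smooth_continuous)

lemma frechet_derivative_eqI: "(f has_derivative D) (at x) \<Longrightarrow> frechet_derivative f (at x) v = D v"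
  using frechet_derivative_at by metis

lemma frechet_derivative_mult_smooth:
  assumes "smooth f" "smooth g"
  shows "frechet_derivative (\<lambda>x. f x * g x) (at x) v
    = f x * frechet_derivative g (at x) v + frechet_derivative f (at x) v * g x"
  by (rule frechet_derivative_eqI) (intro has_derivative_mult smooth_has_derivative assms)

section \<open>A flat function on the line\<close>

text \<open>The classical non-analytic function exp(-1/t), times a polynomial in 1/t. With the
  polynomial as a parameter the family is closed under differentiation, so that smoothness costs a
  single derivative computation.\<close>

definition flat :: "real poly \<Rightarrow> real \<Rightarrow> real" where
  "flat p t = (if t \<le> 0 then 0 else poly p (1 / t) * exp (- (1 / t)))"

text \<open>For t > 0 the derivative of p(1/t) exp(-1/t) is t^(-2) (p - p')(1/t) exp(-1/t);
  \<open>monom 1 2\<close> is the factor t^(-2).\<close>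

definition flat_deriv :: "real poly \<Rightarrow> real poly" where
  "flat_deriv p = monom 1 2 * (p - pderiv p)"

lemma poly_exp_tendsto_0: "((\<lambda>x. poly p x * exp (- x)) \<longlongrightarrow> (0::real)) at_top"
proof -
  have "((\<lambda>x. \<Sum>i\<le>degree p. coeff p i * (x ^ i / exp x)) \<longlongrightarrow> (\<Sum>i\<le>degree p. coeff p i * 0)) at_top"
    by (intro tendsto_intros tendsto_power_div_exp_0)
  then show ?thesis
    by (simp add: poly_altdef sum_distrib_right exp_minus divide_inverse mult.assoc)
qed

lemma flat_tendsto_0: "(flat p \<longlongrightarrow> 0) (at_right 0)"
proof -
  have "((\<lambda>t. poly p (inverse t) * exp (- inverse t)) \<longlongrightarrow> 0) (at_right 0)"
    using poly_exp_tendsto_0 filterlim_inverse_at_top_right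
    by (rule filterlim_compose)
  moreover have "\<forall>\<^sub>F t in at_right 0. poly p (inverse t) * exp (- inverse t) = flat p t"
    by (auto simp: eventually_at_right_field flat_def inverse_eq_divide intro!: exI[of _ 1])
  ultimately show ?thesis by (rule Lim_transform_eventually)
qed

lemma flat_has_derivative: "(flat p has_real_derivative flat (flat_deriv p) t) (at t)"
proof (cases "t = 0")
  case False
  show ?thesis
  proof (cases "t < 0")
    case True
    have "((\<lambda>_. 0) has_real_derivative 0) (at t)" by simp
    then have "(flat p has_real_derivative 0) (at t)"
      by (rule has_field_derivative_transform_within[where d="-t"]) (use True in \<open>auto simp: flat_def dist_real_def\<close>)
    then show ?thesis using True by (simp add: flat_def)
  next
    case f: False
    then have t: "t > 0" using False by simp
    have "((\<lambda>t. poly p (1 / t) * exp (- (1 / t))) has_real_derivative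
        poly p (1 / t) * (exp (- (1 / t)) * (1 / t\<^sup>2)) + poly (pderiv p) (1 / t) * (- 1 / t\<^sup>2) * exp (- (1 / t))) (at t)"
      using t by (auto intro!: derivative_eq_intros simp: field_simps power2_eq_square)
    also have "poly p (1 / t) * (exp (- (1 / t)) * (1 / t\<^sup>2)) + poly (pderiv p) (1 / t) * (- 1 / t\<^sup>2) * exp (- (1 / t))
       = flat (flat_deriv p) t"
      using t by (simp add: flat_def flat_deriv_def poly_monom field_simps)
    finally show ?thesis
      by (rule has_field_derivative_transform_within[where d=t]) (use t in \<open>auto simp: flat_def dist_real_def\<close>)
  qed
next
  case True
  \<comment> \<open>Dividing by t multiplies the polynomial by its variable, so the right difference
    quotient at 0 is again a flat function and tends to 0.\<close>
  have "((\<lambda>t. (flat p t - flat p 0) / (t - 0)) \<longlongrightarrow> 0) (at_right 0)"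
  proof (rule Lim_transform_eventually[OF flat_tendsto_0[of "monom 1 1 * p"]])
    show "\<forall>\<^sub>F t in at_right 0. flat (monom 1 1 * p) t = (flat p t - flat p 0) / (t - 0)"
      by (auto simp: eventually_at_right_field flat_def poly_monom intro!: exI[of _ 1])
  qed
  moreover have "((\<lambda>t. (flat p t - flat p 0) / (t - 0)) \<longlongrightarrow> 0) (at_left 0)"
  proof (rule Lim_transform_eventually[OF tendsto_const])
    show "\<forall>\<^sub>F t in at_left 0. 0 = (flat p t - flat p 0) / (t - 0)"
      by (auto simp: eventually_at_left_field flat_def intro!: exI[of _ "-1"])
  qed
  ultimately have "((\<lambda>t. (flat p t - flat p 0) / (t - 0)) \<longlongrightarrow> 0) (at 0)"
    by (simp add: filterlim_split_at)
  then show ?thesis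
    using True by (simp add: has_field_derivative_iff flat_def)
qed

lemma flat_bounded: "\<exists>B. \<forall>t. \<bar>flat p t\<bar> \<le> B"
proof -
  obtain N where N: "\<And>x. x \<ge> N \<Longrightarrow> \<bar>poly p x * exp (- x)\<bar> < 1"
    using poly_exp_tendsto_0[of p, THEN tendstoD, of 1] by (auto simp: eventually_at_top_linorder)
  have "compact ((\<lambda>x. poly p x * exp (- x)) ` {0..N})"
    by (intro compact_continuous_image continuous_intros) auto
  then obtain B where B: "\<And>x. x \<in> {0..N} \<Longrightarrow> \<bar>poly p x * exp (- x)\<bar> \<le> B"
    using compact_imp_bounded by (fastforce simp: bounded_iff)
  have "\<bar>flat p t\<bar> \<le> max 1 B" for t
    using N[of "1/t"] B[of "1/t"] by (cases "t \<le> 0"; cases "1/t \<ge> N") (auto simp: flat_def)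
  then show ?thesis by blast
qed

abbreviation flat0 :: "real \<Rightarrow> real" where
  "flat0 \<equiv> flat 1"

lemma flat0_eq: "flat0 t = (if t \<le> 0 then 0 else exp (- (1 / t)))"
  by (simp add: flat_def)

lemma flat0_bounds: "0 \<le> flat0 t" "flat0 t \<le> 1" "flat0 t > 0 \<longleftrightarrow> t > 0" "t \<le> 0 \<Longrightarrow> flat0 t = 0"
  by (auto simp: flat0_eq)

lemma smooth_flat: "smooth f \<Longrightarrow> smooth (\<lambda>x. flat p (f x))"
  unfolding smooth_def
  using C_k_compose[where F="\<lambda>j. flat ((flat_deriv ^^ j) p)" and j=0]
  by (auto simp: flat_has_derivative)

section \<open>Bump and cutoff functions\<close>

text \<open>The factor m sharpens the bump: as m grows it tends pointwise to the indicator of the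
  open box and stays in [0, 1], which allows boxes to be tested by dominated convergence.\<close>

definition bump :: "real \<Rightarrow> 'a \<Rightarrow> 'a \<Rightarrow> 'a::euclidean_space \<Rightarrow> real" where
  "bump m a b x = (\<Prod>i\<in>Basis. flat0 (m * (x \<bullet> i - a \<bullet> i)) * flat0 (m * (b \<bullet> i - x \<bullet> i)))"

lemma smooth_bump: "smooth (bump m a b)"
  unfolding bump_def
  by (intro smooth_prod smooth_mult smooth_flat smooth_cmult smooth_diff smooth_const smooth_inner)

lemma bump_bounds: "0 \<le> bump m a b x" "bump m a b x \<le> 1"
  unfolding bump_def by (auto intro!: prod_nonneg prod_le_1 mult_nonneg_nonneg mult_le_one flat0_bounds)

lemma bump_pos_iff: "m > 0 \<Longrightarrow> bump m a b x > 0 \<longleftrightarrow> x \<in> box a b"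
proof -
  assume m: "m > 0"
  have "x \<in> box a b \<Longrightarrow> bump m a b x > 0"
    unfolding bump_def using m by (auto intro!: prod_pos mult_pos_pos simp: flat0_bounds(3) mem_box)
  moreover have "bump m a b x = 0" if "x \<notin> box a b"
    using that m unfolding bump_def mem_box
    by (auto simp: not_less flat0_bounds mult_nonneg_nonpos intro!: prod_zero bexI)
  ultimately show ?thesis by force
qed

lemma bump_eq_0: "m > 0 \<Longrightarrow> x \<notin> box a b \<Longrightarrow> bump m a b x = 0"
  using bump_pos_iff[of m a b x] bump_bounds[of m a b x] by linarith

lemma bump_tendsto_indicator:
  "(\<lambda>m. bump (real (Suc m)) a b x) \<longlonglongrightarrow> indicator (box a b) x"
proof (cases "x \<in> box a b")
  case True
  have 1: "(\<lambda>m. flat0 (real (Suc m) * r)) \<longlonglongrightarrow> 1" if r: "r > 0" for r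
  proof -
    have "(\<lambda>m. exp (- (inverse (real (Suc m)) * (1 / r)))) \<longlonglongrightarrow> exp (- (0 * (1 / r)))"
      by (intro tendsto_intros LIMSEQ_inverse_real_of_nat)
    moreover have "flat0 (real (Suc m) * r) = exp (- (inverse (real (Suc m)) * (1 / r)))" for m
    proof -
      have "real (Suc m) * r > 0" using r by simp
      then show ?thesis unfolding flat0_eq by (simp add: field_simps del: of_nat_Suc)
    qed
    ultimately show ?thesis by simp
  qed
  have "(\<lambda>m. bump (real (Suc m)) a b x) \<longlonglongrightarrow> (\<Prod>i\<in>(Basis::'a set). 1 * 1)"
    unfolding bump_def by (intro tendsto_prod tendsto_mult 1) (use True in \<open>auto simp: mem_box\<close>)
  then show ?thesis using True by simp
qed (simp add: bump_eq_0)

section \<open>Test functions and their closure properties\<close>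

lemma test_functions_smooth: "\<psi> \<in> test_functions \<Omega> \<Longrightarrow> smooth \<psi>"
  by (simp add: test_functions_def smooth_def)

lemma test_functionsI:
  assumes "smooth \<psi>" "compact K" "K \<subseteq> \<Omega>" "\<And>x. x \<notin> K \<Longrightarrow> \<psi> x = 0"
  shows "\<psi> \<in> test_functions \<Omega>"
proof -
  have "closure {x. \<psi> x \<noteq> 0} \<subseteq> K"
    using assms by (intro closure_minimal compact_imp_closed) auto
  moreover from this have "compact (closure {x. \<psi> x \<noteq> 0})"
    using compact_Int_closed[OF assms(2), of "closure {x. \<psi> x \<noteq> 0}"] by (simp add: Int_absorb1)
  ultimately show ?thesis
    using assms by (auto simp: test_functions_def smooth_def)
qed

lemma test_functionsE:
  assumes "\<psi> \<in> test_functions \<Omega>"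
  obtains K where "compact K" "K \<subseteq> \<Omega>" "\<And>x. x \<notin> K \<Longrightarrow> \<psi> x = 0"
proof (rule that[of "closure {x. \<psi> x \<noteq> 0}"])
  show "\<psi> x = 0" if "x \<notin> closure {x. \<psi> x \<noteq> 0}" for x
    using that closure_subset[of "{x. \<psi> x \<noteq> 0}"] by auto
qed (use assms in \<open>simp_all add: test_functions_def\<close>)

lemma test_function_bump: "m > 0 \<Longrightarrow> cbox a b \<subseteq> \<Omega> \<Longrightarrow> bump m a b \<in> test_functions \<Omega>"
  by (rule test_functionsI[of _ "cbox a b"]) (use box_subset_cbox in \<open>auto simp: smooth_bump intro!: bump_eq_0\<close>)

lemma test_function_mult:
  assumes "\<psi> \<in> test_functions \<Omega>" "smooth f"
  shows "(\<lambda>x. \<psi> x * f x) \<in> test_functions \<Omega>"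
proof -
  obtain K where "compact K" "K \<subseteq> \<Omega>" "\<And>x. x \<notin> K \<Longrightarrow> \<psi> x = 0"
    using test_functionsE[OF assms(1)] by blast
  then show ?thesis
    by (intro test_functionsI[of _ K]) (use assms in \<open>auto intro: smooth_mult test_functions_smooth\<close>)
qed

lemma frechet_derivative_zero_outside:
  assumes "compact K" "\<And>x. x \<notin> K \<Longrightarrow> f x = 0" "x \<notin> K"
  shows "frechet_derivative f (at x) v = 0"
proof -
  have "open (-K)" using assms by (simp add: compact_imp_closed open_Compl)
  then have "(f has_derivative (\<lambda>v. 0)) (at x)"
    by (rule has_derivative_transform_within_open[where f="\<lambda>x. 0", rotated]) (use assms in auto)
  then show ?thesis by (rule frechet_derivative_eqI)
qed

lemma test_function_derivative:
  assumes "\<psi> \<in> test_functions \<Omega>"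
  shows "(\<lambda>x. frechet_derivative \<psi> (at x) v) \<in> test_functions \<Omega>"
proof -
  obtain K where K: "compact K" "K \<subseteq> \<Omega>" "\<And>x. x \<notin> K \<Longrightarrow> \<psi> x = 0"
    using test_functionsE[OF assms] by blast
  then show ?thesis
    by (intro test_functionsI[of _ K]) (use assms in \<open>auto intro: smooth_derivative test_functions_smooth
          frechet_derivative_zero_outside[OF K(1)]\<close>)
qed

lemma test_function_bounded:
  assumes "\<psi> \<in> test_functions \<Omega>"
  shows "\<exists>B. \<forall>x. \<bar>\<psi> x\<bar> \<le> B"
proof -
  obtain K where K: "compact K" "K \<subseteq> \<Omega>" "\<And>x. x \<notin> K \<Longrightarrow> \<psi> x = 0"
    using test_functionsE[OF assms] by blast
  have "compact (\<psi> ` K)"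
    using K assms by (intro compact_continuous_image smooth_continuous test_functions_smooth)
  then obtain B where B: "\<And>x. x \<in> K \<Longrightarrow> \<bar>\<psi> x\<bar> \<le> B"
    using compact_imp_bounded by (fastforce simp: bounded_iff)
  then have "\<bar>\<psi> x\<bar> \<le> max 0 B" for x
    using K(3)[of x] by (cases "x \<in> K") (auto simp: le_max_iff_disj)
  then show ?thesis by blast
qed

text \<open>For d > 0 a smooth function with value 0 at 0 and constant value 1 from d on; the factor
  exp (1 / d) normalises \<open>flat0 d\<close>. It is negative for t < 0 but bounded. Composed with
  a test function it gives a test function that equals 1 wherever the old one is at least d.\<close>

definition ramp :: "real \<Rightarrow> real \<Rightarrow> real" where
  "ramp d t = 1 - exp (1 / d) * flat0 (d - t)"

definition ramp' :: "real \<Rightarrow> real \<Rightarrow> real" where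
  "ramp' d t = exp (1 / d) * flat (flat_deriv 1) (d - t)"

lemma ramp_0: "d > 0 \<Longrightarrow> ramp d 0 = 0"
  by (simp add: ramp_def flat0_eq exp_minus)

lemma ramp_eq: "t \<ge> d \<Longrightarrow> ramp d t = 1" "t \<ge> d \<Longrightarrow> ramp' d t = 0"
  by (auto simp: ramp_def ramp'_def flat_def)

lemma ramp_has_derivative: "(ramp d has_real_derivative ramp' d t) (at t)"
proof -
  have "((\<lambda>t. flat0 (d - t)) has_real_derivative flat (flat_deriv 1) (d - t) * (-1)) (at t)"
    by (rule DERIV_chain2[OF flat_has_derivative]) (auto intro!: derivative_eq_intros)
  then show ?thesis
    unfolding ramp_def ramp'_def by (auto intro!: derivative_eq_intros)
qed

lemma smooth_ramp: "smooth f \<Longrightarrow> smooth (\<lambda>x. ramp d (f x))"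
  unfolding ramp_def by (intro smooth_diff smooth_cmult smooth_flat smooth_const)

lemma ramp_bounded: "\<exists>B. \<forall>t. \<bar>ramp d t\<bar> \<le> B"
proof -
  have "\<bar>ramp d t\<bar> \<le> 1 + exp (1 / d) * 1" for t
    unfolding ramp_def by (rule order_trans[OF abs_triangle_ineq4])
      (auto simp: abs_mult flat0_bounds)
  then show ?thesis by blast
qed

lemma ramp'_bounded: "\<exists>B. \<forall>t. \<bar>ramp' d t\<bar> \<le> B"
proof -
  obtain B where "\<And>t. \<bar>flat (flat_deriv 1) t\<bar> \<le> B" using flat_bounded by blast
  then have "\<bar>ramp' d t\<bar> \<le> exp (1 / d) * B" for t
    by (simp add: ramp'_def abs_mult)
  then show ?thesis by blast
qed

lemma bounded_derivative_lipschitz: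
  fixes f :: "real \<Rightarrow> real"
  assumes "\<And>t. (f has_real_derivative f' t) (at t)" "\<And>t. \<bar>f' t\<bar> \<le> B"
  shows "\<bar>f s - f t\<bar> \<le> B * \<bar>s - t\<bar>"
  using field_differentiable_bound[of UNIV f f' B s t] assms
  by (auto simp: has_field_derivative_at_within)

lemma ramp'_lipschitz: "\<exists>B. \<forall>s t. \<bar>ramp' d s - ramp' d t\<bar> \<le> B * \<bar>s - t\<bar>"
proof -
  obtain B where B: "\<And>t. \<bar>flat (flat_deriv (flat_deriv 1)) t\<bar> \<le> B" using flat_bounded by blast
  have L: "\<bar>flat (flat_deriv 1) s - flat (flat_deriv 1) t\<bar> \<le> B * \<bar>s - t\<bar>" for s t
    using bounded_derivative_lipschitz[OF flat_has_derivative B] .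
  have "\<bar>ramp' d s - ramp' d t\<bar> \<le> exp (1 / d) * B * \<bar>s - t\<bar>" for s t
  proof -
    have "\<bar>ramp' d s - ramp' d t\<bar> = exp (1 / d) * \<bar>flat (flat_deriv 1) (d - s) - flat (flat_deriv 1) (d - t)\<bar>"
      by (simp add: ramp'_def abs_mult flip: right_diff_distrib)
    also have "\<dots> \<le> exp (1 / d) * (B * \<bar>(d - s) - (d - t)\<bar>)"
      by (intro mult_left_mono L) auto
    finally show ?thesis by (simp add: mult.assoc abs_minus_commute)
  qed
  then show ?thesis by blast
qed

lemma test_function_ramp:
  assumes "\<psi> \<in> test_functions \<Omega>" "d > 0"
  shows "(\<lambda>x. ramp d (\<psi> x)) \<in> test_functions \<Omega>"
    and "frechet_derivative (\<lambda>x. ramp d (\<psi> x)) (at x) v = ramp' d (\<psi> x) * frechet_derivative \<psi> (at x) v"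
proof -
  obtain K where K: "compact K" "K \<subseteq> \<Omega>" "\<And>x. x \<notin> K \<Longrightarrow> \<psi> x = 0"
    using test_functionsE[OF assms(1)] by blast
  then show "(\<lambda>x. ramp d (\<psi> x)) \<in> test_functions \<Omega>"
    by (intro test_functionsI[of _ K]) (use assms in \<open>auto simp: ramp_0 intro: smooth_ramp test_functions_smooth\<close>)
  show "frechet_derivative (\<lambda>x. ramp d (\<psi> x)) (at x) v = ramp' d (\<psi> x) * frechet_derivative \<psi> (at x) v"
    using has_derivative_compose[OF smooth_has_derivative[OF test_functions_smooth[OF assms(1)]]
        ramp_has_derivative[unfolded has_field_derivative_def]]
    by (rule frechet_derivative_eqI)
qed

text \<open>A finite sum of bumps over boxes covering K has a positive minimum on K, and the ramp
  that reaches 1 at this minimum flattens the sum to 1 on K. The gradient vanishes on K as well,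
  because the derivative of the ramp is 0 from the minimum on.\<close>

lemma cutoff_exists:
  fixes \<Omega> K :: "'a::euclidean_space set"
  assumes "open \<Omega>" "compact K" "K \<subseteq> \<Omega>"
  obtains \<eta> where "\<eta> \<in> test_functions \<Omega>" "\<And>x. x \<in> K \<Longrightarrow> \<eta> x = 1"
    "\<And>x v. x \<in> K \<Longrightarrow> frechet_derivative \<eta> (at x) v = 0"
proof (cases "K = {}")
  case True
  have "(\<lambda>x. 0) \<in> test_functions \<Omega>"
    by (rule test_functionsI[of _ "{}"]) (auto simp: smooth_const)
  then show ?thesis using True that by blast
next
  case False
  have "\<exists>a b. x \<in> box a b \<and> cbox a b \<subseteq> \<Omega>" if "x \<in> K" for x
  proof -
    have "x \<in> \<Omega>" using assms(3) that by blast
    from open_contains_cbox[OF assms(1) this] show ?thesis by metis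
  qed
  then obtain a b where ab: "\<And>x. x \<in> K \<Longrightarrow> x \<in> box (a x) (b x) \<and> cbox (a x) (b x) \<subseteq> \<Omega>"
    by metis
  obtain T where T: "T \<subseteq> K" "finite T" "K \<subseteq> (\<Union>x\<in>T. box (a x) (b x))"
    by (rule compactE_image[OF assms(2), of K "\<lambda>x. box (a x) (b x)"]) (use ab in auto)
  define \<sigma> where "\<sigma> x = (\<Sum>y\<in>T. bump 1 (a y) (b y) x)" for x
  have \<sigma>: "\<sigma> \<in> test_functions \<Omega>"
  proof (rule test_functionsI[of _ "\<Union>y\<in>T. cbox (a y) (b y)"])
    show "smooth \<sigma>" unfolding \<sigma>_def by (intro smooth_sum smooth_bump)
    show "\<sigma> x = 0" if "x \<notin> (\<Union>y\<in>T. cbox (a y) (b y))" for x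
      unfolding \<sigma>_def using that box_subset_cbox by (intro sum.neutral) (auto intro!: bump_eq_0)
  qed (use T ab in \<open>auto intro!: compact_UN\<close>)
  obtain x0 where x0: "x0 \<in> K" "\<And>y. y \<in> K \<Longrightarrow> \<sigma> x0 \<le> \<sigma> y"
    using continuous_attains_inf[OF assms(2) False smooth_continuous[OF test_functions_smooth[OF \<sigma>]]] by blast
  have "\<sigma> x0 > 0"
  proof -
    obtain y where y: "y \<in> T" "x0 \<in> box (a y) (b y)" using x0 T by auto
    then show ?thesis
      unfolding \<sigma>_def using T by (intro sum_pos2[of _ y]) (auto simp: bump_bounds bump_pos_iff)
  qed
  from test_function_ramp[OF \<sigma> this] x0 ramp_eq show ?thesis
    by (intro that[of "\<lambda>x. ramp (\<sigma> x0) (\<sigma> x)"]) auto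
qed

section \<open>Square integrable functions\<close>

definition L2 :: "'a measure \<Rightarrow> ('a \<Rightarrow> real) set" where
  "L2 M = {f \<in> borel_measurable M. integrable M (\<lambda>x. (f x)\<^sup>2)}"

definition nrm :: "'a measure \<Rightarrow> ('a \<Rightarrow> real) \<Rightarrow> real" where
  "nrm M f = sqrt (\<integral>x. (f x)\<^sup>2 \<partial>M)"

lemma L2D [dest]: "f \<in> L2 M \<Longrightarrow> f \<in> borel_measurable M" "f \<in> L2 M \<Longrightarrow> integrable M (\<lambda>x. (f x)\<^sup>2)"
  by (auto simp: L2_def)

lemma L2_bound:
  assumes "f \<in> L2 M" "g \<in> borel_measurable M" "AE x in M. \<bar>g x\<bar> \<le> B * \<bar>f x\<bar>"
  shows "g \<in> L2 M"
proof -
  have "integrable M (\<lambda>x. B\<^sup>2 * (f x)\<^sup>2)" using assms(1) by (auto simp: L2_def)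
  then have "integrable M (\<lambda>x. (g x)\<^sup>2)"
  proof (rule Bochner_Integration.integrable_bound)
    show "AE x in M. norm ((g x)\<^sup>2) \<le> norm (B\<^sup>2 * (f x)\<^sup>2)"
      using assms(3)
    proof eventually_elim
      case (elim x)
      then have "\<bar>g x\<bar>\<^sup>2 \<le> (B * \<bar>f x\<bar>)\<^sup>2" by (intro power_mono) auto
      then show ?case by (simp add: power_mult_distrib)
    qed
  qed (use assms in measurable)
  then show ?thesis using assms by (simp add: L2_def)
qed

lemma L2_mult_integrable:
  assumes "f \<in> L2 M" "g \<in> L2 M"
  shows "integrable M (\<lambda>x. f x * g x)"
proof (rule Bochner_Integration.integrable_bound)
  show "integrable M (\<lambda>x. (f x)\<^sup>2 + (g x)\<^sup>2)" using assms by (auto simp: L2_def)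
  have "\<bar>a * b\<bar> \<le> a\<^sup>2 + b\<^sup>2" for a b :: real
  proof -
    have "0 \<le> (\<bar>a\<bar> - \<bar>b\<bar>)\<^sup>2 + \<bar>a\<bar>\<^sup>2 + \<bar>b\<bar>\<^sup>2" by simp
    then show ?thesis by (simp add: power2_diff abs_mult)
  qed
  then show "AE x in M. norm (f x * g x) \<le> norm ((f x)\<^sup>2 + (g x)\<^sup>2)"
    by (simp add: abs_of_nonneg)
qed (use assms in \<open>auto simp: L2_def\<close>)

lemma L2_cmult: "f \<in> L2 M \<Longrightarrow> (\<lambda>x. c * f x) \<in> L2 M"
  by (auto simp: L2_def power_mult_distrib)

lemma L2_add:
  assumes "f \<in> L2 M" "g \<in> L2 M"
  shows "(\<lambda>x. f x + g x) \<in> L2 M"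
proof -
  have "integrable M (\<lambda>x. (f x)\<^sup>2 + (g x)\<^sup>2 + 2 * (f x * g x))"
    using assms L2_mult_integrable[OF assms] by (auto simp: L2_def)
  then show ?thesis using assms by (auto simp: L2_def power2_sum algebra_simps)
qed

lemma L2_diff: "f \<in> L2 M \<Longrightarrow> g \<in> L2 M \<Longrightarrow> (\<lambda>x. f x - g x) \<in> L2 M"
  using L2_add[OF _ L2_cmult[of g M "-1"]] by simp

lemma L2_mult_bounded:
  "f \<in> L2 M \<Longrightarrow> g \<in> borel_measurable M \<Longrightarrow> (\<And>x. \<bar>g x\<bar> \<le> B) \<Longrightarrow> (\<lambda>x. g x * f x) \<in> L2 M"
  by (rule L2_bound[of f _ _ B]) (auto simp: abs_mult intro!: mult_right_mono)

lemma nrm_nonneg: "nrm M f \<ge> 0"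
  by (simp add: nrm_def)

lemma nrm_power2: "(nrm M f)\<^sup>2 = (\<integral>x. (f x)\<^sup>2 \<partial>M)"
  by (simp add: nrm_def)

lemma nrm_cmult: "nrm M (\<lambda>x. c * f x) = \<bar>c\<bar> * nrm M f"
  by (simp add: nrm_def power_mult_distrib real_sqrt_mult)

lemma nrm_minus_commute: "nrm M (\<lambda>x. f x - g x) = nrm M (\<lambda>x. g x - f x)"
  by (simp add: nrm_def power2_commute)

lemma nrm_mono:
  assumes "g \<in> L2 M" "AE x in M. \<bar>f x\<bar> \<le> \<bar>g x\<bar>"
  shows "nrm M f \<le> nrm M g"
  unfolding nrm_def
proof (rule real_sqrt_le_mono, rule integral_mono_AE')
  show "AE x in M. (f x)\<^sup>2 \<le> (g x)\<^sup>2"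
    using assms(2) by eventually_elim (simp add: abs_le_square_iff)
qed (use assms in auto)

lemma nrm_cong_AE:
  assumes "f \<in> borel_measurable M" "g \<in> borel_measurable M" "AE x in M. f x = g x"
  shows "nrm M f = nrm M g"
proof -
  have "(\<integral>x. (f x)\<^sup>2 \<partial>M) = (\<integral>x. (g x)\<^sup>2 \<partial>M)"
    by (rule integral_cong_AE) (use assms in auto)
  then show ?thesis by (simp add: nrm_def)
qed

text \<open>The integral of (f - t g)^2 is a nonnegative quadratic polynomial in t. The value t = B
  / C gives the discriminant inequality; if C = 0 the polynomial is affine, and t = (A + 1) / B
  would make it negative unless B = 0.\<close>

lemma Cauchy_Schwarz_L2:
  assumes "f \<in> L2 M" "g \<in> L2 M"
  shows "\<bar>\<integral>x. f x * g x \<partial>M\<bar> \<le> nrm M f * nrm M g"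
proof -
  define A B C where "A = (\<integral>x. (f x)\<^sup>2 \<partial>M)" "B = (\<integral>x. f x * g x \<partial>M)" "C = (\<integral>x. (g x)\<^sup>2 \<partial>M)"
  note int = L2_mult_integrable[OF assms] L2D(2)[OF assms(1)] L2D(2)[OF assms(2)]
  have q: "0 \<le> A - 2 * t * B + t\<^sup>2 * C" for t
  proof -
    have "0 \<le> (\<integral>x. (f x - t * g x)\<^sup>2 \<partial>M)" by simp
    also have "\<dots> = (\<integral>x. (f x)\<^sup>2 - 2 * t * (f x * g x) + t\<^sup>2 * (g x)\<^sup>2 \<partial>M)"
      by (simp add: power2_diff power_mult_distrib algebra_simps)
    also have "\<dots> = A - 2 * t * B + t\<^sup>2 * C"
      using int by (simp add: A_B_C_def)
    finally show ?thesis .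
  qed
  have "C \<ge> 0" "A \<ge> 0" by (auto simp: A_B_C_def)
  have "B\<^sup>2 \<le> A * C"
  proof (cases "C = 0")
    case True
    have "B = 0"
    proof (rule ccontr)
      assume "B \<noteq> 0"
      have "0 \<le> A - 2 * ((A + 1) / B) * B" using q[of "(A + 1) / B"] True by simp
      also have "\<dots> = - A - 2" using \<open>B \<noteq> 0\<close> by (simp add: field_simps)
      finally show False using \<open>A \<ge> 0\<close> by simp
    qed
    then show ?thesis using True by simp
  next
    case False
    then show ?thesis using q[of "B / C"] \<open>C \<ge> 0\<close>
      by (simp add: field_simps power2_eq_square)
  qed
  then have "sqrt (B\<^sup>2) \<le> sqrt (A * C)" by (rule real_sqrt_le_mono)
  then show ?thesis by (simp add: nrm_def A_B_C_def real_sqrt_mult)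
qed

lemma nrm_triangle:
  assumes "f \<in> L2 M" "g \<in> L2 M"
  shows "nrm M (\<lambda>x. f x + g x) \<le> nrm M f + nrm M g"
proof (rule power2_le_imp_le)
  have "(nrm M (\<lambda>x. f x + g x))\<^sup>2 = (\<integral>x. (f x)\<^sup>2 + (g x)\<^sup>2 + 2 * (f x * g x) \<partial>M)"
    by (simp add: nrm_power2 power2_sum algebra_simps)
  also have "\<dots> = (nrm M f)\<^sup>2 + (nrm M g)\<^sup>2 + 2 * (\<integral>x. f x * g x \<partial>M)"
    using L2_mult_integrable[OF assms] assms by (auto simp: L2_def nrm_power2)
  also have "\<dots> \<le> (nrm M f + nrm M g)\<^sup>2"
    using Cauchy_Schwarz_L2[OF assms] by (auto simp: power2_sum)
  finally show "(nrm M (\<lambda>x. f x + g x))\<^sup>2 \<le> (nrm M f + nrm M g)\<^sup>2" .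
qed (simp add: nrm_nonneg)

lemma nrm_triangle3:
  assumes "(\<lambda>x. f x - h x) \<in> L2 M" "(\<lambda>x. h x - g x) \<in> L2 M"
  shows "nrm M (\<lambda>x. f x - g x) \<le> nrm M (\<lambda>x. f x - h x) + nrm M (\<lambda>x. h x - g x)"
  using nrm_triangle[OF assms] by simp

section \<open>Convergence in mean square\<close>

definition L2_tendsto :: "'a measure \<Rightarrow> (nat \<Rightarrow> 'a \<Rightarrow> real) \<Rightarrow> ('a \<Rightarrow> real) \<Rightarrow> bool" where
  "L2_tendsto M F f \<longleftrightarrow> f \<in> L2 M \<and> (\<forall>m. F m \<in> L2 M) \<and> (\<lambda>m. nrm M (\<lambda>x. F m x - f x)) \<longlonglongrightarrow> 0"

lemma L2_tendstoD:
  assumes "L2_tendsto M F f"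
  shows "f \<in> L2 M" "F m \<in> L2 M" "(\<lambda>m. nrm M (\<lambda>x. F m x - f x)) \<longlonglongrightarrow> 0"
    "f \<in> borel_measurable M" "F m \<in> borel_measurable M"
  using assms by (auto simp: L2_tendsto_def)

lemma L2_tendsto_integral:
  assumes "L2_tendsto M F f" "g \<in> L2 M"
  shows "(\<lambda>m. \<integral>x. F m x * g x \<partial>M) \<longlonglongrightarrow> (\<integral>x. f x * g x \<partial>M)"
proof -
  note F = L2_tendstoD[OF assms(1)]
  have "(\<lambda>m. (\<integral>x. F m x * g x \<partial>M) - (\<integral>x. f x * g x \<partial>M)) \<longlonglongrightarrow> 0"
  proof (rule Lim_null_comparison)
    have "(\<integral>x. F m x * g x \<partial>M) - (\<integral>x. f x * g x \<partial>M) = (\<integral>x. (F m x - f x) * g x \<partial>M)" for m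
      using L2_mult_integrable F assms(2) by (subst Bochner_Integration.integral_diff[symmetric]) (auto simp: algebra_simps)
    then show "\<forall>\<^sub>F m in sequentially. norm ((\<integral>x. F m x * g x \<partial>M) - (\<integral>x. f x * g x \<partial>M))
        \<le> nrm M (\<lambda>x. F m x - f x) * nrm M g"
      using Cauchy_Schwarz_L2[OF L2_diff[OF F(2,1)] assms(2)] by simp
    show "(\<lambda>m. nrm M (\<lambda>x. F m x - f x) * nrm M g) \<longlonglongrightarrow> 0"
      using tendsto_mult_right[OF F(3), of "nrm M g"] by simp
  qed
  then show ?thesis by (simp add: LIM_zero_iff)
qed

lemma L2_tendsto_null_bound:
  assumes "\<And>m. F m \<in> L2 M" "f \<in> L2 M" "b \<longlonglongrightarrow> 0" "\<And>m. nrm M (\<lambda>x. F m x - f x) \<le> b m"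
  shows "L2_tendsto M F f"
  unfolding L2_tendsto_def
  using assms by (auto intro!: Lim_null_comparison[OF _ assms(3)] simp: nrm_nonneg)

lemma L2_tendsto_add:
  assumes "L2_tendsto M F f" "L2_tendsto M G g"
  shows "L2_tendsto M (\<lambda>m x. F m x + G m x) (\<lambda>x. f x + g x)"
proof (rule L2_tendsto_null_bound)
  note F = L2_tendstoD[OF assms(1)] and G = L2_tendstoD[OF assms(2)]
  show "(\<lambda>m. nrm M (\<lambda>x. F m x - f x) + nrm M (\<lambda>x. G m x - g x)) \<longlonglongrightarrow> 0"
    using tendsto_add[OF F(3) G(3)] by simp
  show "nrm M (\<lambda>x. F m x + G m x - (f x + g x)) \<le> nrm M (\<lambda>x. F m x - f x) + nrm M (\<lambda>x. G m x - g x)" for m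
    using nrm_triangle[OF L2_diff[OF F(2,1)] L2_diff[OF G(2,1)], of m m] by (simp add: algebra_simps)
qed (use L2_tendstoD[OF assms(1)] L2_tendstoD[OF assms(2)] in \<open>auto intro: L2_add\<close>)

text \<open>The difference of h (F m) and h (f) is dominated by a multiple of F m - f, so membership
  in \<open>L2\<close> need only be known for the limit. The value of h at 0 is left open, which
  allows functions such as \<open>ramp' d\<close> on a domain of finite measure.\<close>

lemma L2_tendsto_lipschitz:
  assumes "L2_tendsto M F f" "h \<in> borel_measurable borel" "\<And>s t. \<bar>h s - h t\<bar> \<le> B * \<bar>s - t\<bar>"
    and "(\<lambda>x. h (f x)) \<in> L2 M"
  shows "L2_tendsto M (\<lambda>m x. h (F m x)) (\<lambda>x. h (f x))"
proof (rule L2_tendsto_null_bound)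
  note F = L2_tendstoD[OF assms(1)]
  note [measurable] = F(4,5) assms(2)
  have d: "(\<lambda>x. B * (F m x - f x)) \<in> L2 M" for m
    using F by (intro L2_cmult L2_diff)
  have le: "\<bar>h s - h t\<bar> \<le> \<bar>B * (s - t)\<bar>" for s t
    using order_trans[OF assms(3) mult_right_mono[OF abs_ge_self abs_ge_zero]] by (simp add: abs_mult)
  show "(\<lambda>x. h (F m x)) \<in> L2 M" for m
  proof -
    have "(\<lambda>x. h (F m x) - h (f x)) \<in> L2 M"
      by (rule L2_bound[OF d[of m], of _ 1]) (use le in auto)
    from L2_add[OF this assms(4)] show ?thesis by simp
  qed
  show "nrm M (\<lambda>x. h (F m x) - h (f x)) \<le> \<bar>B\<bar> * nrm M (\<lambda>x. F m x - f x)" for m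
    using nrm_mono[OF d[of m], of "\<lambda>x. h (F m x) - h (f x)"] le by (simp add: nrm_cmult)
  show "(\<lambda>m. \<bar>B\<bar> * nrm M (\<lambda>x. F m x - f x)) \<longlonglongrightarrow> 0"
    using tendsto_mult_left[OF F(3), of "\<bar>B\<bar>"] by simp
qed (use assms in auto)

text \<open>Split \<open>g\<close> at a large level; the part below it is bounded.\<close>

lemma nrm_bounded_mult_null:
  assumes g: "g \<in> L2 M" and F: "\<And>m. F m \<in> L2 M" "\<And>m x. \<bar>F m x\<bar> \<le> C" "(\<lambda>m. nrm M (F m)) \<longlonglongrightarrow> 0"
  shows "(\<lambda>m. nrm M (\<lambda>x. F m x * g x)) \<longlonglongrightarrow> 0"
proof -
  note [measurable] = L2D(1)[OF g] L2D(1)[OF F(1)]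
  note gi = L2D(2)[OF g] and Fi = L2D(2)[OF F(1)]
  have C: "C \<ge> 0" using F(2)[of 0 undefined] by linarith
  have tail: "(\<lambda>N::nat. \<integral>x. (if \<bar>g x\<bar> > real N then (g x)\<^sup>2 else 0) \<partial>M) \<longlonglongrightarrow> (\<integral>x. 0 \<partial>M)"
  proof (rule integral_dominated_convergence[where w="\<lambda>x. (g x)\<^sup>2"])
    show "AE x in M. (\<lambda>N. if \<bar>g x\<bar> > real N then (g x)\<^sup>2 else 0) \<longlonglongrightarrow> 0"
    proof (rule AE_I2)
      fix x
      obtain N0 :: nat where "\<bar>g x\<bar> \<le> real N0" using real_arch_simple by blast
      then have "\<forall>\<^sub>F N in sequentially. (if \<bar>g x\<bar> > real N then (g x)\<^sup>2 else 0) = 0"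
        by (intro eventually_sequentiallyI[of N0]) (auto simp: not_less intro: order_trans)
      then show "(\<lambda>N. if \<bar>g x\<bar> > real N then (g x)\<^sup>2 else 0) \<longlonglongrightarrow> 0"
        by (rule tendsto_eventually)
    qed
  qed (use gi in auto)
  have "(\<lambda>m. (nrm M (\<lambda>x. F m x * g x))\<^sup>2) \<longlonglongrightarrow> 0"
    unfolding tendsto_iff
  proof (intro allI impI)
    fix e :: real assume e: "e > 0"
    have "(\<lambda>N::nat. C\<^sup>2 * (\<integral>x. (if \<bar>g x\<bar> > real N then (g x)\<^sup>2 else 0) \<partial>M)) \<longlonglongrightarrow> 0"
      using tendsto_mult_left[OF tail, of "C\<^sup>2"] by simp
    then have "\<forall>\<^sub>F N in sequentially. C\<^sup>2 * (\<integral>x. (if \<bar>g x\<bar> > real N then (g x)\<^sup>2 else 0) \<partial>M) < e / 2"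
      by (rule order_tendstoD) (use e in auto)
    then obtain N :: nat where N: "C\<^sup>2 * (\<integral>x. (if \<bar>g x\<bar> > real N then (g x)\<^sup>2 else 0) \<partial>M) < e / 2"
      by (auto simp: eventually_sequentially)
    let ?t = "\<lambda>x. if \<bar>g x\<bar> > real N then (g x)\<^sup>2 else 0"
    have ti: "integrable M ?t"
      by (rule Bochner_Integration.integrable_bound[OF gi]) auto
    have "(\<lambda>m. (real N)\<^sup>2 * (nrm M (F m))\<^sup>2) \<longlonglongrightarrow> 0"
      using tendsto_mult_left[OF tendsto_power[OF F(3), of 2], of "(real N)\<^sup>2"] by simp
    then have "\<forall>\<^sub>F m in sequentially. (real N)\<^sup>2 * (nrm M (F m))\<^sup>2 < e / 2"
      by (rule order_tendstoD) (use e in auto)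
    then show "\<forall>\<^sub>F m in sequentially. dist ((nrm M (\<lambda>x. F m x * g x))\<^sup>2) 0 < e"
    proof eventually_elim
      case (elim m)
      have pt: "(F m x * g x)\<^sup>2 \<le> C\<^sup>2 * ?t x + (real N)\<^sup>2 * (F m x)\<^sup>2" for x
      proof (cases "\<bar>g x\<bar> > real N")
        case True
        have "(F m x)\<^sup>2 \<le> C\<^sup>2" using F(2)[of m x] C by (simp add: abs_le_square_iff[symmetric])
        then have "(F m x)\<^sup>2 * (g x)\<^sup>2 \<le> C\<^sup>2 * (g x)\<^sup>2" by (intro mult_right_mono) auto
        then have "(F m x)\<^sup>2 * (g x)\<^sup>2 \<le> C\<^sup>2 * (g x)\<^sup>2 + (real N)\<^sup>2 * (F m x)\<^sup>2"
          by (rule order_trans) simp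
        then show ?thesis using True by (simp add: power_mult_distrib)
      next
        case False
        then have "(g x)\<^sup>2 \<le> (real N)\<^sup>2" by (simp add: abs_le_square_iff[symmetric])
        then have "(F m x)\<^sup>2 * (g x)\<^sup>2 \<le> (F m x)\<^sup>2 * (real N)\<^sup>2" by (intro mult_left_mono) auto
        then show ?thesis using False by (simp add: power_mult_distrib mult.commute)
      qed
      have "(\<integral>x. (F m x * g x)\<^sup>2 \<partial>M) \<le> (\<integral>x. C\<^sup>2 * ?t x + (real N)\<^sup>2 * (F m x)\<^sup>2 \<partial>M)"
        by (rule integral_mono') (use pt ti Fi in auto)
      also have "\<dots> = C\<^sup>2 * (\<integral>x. ?t x \<partial>M) + (real N)\<^sup>2 * (nrm M (F m))\<^sup>2"
        using ti Fi by (simp add: nrm_power2)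
      also have "\<dots> < e" using N elim by linarith
      finally show ?case by (simp add: nrm_power2)
    qed
  qed
  then have "(\<lambda>m. sqrt ((nrm M (\<lambda>x. F m x * g x))\<^sup>2)) \<longlonglongrightarrow> sqrt 0" by (rule tendsto_real_sqrt)
  then show ?thesis by (simp add: nrm_nonneg)
qed

text \<open>The difference of the products is F m (G m - g) + (F m - f) g. The first term is
  controlled by the bound C. In the second, g need not be bounded, and mean square convergence of F
  m together with the common bound suffices.\<close>

lemma L2_tendsto_mult_bounded:
  assumes "L2_tendsto M F f" "L2_tendsto M G g"
    and "\<And>m x. \<bar>F m x\<bar> \<le> C" "\<And>x. \<bar>f x\<bar> \<le> C"
  shows "L2_tendsto M (\<lambda>m x. F m x * G m x) (\<lambda>x. f x * g x)"
proof (rule L2_tendsto_null_bound)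
  note F = L2_tendstoD[OF assms(1)] and G = L2_tendstoD[OF assms(2)]
  have C: "C \<ge> 0" using assms(4)[of undefined] by linarith
  have bd: "\<bar>F m x - f x\<bar> \<le> 2 * C" for m x
    using assms(3)[of m x] assms(4)[of x] by linarith
  have "(\<lambda>m. nrm M (\<lambda>x. (F m x - f x) * g x)) \<longlonglongrightarrow> 0"
    by (rule nrm_bounded_mult_null[OF G(1) L2_diff[OF F(2,1)] bd F(3)])
  from tendsto_add[OF tendsto_mult_left[OF G(3), of C] this]
  show "(\<lambda>m. C * nrm M (\<lambda>x. G m x - g x) + nrm M (\<lambda>x. (F m x - f x) * g x)) \<longlonglongrightarrow> 0" by simp
  fix m
  show FG: "(\<lambda>x. F m x * G m x) \<in> L2 M" using F G assms(3) by (intro L2_mult_bounded) auto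
  show fg: "(\<lambda>x. f x * g x) \<in> L2 M" using F G assms(4) by (intro L2_mult_bounded) auto
  have fg': "(\<lambda>x. F m x * g x) \<in> L2 M" using F G assms(3) by (intro L2_mult_bounded) auto
  have "nrm M (\<lambda>x. F m x * G m x - F m x * g x) \<le> nrm M (\<lambda>x. C * (G m x - g x))"
  proof (rule nrm_mono)
    show "AE x in M. \<bar>F m x * G m x - F m x * g x\<bar> \<le> \<bar>C * (G m x - g x)\<bar>"
    proof (rule AE_I2)
      fix x
      have "\<bar>F m x * G m x - F m x * g x\<bar> = \<bar>F m x\<bar> * \<bar>G m x - g x\<bar>"
        by (simp add: abs_mult flip: right_diff_distrib)
      also have "\<dots> \<le> C * \<bar>G m x - g x\<bar>" by (intro mult_right_mono assms(3)) auto
      finally show "\<bar>F m x * G m x - F m x * g x\<bar> \<le> \<bar>C * (G m x - g x)\<bar>" using C by (simp add: abs_mult)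
    qed
  qed (intro L2_cmult L2_diff G)
  moreover have "nrm M (\<lambda>x. F m x * g x - f x * g x) = nrm M (\<lambda>x. (F m x - f x) * g x)"
    by (simp add: left_diff_distrib)
  ultimately show "nrm M (\<lambda>x. F m x * G m x - f x * g x)
      \<le> C * nrm M (\<lambda>x. G m x - g x) + nrm M (\<lambda>x. (F m x - f x) * g x)"
    using nrm_triangle3[OF L2_diff[OF FG fg'] L2_diff[OF fg' fg]] C by (simp add: nrm_cmult)
qed

section \<open>Mollification\<close>

lemma uniformly_continuous_compact_support:
  fixes f :: "'a::euclidean_space \<Rightarrow> 'b::real_normed_vector"
  assumes f: "continuous_on UNIV f" and K: "compact K" "\<And>x. x \<notin> K \<Longrightarrow> f x = 0"
  shows "uniformly_continuous_on UNIV f"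
proof -
  obtain R where R: "\<And>x. x \<in> K \<Longrightarrow> norm x \<le> R"
    using K(1) compact_imp_bounded bounded_iff by metis
  have u: "uniformly_continuous_on (cball 0 (R + 2)) f"
    using f by (intro compact_uniformly_continuous) (auto intro: continuous_on_subset)
  show ?thesis
    unfolding uniformly_continuous_on_def
  proof (intro allI impI)
    fix e :: real assume e: "e > 0"
    obtain d where d: "d > 0" "\<And>x y. norm x \<le> R + 2 \<Longrightarrow> norm y \<le> R + 2 \<Longrightarrow> dist y x < d \<Longrightarrow> dist (f y) (f x) < e"
      using u e unfolding uniformly_continuous_on_def Ball_def mem_cball dist_0_norm by metis
    have "dist (f y) (f x) < e" if "dist y x < min d 1" for x y
    proof (cases "norm x \<le> R + 1")
      case True
      have "norm y \<le> norm x + dist y x" by (metis dist_norm norm_triangle_sub)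
      then show ?thesis using True that by (intro d(2)) auto
    next
      case False
      have "norm x \<le> norm y + dist y x" by (metis dist_commute dist_norm norm_triangle_sub)
      then have "norm y > R" "norm x > R" using False that by auto
      then have "f y = 0" "f x = 0" using R K(2) by (meson not_less)+
      then show ?thesis using e by simp
    qed
    then show "\<exists>d>0. \<forall>x\<in>UNIV. \<forall>x'\<in>UNIV. dist x' x < d \<longrightarrow> dist (f x') (f x) < e"
      using d(1) by (intro exI[of _ "min d 1"]) auto
  qed
qed

text \<open>The gradient G is continuous with compact support, hence uniformly continuous, and the
  mean value theorem on the segment from x to x + h compares G at two points of distance at most
  norm h. The uniformity in x is what makes the remainder integrable against other
  functions.\<close>

lemma uniformly_differentiable:
  fixes g :: "'a::euclidean_space \<Rightarrow> real"
  assumes g: "C_k 1 g" and K: "compact K" "\<And>x. x \<notin> K \<Longrightarrow> g x = 0" and e: "e > 0"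
  obtains d where "d > 0"
    "\<And>x h. norm h < d \<Longrightarrow> \<bar>g (x + h) - g x - frechet_derivative g (at x) h\<bar> \<le> e * norm h"
proof -
  have g1: "C_k (Suc 0) g" using g by simp
  define G where "G x = (\<Sum>b\<in>Basis. frechet_derivative g (at x) b *\<^sub>R b)" for x
  have lin: "bounded_linear (frechet_derivative g (at x))" for x
    by (rule has_derivative_bounded_linear[OF C_kD(1)[OF g1]])
  have G: "frechet_derivative g (at x) h = G x \<bullet> h" for x h
  proof -
    have "frechet_derivative g (at x) h = frechet_derivative g (at x) (\<Sum>b\<in>Basis. (h \<bullet> b) *\<^sub>R b)"
      by (simp add: euclidean_representation)
    also have "\<dots> = G x \<bullet> h"
      using lin[of x, THEN bounded_linear.linear]
      by (simp add: G_def linear_sum linear_scale inner_sum_left mult.commute) (simp add: inner_commute)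
    finally show ?thesis .
  qed
  have Gc: "uniformly_continuous_on UNIV G"
  proof (rule uniformly_continuous_compact_support[OF _ K(1)])
    show "continuous_on UNIV G"
      unfolding G_def using C_kD(2)[OF g1] by (intro continuous_intros) (auto dest: C_k_continuous)
    show "G x = 0" if "x \<notin> K" for x
      unfolding G_def using frechet_derivative_zero_outside[OF K that] by simp
  qed
  then obtain d where d: "d > 0" "\<And>x y. dist y x < d \<Longrightarrow> dist (G y) (G x) < e"
    using e unfolding uniformly_continuous_on_def by (metis UNIV_I)
  show thesis
  proof (rule that[OF d(1)])
    fix x h :: 'a assume h: "norm h < d"
    have "\<exists>t\<in>{0<..<1}. g (x + 1 *\<^sub>R h) - g (x + 0 *\<^sub>R h) = G (x + t *\<^sub>R h) \<bullet> ((1 - 0) *\<^sub>R h)"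
    proof -
      have "((\<lambda>t. g (x + t *\<^sub>R h)) has_derivative (\<lambda>s. G (x + t *\<^sub>R h) \<bullet> (s *\<^sub>R h))) (at t)" for t
      proof -
        have "((\<lambda>t. x + t *\<^sub>R h) has_derivative (\<lambda>s. s *\<^sub>R h)) (at t)"
          by (auto intro!: derivative_eq_intros)
        from has_derivative_compose[OF this C_kD(1)[OF g1]] show ?thesis by (simp add: G)
      qed
      then have "\<exists>t\<in>{0<..<1}. g (x + 1 *\<^sub>R h) - g (x + 0 *\<^sub>R h) = G (x + t *\<^sub>R h) \<bullet> ((1 - 0) *\<^sub>R h)"
        by (intro mvt_simple) (auto intro: has_derivative_at_withinI)
      then show ?thesis .
    qed
    then obtain t where t: "0 < t" "t < 1" "g (x + h) - g x = G (x + t *\<^sub>R h) \<bullet> h" by auto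
    have "norm (t *\<^sub>R h) \<le> 1 * norm h" unfolding norm_scaleR using t by (intro mult_right_mono) auto
    then have "norm (G (x + t *\<^sub>R h) - G x) \<le> e"
      using d(2)[of "x + t *\<^sub>R h" x] h by (simp add: dist_norm)
    then have "\<bar>(G (x + t *\<^sub>R h) - G x) \<bullet> h\<bar> \<le> e * norm h"
      by (meson Cauchy_Schwarz_ineq2 mult_right_mono norm_ge_zero order_trans)
    then show "\<bar>g (x + h) - g x - frechet_derivative g (at x) h\<bar> \<le> e * norm h"
      by (simp add: t G inner_diff_left)
  qed
qed

lemma integrable_compact_support:
  fixes f :: "'a::euclidean_space \<Rightarrow> real"
  assumes "continuous_on UNIV f" "compact K" "\<And>x. x \<notin> K \<Longrightarrow> f x = 0"
  shows "integrable lborel f"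
proof -
  have "set_integrable lborel K f"
    unfolding set_integrable_def
    using assms by (intro borel_integrable_compact) (auto intro: continuous_on_subset)
  moreover have "(\<lambda>x. indicator K x *\<^sub>R f x) = f"
    using assms(3) by (auto simp: indicator_def fun_eq_iff)
  ultimately show ?thesis by (simp add: set_integrable_def)
qed

lemma lborel_integral_translate:
  fixes f :: "'a::euclidean_space \<Rightarrow> real"
  assumes [measurable]: "f \<in> borel_measurable borel"
  shows "(\<integral>x. f (x + a) \<partial>lborel) = (\<integral>x. f x \<partial>lborel)"
    and "integrable lborel (\<lambda>x. f (x + a)) \<longleftrightarrow> integrable lborel f"
proof -
  have "(\<integral>x. f x \<partial>distr lborel borel ((+) a)) = (\<integral>x. f (a + x) \<partial>lborel)"
    by (intro integral_distr) auto
  then show "(\<integral>x. f (x + a) \<partial>lborel) = (\<integral>x. f x \<partial>lborel)"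
    by (simp add: lborel_distr_plus add.commute)
  have "integrable (distr lborel borel ((+) a)) f \<longleftrightarrow> integrable lborel (\<lambda>x. f (a + x))"
    by (intro integrable_distr_eq) auto
  then show "integrable lborel (\<lambda>x. f (x + a)) \<longleftrightarrow> integrable lborel f"
    by (simp add: lborel_distr_plus add.commute)
qed

lemma lborel_nn_integral_reflect:
  fixes f :: "'a::euclidean_space \<Rightarrow> ennreal"
  assumes [measurable]: "f \<in> borel_measurable borel"
  shows "(\<integral>\<^sup>+x. f (a - x) \<partial>lborel) = (\<integral>\<^sup>+x. f x \<partial>lborel)"
    and "(\<integral>\<^sup>+x. f (x - a) \<partial>lborel) = (\<integral>\<^sup>+x. f x \<partial>lborel)"
proof -
  have "(\<integral>\<^sup>+x. f x \<partial>lborel) = (\<integral>\<^sup>+x. f (a + (-1) *\<^sub>R x) \<partial>lborel)"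
    by (subst lborel_affine[of "-1" a]) (auto simp: nn_integral_density nn_integral_distr)
  then show "(\<integral>\<^sup>+x. f (a - x) \<partial>lborel) = (\<integral>\<^sup>+x. f x \<partial>lborel)" by simp
  have "(\<integral>\<^sup>+x. f x \<partial>lborel) = (\<integral>\<^sup>+x. f (- a + 1 *\<^sub>R x) \<partial>lborel)"
    by (subst lborel_affine[of 1 "-a"]) (auto simp: nn_integral_density nn_integral_distr)
  then show "(\<integral>\<^sup>+x. f (x - a) \<partial>lborel) = (\<integral>\<^sup>+x. f x \<partial>lborel)" by simp
qed

lemma lborel_integral_reflect:
  fixes f :: "'a::euclidean_space \<Rightarrow> real"
  assumes [measurable]: "f \<in> borel_measurable borel"
  shows "(\<integral>x. f (a - x) \<partial>lborel) = (\<integral>x. f x \<partial>lborel)"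
    and "integrable lborel f \<Longrightarrow> integrable lborel (\<lambda>x. f (a - x))"
proof -
  have D: "lborel = distr lborel borel (\<lambda>x::'a. a - x)"
    using lborel_affine[of "-1" a] by (simp add: density_1)
  show "(\<integral>x. f (a - x) \<partial>lborel) = (\<integral>x. f x \<partial>lborel)"
    by (subst (2) D, subst integral_distr) auto
  show "integrable lborel f \<Longrightarrow> integrable lborel (\<lambda>x. f (a - x))"
    by (subst (asm) D, subst (asm) integrable_distr_eq) auto
qed

text \<open>Translation invariance kills the difference quotient, which converges uniformly.\<close>

lemma integral_derivative_compact_support:
  fixes f :: "'a::euclidean_space \<Rightarrow> real"
  assumes f: "C_k 1 f" and K: "compact K" "\<And>x. x \<notin> K \<Longrightarrow> f x = 0"
  shows "(\<integral>x. frechet_derivative f (at x) v \<partial>lborel) = 0"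
proof -
  have f1: "C_k (Suc 0) f" using f by simp
  define I where "I = (\<integral>x. frechet_derivative f (at x) v \<partial>lborel)"
  obtain R where R: "\<And>x. x \<in> K \<Longrightarrow> norm x \<le> R"
    using K(1) compact_imp_bounded bounded_iff by metis
  define V where "V = measure lborel (cball (0::'a) (R + norm v))"
  have D0: "frechet_derivative f (at x) v = 0" if "x \<notin> K" for x
    using frechet_derivative_zero_outside[OF K that] .
  have fi: "integrable lborel f"
    using C_k_continuous[OF f] K by (rule integrable_compact_support)
  have Di: "integrable lborel (\<lambda>x. frechet_derivative f (at x) v)"
    using C_kD(2)[OF f1, THEN C_k_continuous] K(1) D0 by (rule integrable_compact_support)
  have [measurable]: "f \<in> borel_measurable borel"
    using C_k_continuous[OF f] by (rule borel_measurable_continuous_onI)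
  have bound: "\<bar>I\<bar> \<le> e * (norm v * V)" if e: "e > 0" for e
  proof -
    obtain d where d: "d > 0"
      "\<And>x h. norm h < d \<Longrightarrow> \<bar>f (x + h) - f x - frechet_derivative f (at x) h\<bar> \<le> e * norm h"
      using uniformly_differentiable[OF f K e] by metis
    \<comment> \<open>The quotient makes t v shorter than d; the bound 1 keeps the support of the
      remainder inside a ball that does not depend on e.\<close>
    define t where "t = min 1 (d / (2 * (norm v + 1)))"
    have t: "0 < t" "t \<le> 1" "norm (t *\<^sub>R v) < d"
    proof -
      show "0 < t" "t \<le> 1" using d(1) by (auto simp: t_def add_nonneg_pos)
      then have "norm (t *\<^sub>R v) \<le> d / (2 * (norm v + 1)) * norm v"
        unfolding norm_scaleR by (intro mult_right_mono) (auto simp: t_def)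
      also have "\<dots> < d" using d(1) by (simp add: field_simps add_pos_nonneg) (simp add: add_nonneg_pos)
      finally show "norm (t *\<^sub>R v) < d" .
    qed
    have lin: "frechet_derivative f (at x) (t *\<^sub>R v) = t * frechet_derivative f (at x) v" for x
      using C_kD(1)[OF f1, of x, THEN has_derivative_bounded_linear, THEN bounded_linear.linear]
      by (simp add: linear_scale)
    let ?F = "\<lambda>x. f (x + t *\<^sub>R v) - f x - t * frechet_derivative f (at x) v"
    have Fi: "integrable lborel ?F"
      using fi Di by (auto simp: lborel_integral_translate)
    have "t * I = - (\<integral>x. ?F x \<partial>lborel)"
      using fi Di by (simp add: lborel_integral_translate I_def)
    then have "\<bar>t * I\<bar> \<le> (\<integral>x. \<bar>?F x\<bar> \<partial>lborel)" by simp
    also have "\<dots> \<le> (\<integral>x. e * norm (t *\<^sub>R v) * indicator (cball (0::'a) (R + norm v)) x \<partial>lborel)"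
    proof (rule Bochner_Integration.integral_mono)
      show "integrable lborel (\<lambda>x. e * norm (t *\<^sub>R v) * indicator (cball (0::'a) (R + norm v)) x)"
        using emeasure_bounded_finite[OF bounded_cball] by (intro integrable_mult_right integrable_real_indicator) auto
      show "\<bar>?F x\<bar> \<le> e * norm (t *\<^sub>R v) * indicator (cball (0::'a) (R + norm v)) x" for x
      proof (cases "norm x \<le> R + norm v")
        case True
        then show ?thesis using d(2)[OF t(3), of x] by (simp add: lin)
      next
        case False
        have "norm x \<le> norm (x + t *\<^sub>R v) + norm (t *\<^sub>R v)" by (metis add_diff_cancel_right' norm_triangle_ineq4)
        moreover have "norm (t *\<^sub>R v) \<le> 1 * norm v" unfolding norm_scaleR using t by (intro mult_right_mono) auto
        ultimately have "norm (x + t *\<^sub>R v) > R" "norm x > R" using False norm_ge_zero[of v] by linarith+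
        then have "x + t *\<^sub>R v \<notin> K" "x \<notin> K" using R by (meson not_less)+
        then show ?thesis using K(2) D0 e by simp
      qed
    qed (use Fi in auto)
    also have "\<dots> = e * norm (t *\<^sub>R v) * V" by (simp add: V_def)
    finally have "t * \<bar>I\<bar> \<le> t * (e * (norm v * V))" using t by (simp add: abs_mult mult_ac)
    then show ?thesis using t(1) by simp
  qed
  have "norm v * V \<ge> 0" by (simp add: V_def)
  have "\<bar>I\<bar> \<le> 0 + e" if "e > 0" for e
  proof -
    have "\<bar>I\<bar> \<le> e / (norm v * V + 1) * (norm v * V)" using that \<open>norm v * V \<ge> 0\<close> by (intro bound) auto
    also have "\<dots> \<le> e" using that \<open>norm v * V \<ge> 0\<close> by (simp add: field_simps)
    finally show ?thesis by simp
  qed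
  then have "\<bar>I\<bar> \<le> 0" by (rule field_le_epsilon)
  then show ?thesis by (simp add: I_def)
qed

section \<open>Convolution with test functions and mollifiers\<close>

definition conv :: "('a::euclidean_space \<Rightarrow> real) \<Rightarrow> ('a \<Rightarrow> real) \<Rightarrow> 'a \<Rightarrow> real" where
  "conv f g x = (\<integral>y. f y * g (x - y) \<partial>lborel)"

lemma conv_integrable:
  assumes "integrable lborel f" "g \<in> test_functions UNIV"
  shows "integrable lborel (\<lambda>y. f y * g (x - y))"
proof -
  obtain B where B: "\<And>x. \<bar>g x\<bar> \<le> B" using test_function_bounded[OF assms(2)] by blast
  have [measurable]: "g \<in> borel_measurable borel" using test_functions_smooth[OF assms(2)] by (rule smooth_borel)
  have [measurable]: "f \<in> borel_measurable borel" using assms(1) by (auto dest: borel_measurable_integrable)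
  have "integrable lborel (\<lambda>y. \<bar>f y\<bar> * \<bar>B\<bar>)" using assms(1) by simp
  then show ?thesis
  proof (rule Bochner_Integration.integrable_bound)
    show "AE y in lborel. norm (f y * g (x - y)) \<le> norm (\<bar>f y\<bar> * \<bar>B\<bar>)"
      using order_trans[OF B abs_ge_self] by (auto simp: abs_mult intro!: mult_left_mono)
  qed measurable
qed

text \<open>The first order expansion of g holds uniformly in its base point, so integrating it
  against f leaves a remainder of at most e / (F + 1) times the L1 norm F of f; adding 1 avoids a
  division by zero.\<close>

lemma conv_has_derivative:
  assumes f: "integrable lborel f" and g: "g \<in> test_functions UNIV"
  shows "(conv f g has_derivative (\<lambda>v. conv f (\<lambda>x. frechet_derivative g (at x) v) x)) (at x)"
  unfolding has_derivative_at_alt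
proof (intro conjI allI impI)
  obtain K where K: "compact K" "\<And>x. x \<notin> K \<Longrightarrow> g x = 0"
    using test_functionsE[OF g] by metis
  have gs: "smooth g" using g by (rule test_functions_smooth)
  have g1: "C_k 1 g" using gs by (rule smooth_C_k)
  have lin: "linear (frechet_derivative g (at x))" for x
    by (rule has_derivative_linear[OF smooth_has_derivative[OF gs]])
  have int: "integrable lborel (\<lambda>y. f y * frechet_derivative g (at (x - y)) v)" for v x
    using conv_integrable[OF f test_function_derivative[OF g]] .
  have "linear (\<lambda>v. conv f (\<lambda>x. frechet_derivative g (at x) v) x)"
  proof (rule linearI)
    show "conv f (\<lambda>x. frechet_derivative g (at x) (u + v)) x
      = conv f (\<lambda>x. frechet_derivative g (at x) u) x + conv f (\<lambda>x. frechet_derivative g (at x) v) x" for u v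
      unfolding conv_def using int by (simp add: linear_add[OF lin] distrib_left)
    show "conv f (\<lambda>x. frechet_derivative g (at x) (c *\<^sub>R v)) x = c *\<^sub>R conv f (\<lambda>x. frechet_derivative g (at x) v) x" for c v
      unfolding conv_def by (simp add: linear_scale[OF lin] mult.left_commute)
  qed
  then show "bounded_linear (\<lambda>v. conv f (\<lambda>x. frechet_derivative g (at x) v) x)"
    by (simp add: linear_conv_bounded_linear)
  fix e :: real assume e: "e > 0"
  define F where "F = (\<integral>y. \<bar>f y\<bar> \<partial>lborel)"
  have F: "F \<ge> 0" by (simp add: F_def)
  obtain d where d: "d > 0"
    "\<And>x h. norm h < d \<Longrightarrow> \<bar>g (x + h) - g x - frechet_derivative g (at x) h\<bar> \<le> e / (F + 1) * norm h"
    using uniformly_differentiable[OF g1 K, of "e / (F + 1)"] e F by auto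
  show "\<exists>d>0. \<forall>y. norm (y - x) < d \<longrightarrow>
      norm (conv f g y - conv f g x - conv f (\<lambda>w. frechet_derivative g (at w) (y - x)) x) \<le> e * norm (y - x)"
  proof (rule exI[of _ d], intro conjI allI impI)
    fix z assume z: "norm (z - x) < d"
    let ?h = "z - x"
    have "conv f g z - conv f g x - conv f (\<lambda>x. frechet_derivative g (at x) ?h) x
      = (\<integral>y. f y * (g (x - y + ?h) - g (x - y) - frechet_derivative g (at (x - y)) ?h) \<partial>lborel)"
      unfolding conv_def using conv_integrable[OF f g] int
      by (simp add: right_diff_distrib)
    also have "norm \<dots> \<le> (\<integral>y. \<bar>f y\<bar> * (e / (F + 1) * norm ?h) \<partial>lborel)"
    proof (rule Bochner_Integration.integral_norm_bound_integral)
      show "integrable lborel (\<lambda>y. f y * (g (x - y + ?h) - g (x - y) - frechet_derivative g (at (x - y)) ?h))"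
        using conv_integrable[OF f g] int by (simp add: right_diff_distrib)
      show "norm (f y * (g (x - y + ?h) - g (x - y) - frechet_derivative g (at (x - y)) ?h))
          \<le> \<bar>f y\<bar> * (e / (F + 1) * norm ?h)" for y
        using d(2)[OF z, of "x - y"] by (simp only: real_norm_def abs_mult) (intro mult_left_mono; simp)
    qed (use f in auto)
    also have "\<dots> = F / (F + 1) * e * norm ?h" by (simp add: F_def)
    also have "\<dots> \<le> 1 * e * norm ?h" using F e by (intro mult_right_mono) auto
    finally show "norm (conv f g z - conv f g x - conv f (\<lambda>x. frechet_derivative g (at x) ?h) x) \<le> e * norm ?h"
      by simp
  qed (rule d(1))
qed

text \<open>Derivatives fall on the test function, so all convolutions of f with test functions form
  a family closed under directional derivatives.\<close>

lemma smooth_conv: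
  assumes "integrable lborel f" "g \<in> test_functions UNIV"
  shows "smooth (conv f g)"
proof (rule smoothI_family[where S="conv f ` test_functions UNIV"])
  fix h assume "h \<in> conv f ` test_functions UNIV"
  then obtain g where g: "g \<in> test_functions UNIV" "h = conv f g" by auto
  note D = conv_has_derivative[OF assms(1) g(1)]
  show "h differentiable at x" for x using D g(2) differentiable_def by blast
  show "(\<lambda>x. frechet_derivative h (at x) v) \<in> conv f ` test_functions UNIV" for v
  proof (rule image_eqI)
    show "(\<lambda>x. frechet_derivative h (at x) v) = conv f (\<lambda>x. frechet_derivative g (at x) v)"
      using frechet_derivative_eqI[OF D] g(2) by auto
  qed (rule test_function_derivative[OF g(1)])
qed (use assms in auto)

lemma conv_diff_left:
  assumes "integrable lborel f1" "integrable lborel f2" "g \<in> test_functions UNIV"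
  shows "conv (\<lambda>x. f1 x - f2 x) g x = conv f1 g x - conv f2 g x"
  using conv_integrable[OF assms(1,3)] conv_integrable[OF assms(2,3)]
  unfolding conv_def by (simp add: left_diff_distrib)

definition mollifier :: "real \<Rightarrow> ('a::euclidean_space \<Rightarrow> real) \<Rightarrow> bool" where
  "mollifier r \<rho> \<longleftrightarrow> \<rho> \<in> test_functions UNIV \<and> (\<forall>x. \<rho> x \<ge> 0) \<and> (\<forall>x. x \<notin> cball 0 r \<longrightarrow> \<rho> x = 0) \<and>
     integrable lborel \<rho> \<and> (\<integral>x. \<rho> x \<partial>lborel) = 1"

text \<open>A bump on a small box around 0 is divided by its integral I. The integral is positive
  because the bump is positive on a nonempty open box, which is not a null set.\<close>

lemma mollifier_exists:
  assumes "r > 0"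
  shows "\<exists>\<rho>::'a::euclidean_space \<Rightarrow> real. mollifier r \<rho>"
proof -
  obtain a b :: 'a where ab: "cbox a b \<subseteq> ball 0 r" "0 \<in> box a b"
    using open_contains_cbox[OF open_ball, of 0 "0::'a" r] assms by (metis centre_in_ball)
  define I where "I = (\<integral>x. bump 1 a b x \<partial>lborel)"
  have z: "bump 1 a b x = 0" if "x \<notin> cbox a b" for x
    using that box_subset_cbox by (intro bump_eq_0) auto
  have i: "integrable lborel (bump 1 a b)"
    by (rule integrable_compact_support[OF _ compact_cbox z]) (auto intro: smooth_continuous smooth_bump)
  have "I > 0"
  proof (rule ccontr)
    assume "\<not> I > 0"
    moreover have "I \<ge> 0" by (simp add: I_def bump_bounds)
    ultimately have "I = 0" by linarith
    then have "AE x in lborel. bump 1 a b x = 0"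
      using integral_nonneg_eq_0_iff_AE[OF i] by (simp add: I_def bump_bounds)
    then have "AE x in lborel. x \<notin> box a b"
      by eventually_elim (metis bump_pos_iff less_irrefl zero_less_one)
    then have "box a b \<in> null_sets lborel"
      using AE_iff_null_sets[of "box a b" lborel] by simp
    then have "negligible (box a b)"
      by (simp add: negligible_iff_null_sets null_sets_completionI)
    then show False using ab(2) open_not_negligible[OF open_box, of a b] by blast
  qed
  have "mollifier r (\<lambda>x. (1 / I) * bump 1 a b x)"
    unfolding mollifier_def
  proof (intro conjI allI impI)
    show "(\<lambda>x. 1 / I * bump 1 a b x) \<in> test_functions UNIV"
      by (rule test_functionsI[OF smooth_cmult[OF smooth_bump] compact_cbox]) (use z in auto)
    show "1 / I * bump 1 a b x = 0" if "x \<notin> cball 0 r" for x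
      using z[of x] that ab(1) ball_subset_cball by fastforce
    show "(\<integral>x. 1 / I * bump 1 a b x \<partial>lborel) = 1" using \<open>I > 0\<close> by (simp add: I_def)
  qed (use i \<open>I > 0\<close> in \<open>auto simp: bump_bounds\<close>)
  then show ?thesis by blast
qed

lemma conv_zero_outside:
  assumes "mollifier r \<rho>" "\<And>y. y \<notin> A \<Longrightarrow> f y = 0" "\<And>y. y \<in> A \<Longrightarrow> dist x y > r"
  shows "conv f \<rho> x = 0"
proof -
  have "f y * \<rho> (x - y) = 0" for y
    using assms by (cases "y \<in> A") (auto simp: mollifier_def dist_norm not_le)
  then have "(\<lambda>y. f y * \<rho> (x - y)) = (\<lambda>y. 0)" by blast
  then show ?thesis unfolding conv_def by simp
qed

text \<open>Jensen's inequality for the probability density \<rho>(x - y), obtained from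
  Cauchy-Schwarz by splitting the density into two square roots, bounds the square of the
  convolution by the convolution of f^2 with \<rho>. Tonelli's theorem then integrates \<rho>
  out.\<close>

lemma conv_L2_contraction:
  assumes \<rho>: "mollifier r \<rho>" and f: "integrable lborel f" "f \<in> L2 lborel"
  shows "conv f \<rho> \<in> L2 lborel" "nrm lborel (conv f \<rho>) \<le> nrm lborel f"
proof -
  have \<rho>': "\<rho> \<in> test_functions UNIV" "\<And>x. \<rho> x \<ge> 0" "integrable lborel \<rho>" "(\<integral>x. \<rho> x \<partial>lborel) = 1"
    using \<rho> by (auto simp: mollifier_def)
  have [measurable]: "f \<in> borel_measurable borel" using f by auto
  have [measurable]: "\<rho> \<in> borel_measurable borel" using \<rho>'(1) by (intro smooth_borel test_functions_smooth)
  have [measurable]: "conv f \<rho> \<in> borel_measurable borel" using smooth_conv[OF f(1) \<rho>'(1)] by (rule smooth_borel)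
  obtain B where B: "\<And>x. \<bar>\<rho> x\<bar> \<le> B" using test_function_bounded[OF \<rho>'(1)] by blast
  have \<rho>i: "integrable lborel (\<lambda>y. \<rho> (x - y))" "(\<integral>y. \<rho> (x - y) \<partial>lborel) = 1" for x
    using lborel_integral_reflect[of \<rho> x] \<rho>' by auto
  have f2i: "integrable lborel (\<lambda>y. (f y)\<^sup>2 * \<rho> (x - y))" for x
    using conv_integrable[OF L2D(2)[OF f(2)] \<rho>'(1)] .
  have jensen: "(conv f \<rho> x)\<^sup>2 \<le> (\<integral>y. (f y)\<^sup>2 * \<rho> (x - y) \<partial>lborel)" for x
  proof -
    have 1: "(\<lambda>y. f y * sqrt (\<rho> (x - y))) \<in> L2 lborel" "(\<lambda>y. sqrt (\<rho> (x - y))) \<in> L2 lborel"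
      using f2i \<rho>i \<rho>'(2) by (auto simp: L2_def power_mult_distrib)
    have "conv f \<rho> x = (\<integral>y. (f y * sqrt (\<rho> (x - y))) * sqrt (\<rho> (x - y)) \<partial>lborel)"
      using \<rho>'(2) by (simp add: conv_def mult.assoc)
    then have "\<bar>conv f \<rho> x\<bar> \<le> nrm lborel (\<lambda>y. f y * sqrt (\<rho> (x - y))) * nrm lborel (\<lambda>y. sqrt (\<rho> (x - y)))"
      using Cauchy_Schwarz_L2[OF 1] by simp
    also have "nrm lborel (\<lambda>y. sqrt (\<rho> (x - y))) = 1"
      using \<rho>'(2) \<rho>i by (simp add: nrm_def)
    finally have "\<bar>conv f \<rho> x\<bar>\<^sup>2 \<le> (nrm lborel (\<lambda>y. f y * sqrt (\<rho> (x - y))))\<^sup>2"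
      by (intro power_mono) auto
    then show ?thesis using \<rho>'(2) by (simp add: nrm_power2 power_mult_distrib)
  qed
  have "(\<integral>\<^sup>+x. ennreal ((conv f \<rho> x)\<^sup>2) \<partial>lborel) \<le> (\<integral>\<^sup>+x. \<integral>\<^sup>+y. ennreal ((f y)\<^sup>2 * \<rho> (x - y)) \<partial>lborel \<partial>lborel)"
  proof (rule nn_integral_mono)
    fix x
    show "ennreal ((conv f \<rho> x)\<^sup>2) \<le> (\<integral>\<^sup>+y. ennreal ((f y)\<^sup>2 * \<rho> (x - y)) \<partial>lborel)"
      using jensen[of x] f2i \<rho>'(2) by (subst nn_integral_eq_integral) (auto intro: ennreal_leI)
  qed
  also have "\<dots> = (\<integral>\<^sup>+y. \<integral>\<^sup>+x. ennreal ((f y)\<^sup>2 * \<rho> (x - y)) \<partial>lborel \<partial>lborel)"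
    by (rule lborel_pair.Fubini') measurable
  also have "\<dots> = (\<integral>\<^sup>+y. ennreal ((f y)\<^sup>2) \<partial>lborel)"
  proof (rule nn_integral_cong)
    fix y
    have "(\<integral>\<^sup>+x. ennreal ((f y)\<^sup>2 * \<rho> (x - y)) \<partial>lborel) = ennreal ((f y)\<^sup>2) * (\<integral>\<^sup>+x. ennreal (\<rho> (x - y)) \<partial>lborel)"
      using \<rho>'(2) by (simp add: ennreal_mult nn_integral_cmult)
    also have "(\<integral>\<^sup>+x. ennreal (\<rho> (x - y)) \<partial>lborel) = (\<integral>\<^sup>+x. ennreal (\<rho> x) \<partial>lborel)"
      by (rule lborel_nn_integral_reflect(2)[of "\<lambda>x. ennreal (\<rho> x)"]) measurable
    also have "\<dots> = 1" using \<rho>' by (subst nn_integral_eq_integral) auto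
    finally show "(\<integral>\<^sup>+x. ennreal ((f y)\<^sup>2 * \<rho> (x - y)) \<partial>lborel) = ennreal ((f y)\<^sup>2)" by simp
  qed
  also have "\<dots> = ennreal (\<integral>y. (f y)\<^sup>2 \<partial>lborel)"
    using f(2) by (subst nn_integral_eq_integral) auto
  finally have le: "(\<integral>\<^sup>+x. ennreal ((conv f \<rho> x)\<^sup>2) \<partial>lborel) \<le> ennreal (\<integral>y. (f y)\<^sup>2 \<partial>lborel)" .
  then have i: "integrable lborel (\<lambda>x. (conv f \<rho> x)\<^sup>2)"
    by (auto simp: integrable_iff_bounded intro: le_less_trans)
  then show "conv f \<rho> \<in> L2 lborel" by (simp add: L2_def)
  have "(\<integral>x. (conv f \<rho> x)\<^sup>2 \<partial>lborel) \<le> (\<integral>y. (f y)\<^sup>2 \<partial>lborel)"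
    using le nn_integral_eq_integral[OF i] by simp
  then show "nrm lborel (conv f \<rho>) \<le> nrm lborel f" by (simp add: nrm_def)
qed

section \<open>Density of continuous functions and convergence of mollifications\<close>

lemma clip_bounds:
  fixes N :: real assumes "N \<ge> 0"
  shows "\<bar>max (- N) (min N t)\<bar> \<le> N" "\<bar>t\<bar> \<le> N \<Longrightarrow> max (- N) (min N t) = t"
    "\<bar>t - max (- N) (min N t)\<bar> \<le> \<bar>t\<bar>"
  using assms by (auto simp: max_def min_def)

lemma integrable_indicator_compact:
  "compact K \<Longrightarrow> integrable lborel (\<lambda>x::'a::euclidean_space. c * indicator K x :: real)"
  using emeasure_bounded_finite[OF compact_imp_bounded]
  by (intro integrable_mult_right integrable_real_indicator) (auto intro: borel_compact)

lemma nrm_tendsto_0_dominated: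
  fixes F :: "nat \<Rightarrow> 'a \<Rightarrow> real"
  assumes [measurable]: "\<And>n. F n \<in> borel_measurable M" and w: "integrable M w"
    and "AE x in M. (\<lambda>n. F n x) \<longlonglongrightarrow> 0" "\<And>n x. (F n x)\<^sup>2 \<le> w x"
  shows "(\<lambda>n. nrm M (F n)) \<longlonglongrightarrow> 0"
proof -
  have "(\<lambda>n. \<integral>x. (F n x)\<^sup>2 \<partial>M) \<longlonglongrightarrow> (\<integral>x. 0 \<partial>M)"
  proof (rule integral_dominated_convergence[OF _ _ w])
    show "AE x in M. (\<lambda>n. (F n x)\<^sup>2) \<longlonglongrightarrow> 0"
      using assms(3) by eventually_elim (use tendsto_power[of _ 0 _ 2] in fastforce)
  qed (use assms(4) in auto)
  from tendsto_real_sqrt[OF this] show ?thesis by (simp add: nrm_def)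
qed

text \<open>A measurable function is an almost everywhere limit of continuous functions. Clipping
  these at N and multiplying by a cutoff that is 1 on A gives continuous functions with common
  compact support and a common bound, to which dominated convergence applies.\<close>

lemma L2_dense_bounded:
  fixes f :: "'a::euclidean_space \<Rightarrow> real"
  assumes f [measurable]: "f \<in> borel_measurable borel" and A: "compact A" "\<And>x. x \<notin> A \<Longrightarrow> f x = 0"
    and N: "\<And>x. \<bar>f x\<bar> \<le> N" and e: "e > 0"
  shows "\<exists>g K. continuous_on UNIV g \<and> compact K \<and> (\<forall>x. x \<notin> K \<longrightarrow> g x = 0) \<and>
    nrm lborel (\<lambda>x. g x - f x) < e"
proof -
  have N0: "N \<ge> 0" using N[of undefined] by linarith
  have "f \<in> borel_measurable lebesgue" by (intro measurable_completion) simp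
  then have "f measurable_on UNIV"
    by (intro lebesgue_measurable_imp_measurable_on_real) auto
  then obtain Z g where Z: "negligible Z" and g: "\<And>n. continuous_on UNIV (g n)"
    "\<And>x. x \<notin> Z \<Longrightarrow> (\<lambda>n. g n x) \<longlonglongrightarrow> f x"
    unfolding measurable_on_def by auto
  obtain \<eta> where \<eta>: "\<eta> \<in> test_functions UNIV" "\<And>x. x \<in> A \<Longrightarrow> \<eta> x = 1"
    using cutoff_exists[OF open_UNIV A(1) subset_UNIV] by metis
  obtain K where K: "compact K" "\<And>x. x \<notin> K \<Longrightarrow> \<eta> x = 0"
    using test_functionsE[OF \<eta>(1)] by metis
  obtain B where B: "\<And>x. \<bar>\<eta> x\<bar> \<le> B" using test_function_bounded[OF \<eta>(1)] by blast
  define h where "h n x = \<eta> x * max (- N) (min N (g n x))" for n x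
  have hc: "continuous_on UNIV (h n)" for n
    unfolding h_def using smooth_continuous[OF test_functions_smooth[OF \<eta>(1)]] g(1)
    by (intro continuous_intros) auto
  have [measurable]: "h n \<in> borel_measurable borel" for n
    using hc by (rule borel_measurable_continuous_onI)
  have "(\<lambda>n. nrm lborel (\<lambda>x. h n x - f x)) \<longlonglongrightarrow> 0"
  proof (rule nrm_tendsto_0_dominated)
    show "integrable lborel (\<lambda>x. (B * N + N)\<^sup>2 * indicator (K \<union> A) x)"
      using K A by (intro integrable_indicator_compact compact_Un)
    have "AE x in lebesgue. x \<notin> Z"
      using Z by (auto simp: negligible_iff_null_sets intro: AE_not_in)
    then have "AE x in lborel. x \<notin> Z" by (simp add: AE_completion_iff)
    then show "AE x in lborel. (\<lambda>n. h n x - f x) \<longlonglongrightarrow> 0"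
    proof eventually_elim
      case (elim x)
      have "(\<lambda>n. h n x - f x) \<longlonglongrightarrow> \<eta> x * max (- N) (min N (f x)) - f x"
        unfolding h_def by (intro tendsto_intros g(2) elim)
      moreover have "\<eta> x * max (- N) (min N (f x)) = f x"
        using \<eta>(2)[of x] A(2)[of x] clip_bounds(2)[OF N0 N, of x] N0 by (cases "x \<in> A") auto
      ultimately show ?case by simp
    qed
    show "(h n x - f x)\<^sup>2 \<le> (B * N + N)\<^sup>2 * indicator (K \<union> A) x" for n x
    proof (cases "x \<in> K \<union> A")
      case True
      have "\<bar>h n x\<bar> \<le> B * N"
        unfolding h_def abs_mult using B[of x] clip_bounds(1)[OF N0, of "g n x"] by (intro mult_mono) auto
      then have "\<bar>h n x - f x\<bar> \<le> B * N + N" using N[of x] by linarith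
      then have "\<bar>h n x - f x\<bar>\<^sup>2 \<le> (B * N + N)\<^sup>2" by (intro power_mono) auto
      then show ?thesis using True by simp
    qed (use K A in \<open>auto simp: h_def\<close>)
  qed measurable
  then have "\<forall>\<^sub>F n in sequentially. nrm lborel (\<lambda>x. h n x - f x) < e"
    using e by (rule order_tendstoD)
  then obtain n where "nrm lborel (\<lambda>x. h n x - f x) < e" by (auto simp: eventually_sequentially)
  then show ?thesis using hc K by (intro exI[of _ "h n"] exI[of _ K]) (auto simp: h_def)
qed

lemma L2_compact_support_continuous:
  fixes g :: "'a::euclidean_space \<Rightarrow> real"
  assumes "continuous_on UNIV g" "compact K" "\<And>x. x \<notin> K \<Longrightarrow> g x = 0"
  shows "g \<in> L2 lborel"
  using assms integrable_compact_support[of "\<lambda>x. (g x)\<^sup>2" K]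
  by (auto simp: L2_def intro!: continuous_intros borel_measurable_continuous_onI)

text \<open>Clipping f at height n changes it little in mean square for large n, by domination
  through f^2; the clipped function is bounded with support in A.\<close>

lemma L2_dense:
  fixes f :: "'a::euclidean_space \<Rightarrow> real"
  assumes f: "f \<in> L2 lborel" and A: "compact A" "\<And>x. x \<notin> A \<Longrightarrow> f x = 0" and e: "e > 0"
  shows "\<exists>g K. continuous_on UNIV g \<and> compact K \<and> (\<forall>x. x \<notin> K \<longrightarrow> g x = 0) \<and>
    nrm lborel (\<lambda>x. g x - f x) < e"
proof -
  have [measurable]: "f \<in> borel_measurable borel" using f by auto
  define h where "h n x = max (- real n) (min (real n) (f x))" for n x
  have "(\<lambda>n. nrm lborel (\<lambda>x. f x - h n x)) \<longlonglongrightarrow> 0"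
  proof (rule nrm_tendsto_0_dominated[OF _ L2D(2)[OF f]])
    show "AE x in lborel. (\<lambda>n. f x - h n x) \<longlonglongrightarrow> 0"
    proof (rule AE_I2)
      fix x
      obtain N0 :: nat where "\<bar>f x\<bar> \<le> real N0" using real_arch_simple by blast
      then have "\<forall>\<^sub>F n in sequentially. f x - h n x = 0"
        by (intro eventually_sequentiallyI[of N0]) (auto simp: h_def max_def min_def)
      then show "(\<lambda>n. f x - h n x) \<longlonglongrightarrow> 0" by (rule tendsto_eventually)
    qed
    show "(f x - h n x)\<^sup>2 \<le> (f x)\<^sup>2" for n x
      unfolding abs_le_square_iff[symmetric] h_def by (rule clip_bounds) simp
  qed (simp add: h_def)
  then have "\<forall>\<^sub>F n in sequentially. nrm lborel (\<lambda>x. f x - h n x) < e / 2"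
    by (rule order_tendstoD) (use e in auto)
  then obtain n where n: "nrm lborel (\<lambda>x. f x - h n x) < e / 2" by (auto simp: eventually_sequentially)
  have hb: "h n x = 0" if "x \<notin> A" for x
    using A(2)[OF that] by (auto simp: h_def)
  have hb': "h n \<in> borel_measurable borel" "\<bar>h n x\<bar> \<le> real n" for x
  proof -
    have "h n = (\<lambda>x. max (- real n) (min (real n) (f x)))" by (simp add: h_def fun_eq_iff)
    then show "h n \<in> borel_measurable borel" by (rule ssubst) measurable
    show "\<bar>h n x\<bar> \<le> real n" unfolding h_def by (rule clip_bounds) simp
  qed
  obtain g K where g: "continuous_on UNIV g" "compact K" "\<forall>x. x \<notin> K \<longrightarrow> g x = 0"
    "nrm lborel (\<lambda>x. g x - h n x) < e / 2"
    using L2_dense_bounded[OF hb'(1) A(1) hb hb'(2), of "e / 2"] e by auto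
  have h: "h n \<in> L2 lborel"
    by (rule L2_bound[OF f, of _ 1]) (use hb'(1) in \<open>auto simp: h_def max_def min_def\<close>)
  have gL: "g \<in> L2 lborel" using L2_compact_support_continuous g by blast
  have "nrm lborel (\<lambda>x. g x - f x) \<le> nrm lborel (\<lambda>x. g x - h n x) + nrm lborel (\<lambda>x. h n x - f x)"
    by (intro nrm_triangle3 L2_diff gL h f)
  also have "\<dots> < e" using n g(4) by (simp add: nrm_minus_commute)
  finally show ?thesis using g by blast
qed

lemma L2_compact_support_integrable:
  fixes f :: "'a::euclidean_space \<Rightarrow> real"
  assumes f: "f \<in> L2 lborel" and A: "compact A" "\<And>x. x \<notin> A \<Longrightarrow> f x = 0"
  shows "integrable lborel f"
proof (rule Bochner_Integration.integrable_bound)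
  show "integrable lborel (\<lambda>x. 1 * indicator A x + (f x)\<^sup>2)"
    using f A by (intro Bochner_Integration.integrable_add integrable_indicator_compact) auto
  have "\<bar>t\<bar> \<le> 1 + t\<^sup>2" for t :: real
  proof -
    have "0 \<le> (\<bar>t\<bar> - 1)\<^sup>2 + \<bar>t\<bar>\<^sup>2 + 1" by simp
    then show ?thesis by (simp add: power2_diff)
  qed
  then show "AE x in lborel. norm (f x) \<le> norm (1 * indicator A x + (f x)\<^sup>2)"
    using A(2) by (auto simp: indicator_def abs_of_nonneg)
qed (use f in auto)

text \<open>Uniform continuity makes the pointwise error at most e'. For r \<le> 1 both functions
  vanish outside the ball of radius R + 1, so the error in mean square is at most e' times the
  square root of the volume V. The threshold r0 serves all mollifiers of smaller radius, so it can
  be applied along a sequence.\<close>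

lemma conv_continuous_approx:
  fixes g :: "'a::euclidean_space \<Rightarrow> real"
  assumes g: "continuous_on UNIV g" and K: "compact K" "\<And>x. x \<notin> K \<Longrightarrow> g x = 0" and e: "e > 0"
  shows "\<exists>r0>0. \<forall>r \<rho>. r \<le> r0 \<longrightarrow> mollifier r \<rho> \<longrightarrow> nrm lborel (\<lambda>x. conv g \<rho> x - g x) < e"
proof -
  obtain R where R: "\<And>x. x \<in> K \<Longrightarrow> norm x \<le> R"
    using K(1) compact_imp_bounded bounded_iff by metis
  define V where "V = measure lborel (cball (0::'a) (R + 1))"
  have V: "V \<ge> 0" by (simp add: V_def)
  define e' where "e' = e / (sqrt V + 1)"
  have e': "e' > 0" using e V by (simp add: e'_def add_nonneg_pos)
  obtain d where d: "d > 0" "\<And>x y. dist y x < d \<Longrightarrow> dist (g y) (g x) < e'"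
    using uniformly_continuous_compact_support[OF g K] e' unfolding uniformly_continuous_on_def
    by (metis UNIV_I)
  have "nrm lborel (\<lambda>x. conv g \<rho> x - g x) < e" if r: "r \<le> min 1 (d / 2)" and m: "mollifier r \<rho>" for r \<rho>
  proof -
    have \<rho>: "\<rho> \<in> test_functions UNIV" "\<And>x. \<rho> x \<ge> 0" "integrable lborel \<rho>" "(\<integral>x. \<rho> x \<partial>lborel) = 1"
      "\<And>x. x \<notin> cball 0 r \<Longrightarrow> \<rho> x = 0"
      using m by (auto simp: mollifier_def)
    have [measurable]: "\<rho> \<in> borel_measurable borel" using \<rho>(1) by (intro smooth_borel test_functions_smooth)
    have gi: "integrable lborel g" by (rule integrable_compact_support[OF g K])
    have \<rho>i: "integrable lborel (\<lambda>y. \<rho> (x - y))" "(\<integral>y. \<rho> (x - y) \<partial>lborel) = 1" for x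
      using lborel_integral_reflect[of \<rho> x] \<rho> by auto
    have bd: "\<bar>conv g \<rho> x - g x\<bar> \<le> e'" for x
    proof -
      have "conv g \<rho> x - g x = (\<integral>y. g y * \<rho> (x - y) \<partial>lborel) - (\<integral>y. g x * \<rho> (x - y) \<partial>lborel)"
        using \<rho>i by (simp add: conv_def)
      also have "\<dots> = (\<integral>y. (g y - g x) * \<rho> (x - y) \<partial>lborel)"
        using conv_integrable[OF gi \<rho>(1)] \<rho>i by (simp add: left_diff_distrib)
      also have "norm \<dots> \<le> (\<integral>y. e' * \<rho> (x - y) \<partial>lborel)"
      proof (rule Bochner_Integration.integral_norm_bound_integral)
        show "integrable lborel (\<lambda>y. (g y - g x) * \<rho> (x - y))"
          using conv_integrable[OF gi \<rho>(1)] \<rho>i by (simp add: left_diff_distrib)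
        show "norm ((g y - g x) * \<rho> (x - y)) \<le> e' * \<rho> (x - y)" for y
        proof (cases "x - y \<in> cball 0 r")
          case True
          then have "dist y x < d" using r d(1) by (simp add: dist_norm norm_minus_commute)
          then have "\<bar>g y - g x\<bar> \<le> e'" using d(2)[of y x] by (simp add: dist_real_def)
          then show ?thesis using \<rho>(2)[of "x - y"] by (simp add: abs_mult mult_right_mono)
        qed (simp add: \<rho>(5))
      qed (use \<rho>i in auto)
      finally show ?thesis using \<rho>i by simp
    qed
    have z: "conv g \<rho> x - g x = 0" if "x \<notin> cball 0 (R + 1)" for x
    proof -
      have "conv g \<rho> x = 0"
      proof (rule conv_zero_outside[OF m K(2)])
        fix y assume "y \<in> K"
        have "norm x \<le> norm y + dist x y" by (metis dist_norm norm_triangle_sub)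
        then show "dist x y > r" using R[OF \<open>y \<in> K\<close>] that r by simp
      qed
      moreover have "x \<notin> K" using R that by force
      ultimately show ?thesis using K(2) by simp
    qed
    have "(\<integral>x. (conv g \<rho> x - g x)\<^sup>2 \<partial>lborel) \<le> (\<integral>x. e'\<^sup>2 * indicator (cball (0::'a) (R + 1)) x \<partial>lborel)"
    proof (rule integral_mono')
      show "integrable lborel (\<lambda>x. e'\<^sup>2 * indicator (cball (0::'a) (R + 1)) x :: real)"
        by (rule integrable_indicator_compact) simp
      show "(conv g \<rho> x - g x)\<^sup>2 \<le> e'\<^sup>2 * indicator (cball 0 (R + 1)) x" for x
        using power_mono[OF bd[of x], of 2] z[of x] by (cases "x \<in> cball 0 (R + 1)") auto
    qed simp
    also have "\<dots> = e'\<^sup>2 * V" by (simp add: V_def)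
    finally have "nrm lborel (\<lambda>x. conv g \<rho> x - g x) \<le> sqrt (e'\<^sup>2 * V)"
      unfolding nrm_def by (rule real_sqrt_le_mono)
    also have "\<dots> = e' * sqrt V" using e' by (simp add: real_sqrt_mult)
    also have "\<dots> < e"
    proof -
      have "sqrt V + 1 > 0" using V by (simp add: add_nonneg_pos)
      then show ?thesis using e by (simp add: e'_def field_simps)
    qed
    finally show ?thesis .
  qed
  then show ?thesis using d(1) by (intro exI[of _ "min 1 (d / 2)"]) auto
qed

text \<open>Approximate f by a continuous g of compact support: mollification does not enlarge the
  error between f and g, so three errors of size e / 3 add up.\<close>

lemma conv_L2_tendsto:
  fixes f :: "'a::euclidean_space \<Rightarrow> real"
  assumes f: "f \<in> L2 lborel" and A: "compact A" "\<And>x. x \<notin> A \<Longrightarrow> f x = 0"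
    and \<rho>: "\<And>m. mollifier (r m) (\<rho> m)" and r: "r \<longlonglongrightarrow> 0"
  shows "L2_tendsto lborel (\<lambda>m. conv f (\<rho> m)) f"
  unfolding L2_tendsto_def
proof (intro conjI allI)
  note fi = L2_compact_support_integrable[OF f A]
  show "conv f (\<rho> m) \<in> L2 lborel" for m using conv_L2_contraction[OF \<rho> fi f] by simp
  show "(\<lambda>m. nrm lborel (\<lambda>x. conv f (\<rho> m) x - f x)) \<longlonglongrightarrow> 0"
    unfolding tendsto_iff
  proof (intro allI impI)
    fix e :: real assume e: "e > 0"
    obtain g K where g: "continuous_on UNIV g" "compact K" "\<And>x. x \<notin> K \<Longrightarrow> g x = 0"
      "nrm lborel (\<lambda>x. g x - f x) < e / 3"
      using L2_dense[OF f A, of "e / 3"] e by auto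
    note gL = L2_compact_support_continuous[OF g(1,2,3)] and gi = integrable_compact_support[OF g(1,2,3)]
    obtain r0 where r0: "r0 > 0" "\<And>r \<rho>. r \<le> r0 \<Longrightarrow> mollifier r \<rho> \<Longrightarrow> nrm lborel (\<lambda>x. conv g \<rho> x - g x) < e / 3"
      using conv_continuous_approx[OF g(1,2,3), of "e / 3"] e by auto
    have "\<forall>\<^sub>F m in sequentially. r m < r0" using r r0(1) by (rule order_tendstoD)
    then show "\<forall>\<^sub>F m in sequentially. dist (nrm lborel (\<lambda>x. conv f (\<rho> m) x - f x)) 0 < e"
    proof eventually_elim
      case (elim m)
      have \<rho>t: "\<rho> m \<in> test_functions UNIV" using \<rho> by (simp add: mollifier_def)
      note c = conv_L2_contraction(1)[OF \<rho> fi f, of m] conv_L2_contraction(1)[OF \<rho> gi gL, of m]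
      have "nrm lborel (\<lambda>x. conv f (\<rho> m) x - conv g (\<rho> m) x) \<le> nrm lborel (\<lambda>x. f x - g x)"
        using conv_L2_contraction(2)[OF \<rho> _ L2_diff[OF f gL], of m] fi gi
        by (simp add: conv_diff_left[OF fi gi \<rho>t, THEN ext])
      then have 1: "nrm lborel (\<lambda>x. conv f (\<rho> m) x - conv g (\<rho> m) x) < e / 3"
        using g(4) unfolding nrm_minus_commute[of _ g f] by linarith
      have 2: "nrm lborel (\<lambda>x. conv g (\<rho> m) x - g x) < e / 3"
        using r0(2)[OF _ \<rho>, of m] elim by simp
      have "nrm lborel (\<lambda>x. conv f (\<rho> m) x - f x)
          \<le> nrm lborel (\<lambda>x. conv f (\<rho> m) x - conv g (\<rho> m) x) + nrm lborel (\<lambda>x. conv g (\<rho> m) x - f x)"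
        by (intro nrm_triangle3 L2_diff c f)
      also have "nrm lborel (\<lambda>x. conv g (\<rho> m) x - f x)
          \<le> nrm lborel (\<lambda>x. conv g (\<rho> m) x - g x) + nrm lborel (\<lambda>x. g x - f x)"
        by (intro nrm_triangle3 L2_diff c f gL)
      finally show ?case using 1 2 g(4) by (simp add: nrm_nonneg dist_real_def)
    qed
  qed
qed (rule f)

section \<open>Weak derivatives\<close>

lemma open_sets_lebesgue [simp]: "open \<Omega> \<Longrightarrow> \<Omega> \<in> sets lebesgue"
  by (simp add: borel_open)

lemma lebesgue_on_AE_iff:
  "open \<Omega> \<Longrightarrow> (AE x in lebesgue_on \<Omega>. P x) \<longleftrightarrow> (AE x in lebesgue. x \<in> \<Omega> \<longrightarrow> P x)"
  by (rule AE_restrict_space_iff) simp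

lemma integral_lebesgue_on_borel:
  fixes f :: "'a::euclidean_space \<Rightarrow> real"
  assumes \<Omega>: "open \<Omega>" and f: "f \<in> borel_measurable borel" "\<And>x. x \<notin> \<Omega> \<Longrightarrow> f x = 0"
  shows "integral\<^sup>L (lebesgue_on \<Omega>) f = integral\<^sup>L lborel f"
    and "integrable (lebesgue_on \<Omega>) f \<longleftrightarrow> integrable lborel f"
proof -
  have eq: "(\<lambda>x. indicator \<Omega> x *\<^sub>R f x) = f"
    using f(2) by (auto simp: indicator_def fun_eq_iff)
  show "integral\<^sup>L (lebesgue_on \<Omega>) f = integral\<^sup>L lborel f"
    using \<Omega> f(1) by (subst integral_restrict_space) (simp, simp only: eq, simp add: integral_completion)
  show "integrable (lebesgue_on \<Omega>) f \<longleftrightarrow> integrable lborel f"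
    using \<Omega> f(1) by (subst integrable_restrict_space) (simp, simp only: eq, simp add: integrable_completion)
qed

text \<open>Convolutions are integrals over \<open>lborel\<close> of Borel functions, whereas
  members of the function spaces are only Lebesgue measurable on \<Omega>. The representative,
  extended by 0, bridges the two.\<close>

lemma borel_representative:
  fixes f :: "'a::euclidean_space \<Rightarrow> real"
  assumes \<Omega>: "open \<Omega>" and f: "f \<in> borel_measurable (lebesgue_on \<Omega>)"
  obtains f' where "f' \<in> borel_measurable borel" "\<And>x. x \<notin> \<Omega> \<Longrightarrow> f' x = 0"
    "AE x in lebesgue_on \<Omega>. f x = f' x"
proof -
  have "(\<lambda>x. indicator \<Omega> x *\<^sub>R f x) \<in> borel_measurable lebesgue"
    using f \<Omega> by (subst (asm) borel_measurable_restrict_space_iff) simp_all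
  then obtain g where g: "g \<in> borel_measurable lborel" "AE x in lborel. indicator \<Omega> x *\<^sub>R f x = g x"
    using completion_ex_borel_measurable_real by metis
  have [measurable]: "g \<in> borel_measurable borel" "\<Omega> \<in> sets borel" using g(1) \<Omega> by auto
  have "AE x in lebesgue. indicator \<Omega> x *\<^sub>R f x = g x" using g(2) by (rule AE_completion)
  then have "AE x in lebesgue. x \<in> \<Omega> \<longrightarrow> f x = indicator \<Omega> x * g x"
    by eventually_elim auto
  then have "AE x in lebesgue_on \<Omega>. f x = indicator \<Omega> x * g x"
    using \<Omega> by (simp add: lebesgue_on_AE_iff)
  then show ?thesis by (rule that[rotated 2]) auto
qed

text \<open>Sharpened bumps show that d integrates to 0 over every box whose closure lies in
  \<Omega>. Within one such box this extends to all Borel sets, so d vanishes there almost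
  everywhere; countably many boxes cover \<Omega>.\<close>

lemma du_Bois_Reymond:
  fixes d :: "'a::euclidean_space \<Rightarrow> real"
  assumes \<Omega>: "open \<Omega>" and d: "locally_integrable_on d \<Omega>"
    and z: "\<And>\<psi>. \<psi> \<in> test_functions \<Omega> \<Longrightarrow> (\<integral>x. d x * \<psi> x \<partial>lebesgue_on \<Omega>) = 0"
  shows "AE x in lebesgue_on \<Omega>. d x = 0"
proof -
  have int_box: "integrable lebesgue (\<lambda>x. indicator (cbox a b) x * d x)" if "cbox a b \<subseteq> \<Omega>" for a b
    using d that by (auto simp: locally_integrable_on_def set_integrable_def)
  have box0: "(\<integral>x. indicator (box a b) x * d x \<partial>lebesgue) = 0" if ab: "cbox a b \<subseteq> \<Omega>" for a b
  proof -
    have eq: "(\<integral>x. d x * bump (real (Suc m)) a b x \<partial>lebesgue_on \<Omega>)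
       = (\<integral>x. bump (real (Suc m)) a b x * (indicator (cbox a b) x * d x) \<partial>lebesgue)" for m
    proof -
      have "(\<lambda>x. indicator \<Omega> x *\<^sub>R (d x * bump (real (Suc m)) a b x))
          = (\<lambda>x. bump (real (Suc m)) a b x * (indicator (cbox a b) x * d x))"
      proof
        fix x
        have "x \<in> cbox a b" if "bump (real (Suc m)) a b x \<noteq> 0"
          using that bump_eq_0[of "real (Suc m)" x a b] box_subset_cbox[of a b] by auto
        then show "indicator \<Omega> x *\<^sub>R (d x * bump (real (Suc m)) a b x)
            = bump (real (Suc m)) a b x * (indicator (cbox a b) x * d x)"
          using ab by (cases "bump (real (Suc m)) a b x = 0") auto
      qed
      then show ?thesis using \<Omega> by (subst integral_restrict_space) simp_all
    qed
    have "(\<lambda>m. \<integral>x. bump (real (Suc m)) a b x * (indicator (cbox a b) x * d x) \<partial>lebesgue)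
        \<longlonglongrightarrow> (\<integral>x. indicator (box a b) x * (indicator (cbox a b) x * d x) \<partial>lebesgue)"
    proof (rule integral_dominated_convergence)
      show "integrable lebesgue (\<lambda>x. norm (indicator (cbox a b) x * d x))"
        using int_box[OF ab] by (rule integrable_norm)
      have [measurable]: "(\<lambda>x. indicator (cbox a b) x * d x) \<in> borel_measurable lebesgue"
        using int_box[OF ab] by (rule borel_measurable_integrable)
      have [measurable]: "bump (real (Suc m)) a b \<in> borel_measurable lebesgue" for m
        by (intro measurable_completion) (simp add: smooth_borel smooth_bump)
      show "(\<lambda>x. indicator (box a b) x * (indicator (cbox a b) x * d x)) \<in> borel_measurable lebesgue"
        by (rule borel_measurable_times[OF borel_measurable_indicator]) auto
      show "(\<lambda>x. bump (real (Suc m)) a b x * (indicator (cbox a b) x * d x)) \<in> borel_measurable lebesgue" for m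
        by measurable
      show "AE x in lebesgue. (\<lambda>m. bump (real (Suc m)) a b x * (indicator (cbox a b) x * d x))
          \<longlonglongrightarrow> indicator (box a b) x * (indicator (cbox a b) x * d x)"
        by (intro AE_I2 tendsto_mult bump_tendsto_indicator tendsto_const)
      show "AE x in lebesgue. norm (bump (real (Suc m)) a b x * (indicator (cbox a b) x * d x))
          \<le> norm (indicator (cbox a b) x * d x)" for m
        using bump_bounds[of "real (Suc m)" a b] by (auto simp: abs_mult intro!: mult_left_le_one_le)
    qed
    moreover have "(\<integral>x. bump (real (Suc m)) a b x * (indicator (cbox a b) x * d x) \<partial>lebesgue) = 0" for m
      using z[OF test_function_bump[OF _ ab, of "real (Suc m)"]] eq[of m] by simp
    ultimately have "(\<integral>x. indicator (box a b) x * (indicator (cbox a b) x * d x) \<partial>lebesgue) = 0"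
      by (simp add: LIMSEQ_const_iff)
    moreover have "(\<lambda>x. indicator (box a b) x * (indicator (cbox a b) x * d x)) = (\<lambda>x. indicator (box a b) x * d x)"
      using box_subset_cbox[of a b] by (auto simp: indicator_def fun_eq_iff)
    ultimately show ?thesis by simp
  qed
  have int_box': "integrable lebesgue (\<lambda>x. indicator (box a b) x * d x)" if "cbox a b \<subseteq> \<Omega>" for a b
  proof -
    have "set_integrable lebesgue (box a b) (\<lambda>x. indicator (cbox a b) x * d x)"
      unfolding set_integrable_def using int_box[OF that]
      by (intro integrable_mult_indicator) auto
    moreover have "(\<lambda>x. indicator (box a b) x *\<^sub>R (indicator (cbox a b) x * d x)) = (\<lambda>x. indicator (box a b) x * d x)"
      using box_subset_cbox[of a b] by (auto simp: indicator_def fun_eq_iff)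
    ultimately show ?thesis by (simp add: set_integrable_def)
  qed
  have box_AE: "AE x in lebesgue. x \<in> box a b \<longrightarrow> d x = 0" if ab: "cbox a b \<subseteq> \<Omega>" for a b
  proof -
    define f where "f x = indicator (box a b) x * d x" for x
    have fi: "integrable lebesgue f" using int_box'[OF ab] by (simp add: f_def[abs_def])
    obtain f' where f': "f' \<in> borel_measurable lborel" "AE x in lborel. f x = f' x"
      using completion_ex_borel_measurable_real[of f lborel] fi by auto
    have ae: "AE x in lebesgue. f x = f' x" using f'(2) by (rule AE_completion)
    have f'm: "f' \<in> borel_measurable lebesgue" using f'(1) by (rule measurable_completion)
    have f'i: "integrable lborel f'"
      using integrable_cong_AE[OF _ f'm ae] fi f'(1) by (simp add: integrable_completion)
    have inter: "(\<integral>x. indicator (box l u) x * f x \<partial>lebesgue) = 0" for l u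
    proof (cases "box l u \<inter> box a b = {}")
      case True
      then have "(\<lambda>x. indicator (box l u) x * f x) = (\<lambda>x. 0)" by (auto simp: f_def indicator_def fun_eq_iff)
      then show ?thesis by simp
    next
      case False
      obtain l' u' where lu: "box l u \<inter> box a b = box l' u'" using that[OF box_Int_box] .
      \<comment> \<open>The box with corners l' and u' is nonempty here, so its closed version is
        its closure and stays inside \<open>cbox a b\<close>; for an empty box the corners would say
        nothing about that.\<close>
      have "cbox l' u' = closure (box l' u')" using False lu by (metis closure_box)
      also have "\<dots> \<subseteq> closure (box a b)" using lu by (intro closure_mono) auto
      also have "\<dots> \<subseteq> cbox a b" by (intro closure_minimal) (auto simp: box_subset_cbox)
      finally have "cbox l' u' \<subseteq> \<Omega>" using ab by simp
      from box0[OF this]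
      have "(\<integral>x. indicator (box l u \<inter> box a b) x * d x \<partial>lebesgue) = 0" by (simp add: lu)
      then show ?thesis by (simp add: f_def indicator_inter_arith mult.assoc)
    qed
    have box_f': "(\<integral>x. indicator (box l u) x *\<^sub>R f' x \<partial>lborel) = 0" for l u
    proof -
      have "(\<integral>x. indicator (box l u) x *\<^sub>R f' x \<partial>lborel) = (\<integral>x. indicator (box l u) x *\<^sub>R f' x \<partial>lebesgue)"
        using f'(1) by (intro integral_completion[symmetric]) auto
      also have "\<dots> = (\<integral>x. indicator (box l u) x * f x \<partial>lebesgue)"
      proof (rule integral_cong_AE)
        show "(\<lambda>x. indicator (box l u) x *\<^sub>R f' x) \<in> borel_measurable lebesgue"
          using f'm by (intro borel_measurable_scaleR borel_measurable_indicator) auto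
        show "(\<lambda>x. indicator (box l u) x * f x) \<in> borel_measurable lebesgue"
          using fi by (intro borel_measurable_times borel_measurable_indicator) auto
        show "AE x in lebesgue. indicator (box l u) x *\<^sub>R f' x = indicator (box l u) x * f x"
          using ae by eventually_elim simp
      qed
      finally show ?thesis using inter by simp
    qed
    have all_f': "(\<integral>x. indicator A x *\<^sub>R f' x \<partial>lborel) = 0" if "A \<in> sets borel" for A
    proof -
      have tot: "(\<integral>x. f' x \<partial>lborel) = 0"
      proof -
        have "(\<integral>x. f' x \<partial>lborel) = (\<integral>x. f' x \<partial>lebesgue)"
          using f'(1) by (intro integral_completion[symmetric]) auto
        also have "\<dots> = (\<integral>x. f x \<partial>lebesgue)"
          using ae fi f'm by (intro integral_cong_AE) auto
        finally show ?thesis using box0[OF ab] by (simp add: f_def)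
      qed
      have si: "integrable lborel (\<lambda>x. indicator A x *\<^sub>R f' x)" if "A \<in> sets borel" for A
        using f'i that by (intro integrable_mult_indicator) auto
      \<comment> \<open>Boxes generate the Borel sets and are stable under intersection, so Dynkin's
        theorem applies; the total integral \<open>tot\<close> settles complements.\<close>
      have "Int_stable (range (\<lambda>(a, b). box a b :: 'a set))"
        by (auto simp: Int_stable_def box_Int_box)
      moreover have "range (\<lambda>(a, b). box a b :: 'a set) \<subseteq> Pow UNIV" by simp
      moreover have "A \<in> sigma_sets UNIV (range (\<lambda>(a, b). box a b))"
        using that by (simp add: borel_eq_box)
      ultimately show ?thesis
      proof (induction rule: sigma_sets_induct_disjoint)
        case (basic A)
        then show ?case using box_f' by auto
      next
        case empty
        then show ?case by simp
      next
        case (compl A)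
        then have A: "A \<in> sets borel" by (simp add: borel_eq_box)
        have "(\<lambda>x. indicator (UNIV - A) x *\<^sub>R f' x) = (\<lambda>x. f' x - indicator A x *\<^sub>R f' x)"
          by (auto simp: indicator_def fun_eq_iff)
        then show ?case using compl si[OF A] f'i tot by simp
      next
        case (union A)
        then have A: "A i \<in> sets borel" for i by (auto simp: borel_eq_box)
        have "(\<integral>x\<in>(\<Union>i. A i). f' x \<partial>lborel) = (\<Sum>i. (\<integral>x\<in>A i. f' x \<partial>lborel))"
          using A union(1) si by (intro lebesgue_integral_countable_add)
            (auto simp: disjoint_family_on_def set_integrable_def)
        then show ?case using union by (simp add: set_lebesgue_integral_def)
      qed
    qed
    have "AE x in lborel. f' x = 0"
      by (rule density_unique_real[OF f'i]) (use all_f' in \<open>auto simp: set_lebesgue_integral_def\<close>)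
    then have "AE x in lebesgue. f' x = 0" by (rule AE_completion)
    with ae show ?thesis by eventually_elim (auto simp: f_def)
  qed
  \<comment> \<open>Exceptional null sets may be united only countably often, hence the passage to a
    countable subfamily by Lindelof's theorem.\<close>
  define F where "F = {box a b | a b. cbox a b \<subseteq> \<Omega>}"
  obtain F' where F': "F' \<subseteq> F" "countable F'" "\<Union>F' = \<Union>F"
    by (rule Lindelof[of F]) (auto simp: F_def)
  have "\<Omega> \<subseteq> \<Union>F"
  proof
    fix x assume "x \<in> \<Omega>"
    then obtain a b where "cbox a b \<subseteq> \<Omega>" "x \<in> box a b"
      using open_contains_cbox[OF \<Omega>] by metis
    then show "x \<in> \<Union>F" by (auto simp: F_def)
  qed
  have "AE x in lebesgue. \<forall>X\<in>F'. x \<in> X \<longrightarrow> d x = 0"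
    using F'(1) box_AE by (intro AE_ball_countable'[OF _ F'(2)]) (auto simp: F_def)
  then have "AE x in lebesgue. x \<in> \<Omega> \<longrightarrow> d x = 0"
    by eventually_elim (use \<open>\<Omega> \<subseteq> \<Union>F\<close> F'(3) in blast)
  then show ?thesis using \<Omega> by (simp add: lebesgue_on_AE_iff)
qed

section \<open>Weak gradients of square integrable functions\<close>

abbreviation pd :: "'n::finite \<Rightarrow> (real^'n \<Rightarrow> real) \<Rightarrow> real^'n \<Rightarrow> real" where
  "pd i f x \<equiv> frechet_derivative f (at x) (axis i 1)"

lemma Lp_on_2: "Lp_on 2 \<Omega> = L2 (lebesgue_on \<Omega>)"
proof -
  have "\<bar>t\<bar> powr 2 = t\<^sup>2" for t :: real
    by (cases "t = 0") (auto simp: powr_numeral)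
  then show ?thesis by (simp add: Lp_on_def L2_def)
qed

lemma L2_locally_integrable:
  assumes \<Omega>: "open \<Omega>" and u: "u \<in> L2 (lebesgue_on \<Omega>)"
  shows "locally_integrable_on u \<Omega>"
  unfolding locally_integrable_on_def
proof (intro allI impI, elim conjE)
  fix K assume K: "compact K" "K \<subseteq> \<Omega>"
  have um: "(\<lambda>x. indicator \<Omega> x *\<^sub>R u x) \<in> borel_measurable lebesgue"
    using L2D(1)[OF u] \<Omega> by (subst (asm) borel_measurable_restrict_space_iff) simp_all
  have ui: "integrable lebesgue (\<lambda>x. indicator \<Omega> x *\<^sub>R (u x)\<^sup>2)"
    using L2D(2)[OF u] \<Omega> by (subst (asm) integrable_restrict_space) simp_all
  have Km: "K \<in> sets lebesgue" using K by (simp add: borel_compact)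
  have eq: "(\<lambda>x. indicator K x *\<^sub>R u x) = (\<lambda>x. indicator K x *\<^sub>R (indicator \<Omega> x *\<^sub>R u x))"
    using K by (auto simp: indicator_def fun_eq_iff)
  have "integrable lebesgue (\<lambda>x. indicator K x *\<^sub>R u x)"
  proof (rule Bochner_Integration.integrable_bound)
    have "integrable lebesgue (\<lambda>x. 1 * indicator K x :: real)"
      using integrable_indicator_compact[OF K(1), of 1] K(1)
      by (subst integrable_completion) (auto simp: borel_compact)
    then show "integrable lebesgue (\<lambda>x. 1 * indicator K x + indicator \<Omega> x *\<^sub>R (u x)\<^sup>2)"
      using ui by (rule Bochner_Integration.integrable_add)
    show "(\<lambda>x. indicator K x *\<^sub>R u x) \<in> borel_measurable lebesgue"
      unfolding eq using um Km by (rule borel_measurable_scaleR[OF borel_measurable_indicator, rotated])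
    have "\<bar>t\<bar> \<le> 1 + t\<^sup>2" for t :: real
    proof -
      have "0 \<le> (\<bar>t\<bar> - 1)\<^sup>2 + \<bar>t\<bar>\<^sup>2 + 1" by simp
      then show ?thesis by (simp add: power2_diff)
    qed
    then show "AE x in lebesgue. norm (indicator K x *\<^sub>R u x) \<le> norm (1 * indicator K x + indicator \<Omega> x *\<^sub>R (u x)\<^sup>2)"
      using K by (auto simp: indicator_def abs_of_nonneg)
  qed
  then show "u absolutely_integrable_on K" by (simp add: set_integrable_def)
qed

lemma test_function_L2:
  assumes \<Omega>: "open \<Omega>" and \<psi>: "\<psi> \<in> test_functions \<Omega>"
  shows "\<psi> \<in> L2 (lebesgue_on \<Omega>)"
proof -
  obtain K where K: "compact K" "K \<subseteq> \<Omega>" "\<And>x. x \<notin> K \<Longrightarrow> \<psi> x = 0"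
    using test_functionsE[OF \<psi>] by metis
  note s = test_functions_smooth[OF \<psi>]
  have L: "\<psi> \<in> L2 lborel"
    using L2_compact_support_continuous[OF smooth_continuous[OF s] K(1,3)] .
  have m: "\<psi> \<in> borel_measurable borel" using s by (rule smooth_borel)
  have "integrable (lebesgue_on \<Omega>) (\<lambda>x. (\<psi> x)\<^sup>2)"
    using integral_lebesgue_on_borel(2)[OF \<Omega>, of "\<lambda>x. (\<psi> x)\<^sup>2"] m K L by (auto simp: L2_def)
  moreover have "\<psi> \<in> borel_measurable (lebesgue_on \<Omega>)"
    using m by (intro measurable_restrict_space1 measurable_completion) simp
  ultimately show ?thesis by (simp add: L2_def)
qed

lemma weak_partial_unique:
  assumes \<Omega>: "open \<Omega>" and g: "has_weak_partial \<Omega> i u g" "has_weak_partial \<Omega> i u h"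
  shows "AE x in lebesgue_on \<Omega>. g x = h x"
proof -
  have "AE x in lebesgue_on \<Omega>. g x - h x = 0"
  proof (rule du_Bois_Reymond[OF \<Omega>])
    have li: "locally_integrable_on g \<Omega>" "locally_integrable_on h \<Omega>"
      using g by (auto simp: has_weak_partial_def)
    then show "locally_integrable_on (\<lambda>x. g x - h x) \<Omega>"
      by (auto simp: locally_integrable_on_def set_integral_diff)
    fix \<psi> assume \<psi>: "\<psi> \<in> test_functions \<Omega>"
    have int: "integrable (lebesgue_on \<Omega>) (\<lambda>x. f x * \<psi> x)" if f: "locally_integrable_on f \<Omega>" for f
    proof -
      obtain K where K: "compact K" "K \<subseteq> \<Omega>" "\<And>x. x \<notin> K \<Longrightarrow> \<psi> x = 0"
        using test_functionsE[OF \<psi>] by metis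
      obtain B where B: "\<And>x. \<bar>\<psi> x\<bar> \<le> B" using test_function_bounded[OF \<psi>] by blast
      have fK: "integrable lebesgue (\<lambda>x. indicator K x *\<^sub>R f x)"
        using f K by (auto simp: locally_integrable_on_def set_integrable_def)
      have \<psi>m: "\<psi> \<in> borel_measurable lebesgue"
        using smooth_borel[OF test_functions_smooth[OF \<psi>]] by (intro measurable_completion) simp
      have eq: "(\<lambda>x. indicator \<Omega> x *\<^sub>R (f x * \<psi> x)) = (\<lambda>x. \<psi> x * (indicator K x *\<^sub>R f x))"
        using K by (force simp: indicator_def fun_eq_iff)
      have "integrable lebesgue (\<lambda>x. \<psi> x * (indicator K x *\<^sub>R f x))"
      proof (rule Bochner_Integration.integrable_bound)
        show "integrable lebesgue (\<lambda>x. B * norm (indicator K x *\<^sub>R f x))"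
          using fK by (intro integrable_mult_right integrable_norm)
        show "AE x in lebesgue. norm (\<psi> x * (indicator K x *\<^sub>R f x)) \<le> norm (B * norm (indicator K x *\<^sub>R f x))"
          unfolding real_norm_def abs_mult abs_abs
          by (intro AE_I2 mult_right_mono order_trans[OF B abs_ge_self]) auto
      qed (use fK \<psi>m in auto)
      then show ?thesis using \<Omega> by (subst integrable_restrict_space) (simp, simp only: eq)
    qed
    have "(\<integral>x. g x * \<psi> x \<partial>lebesgue_on \<Omega>) = (\<integral>x. h x * \<psi> x \<partial>lebesgue_on \<Omega>)"
      using g \<psi> by (auto simp: has_weak_partial_def)
    then show "(\<integral>x. (g x - h x) * \<psi> x \<partial>lebesgue_on \<Omega>) = 0"
      using int[OF li(1)] int[OF li(2)] by (simp add: left_diff_distrib)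
  qed
  then show ?thesis by simp
qed

text \<open>The product f \<psi> is of class C^1 with compact support, so the integral of its
  derivative is 0. Only \<psi> has to be smooth, which leaves room for f obtained by composing a
  test function with a function that is merely C^1.\<close>

lemma integration_by_parts:
  assumes \<Omega>: "open \<Omega>" and f: "C_k 1 f" and \<psi>: "\<psi> \<in> test_functions \<Omega>"
  shows "(\<integral>x. f x * pd i \<psi> x \<partial>lebesgue_on \<Omega>) = - (\<integral>x. pd i f x * \<psi> x \<partial>lebesgue_on \<Omega>)"
proof -
  obtain K where K: "compact K" "K \<subseteq> \<Omega>" "\<And>x. x \<notin> K \<Longrightarrow> \<psi> x = 0"
    using test_functionsE[OF \<psi>] by metis
  have f1: "C_k (Suc 0) f" and \<psi>1: "C_k (Suc 0) \<psi>"
    using f smooth_C_k[OF test_functions_smooth[OF \<psi>]] by auto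
  have p: "C_k 1 (\<lambda>x. f x * \<psi> x)" using C_k_mult[OF f1 \<psi>1] by simp
  have d: "pd i (\<lambda>x. f x * \<psi> x) x = f x * pd i \<psi> x + pd i f x * \<psi> x" for x
    by (rule frechet_derivative_eqI) (intro has_derivative_mult C_kD[OF f1] C_kD[OF \<psi>1])
  have z: "pd i \<psi> x = 0" if "x \<notin> K" for x
    using frechet_derivative_zero_outside[OF K(1,3) that] .
  have c: "continuous_on UNIV (\<lambda>x. f x * pd i \<psi> x)" "continuous_on UNIV (\<lambda>x. pd i f x * \<psi> x)"
    using C_k_continuous[OF C_kD(2)[OF f1]] C_k_continuous[OF C_kD(2)[OF \<psi>1]] C_k_continuous[OF f1] C_k_continuous[OF \<psi>1]
    by (auto intro: continuous_intros)
  have i1: "integrable lborel (\<lambda>x. f x * pd i \<psi> x)"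
    using c(1) K(1) by (rule integrable_compact_support) (use z in auto)
  have i2: "integrable lborel (\<lambda>x. pd i f x * \<psi> x)"
    using c(2) K(1) by (rule integrable_compact_support) (use K in auto)
  have "(\<integral>x. pd i (\<lambda>x. f x * \<psi> x) x \<partial>lborel) = 0"
    using p K(1) by (rule integral_derivative_compact_support) (use K in auto)
  then have "(\<integral>x. f x * pd i \<psi> x \<partial>lborel) + (\<integral>x. pd i f x * \<psi> x \<partial>lborel) = 0"
    using i1 i2 by (simp add: d)
  moreover have "(\<integral>x. f x * pd i \<psi> x \<partial>lebesgue_on \<Omega>) = (\<integral>x. f x * pd i \<psi> x \<partial>lborel)"
    by (rule integral_lebesgue_on_borel[OF \<Omega> borel_measurable_continuous_onI[OF c(1)]]) (use z K in auto)
  moreover have "(\<integral>x. pd i f x * \<psi> x \<partial>lebesgue_on \<Omega>) = (\<integral>x. pd i f x * \<psi> x \<partial>lborel)"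
    by (rule integral_lebesgue_on_borel[OF \<Omega> borel_measurable_continuous_onI[OF c(2)]]) (use K in auto)
  ultimately show ?thesis by linarith
qed

lemma has_weak_partialI:
  assumes "open \<Omega>" "u \<in> L2 (lebesgue_on \<Omega>)" "g \<in> L2 (lebesgue_on \<Omega>)"
    and "\<And>\<psi>. \<psi> \<in> test_functions \<Omega> \<Longrightarrow>
      (\<integral>x. u x * pd i \<psi> x \<partial>lebesgue_on \<Omega>) = - (\<integral>x. g x * \<psi> x \<partial>lebesgue_on \<Omega>)"
  shows "has_weak_partial \<Omega> i u g"
  using assms L2_locally_integrable by (auto simp: has_weak_partial_def)

lemma has_weak_partialD:
  assumes "has_weak_partial \<Omega> i u g" "\<psi> \<in> test_functions \<Omega>"
  shows "(\<integral>x. u x * pd i \<psi> x \<partial>lebesgue_on \<Omega>) = - (\<integral>x. g x * \<psi> x \<partial>lebesgue_on \<Omega>)"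
  using assms by (auto simp: has_weak_partial_def)

lemma has_weak_partial_diff:
  assumes \<Omega>: "open \<Omega>"
    and L: "u \<in> L2 (lebesgue_on \<Omega>)" "g \<in> L2 (lebesgue_on \<Omega>)" "v \<in> L2 (lebesgue_on \<Omega>)" "h \<in> L2 (lebesgue_on \<Omega>)"
    and w: "has_weak_partial \<Omega> i u g" "has_weak_partial \<Omega> i v h"
  shows "has_weak_partial \<Omega> i (\<lambda>x. u x - v x) (\<lambda>x. g x - h x)"
proof (rule has_weak_partialI[OF \<Omega> L2_diff[OF L(1,3)] L2_diff[OF L(2,4)]])
  fix \<psi> assume \<psi>: "\<psi> \<in> test_functions \<Omega>"
  note T = test_function_L2[OF \<Omega> \<psi>] test_function_L2[OF \<Omega> test_function_derivative[OF \<psi>, of "axis i 1"]]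
  show "(\<integral>x. (u x - v x) * pd i \<psi> x \<partial>lebesgue_on \<Omega>) = - (\<integral>x. (g x - h x) * \<psi> x \<partial>lebesgue_on \<Omega>)"
    using L2_mult_integrable[OF L(1) T(2)] L2_mult_integrable[OF L(3) T(2)]
      L2_mult_integrable[OF L(2) T(1)] L2_mult_integrable[OF L(4) T(1)]
      has_weak_partialD[OF w(1) \<psi>] has_weak_partialD[OF w(2) \<psi>]
    by (simp add: left_diff_distrib)
qed

lemma test_has_weak_partial:
  assumes \<Omega>: "open \<Omega>" and \<psi>: "\<psi> \<in> test_functions \<Omega>"
  shows "has_weak_partial \<Omega> i \<psi> (pd i \<psi>)"
  by (intro has_weak_partialI integration_by_parts smooth_C_k test_functions_smooth[OF \<psi>]
      test_function_L2 test_function_derivative \<Omega> \<psi>)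

text \<open>The choice operator may pick any weak derivative, and nothing in
  \<open>has_weak_partial\<close> makes the chosen one square integrable. Uniqueness identifies it
  almost everywhere with g, and completeness of Lebesgue measure transfers measurability.\<close>

lemma weak_partial_L2:
  assumes \<Omega>: "open \<Omega>" and g: "has_weak_partial \<Omega> i u g" "g \<in> L2 (lebesgue_on \<Omega>)"
  shows "AE x in lebesgue_on \<Omega>. weak_partial \<Omega> i u x = g x"
    and "weak_partial \<Omega> i u \<in> L2 (lebesgue_on \<Omega>)"
    and "has_weak_partial \<Omega> i u (weak_partial \<Omega> i u)"
proof -
  show h: "has_weak_partial \<Omega> i u (weak_partial \<Omega> i u)"
    unfolding weak_partial_def using g(1) by (rule someI[of "has_weak_partial \<Omega> i u"])
  then show ae: "AE x in lebesgue_on \<Omega>. weak_partial \<Omega> i u x = g x"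
    using g(1) by (rule weak_partial_unique[OF \<Omega>])
  then have "AE x in lebesgue. x \<in> \<Omega> \<longrightarrow> weak_partial \<Omega> i u x = g x"
    using \<Omega> by (simp add: lebesgue_on_AE_iff)
  then have ae': "AE x in lebesgue. indicator \<Omega> x *\<^sub>R g x = indicator \<Omega> x *\<^sub>R weak_partial \<Omega> i u x"
    by eventually_elim (auto simp: indicator_def)
  have "(\<lambda>x. indicator \<Omega> x *\<^sub>R g x) \<in> borel_measurable lebesgue"
    using L2D(1)[OF g(2)] \<Omega> by (subst (asm) borel_measurable_restrict_space_iff) simp_all
  then have "(\<lambda>x. indicator \<Omega> x *\<^sub>R weak_partial \<Omega> i u x) \<in> borel_measurable lebesgue"
    using ae' by (rule borel_measurable_AE)
  then have "weak_partial \<Omega> i u \<in> borel_measurable (lebesgue_on \<Omega>)"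
    using \<Omega> by (subst borel_measurable_restrict_space_iff) simp_all
  then show "weak_partial \<Omega> i u \<in> L2 (lebesgue_on \<Omega>)"
    by (rule L2_bound[OF g(2), of _ 1]) (use ae in auto)
qed

lemma W12_weak_partial:
  assumes "open \<Omega>" "u \<in> W12 \<Omega>"
  shows "u \<in> L2 (lebesgue_on \<Omega>)" "weak_partial \<Omega> i u \<in> L2 (lebesgue_on \<Omega>)"
    "has_weak_partial \<Omega> i u (weak_partial \<Omega> i u)"
proof -
  obtain g where "has_weak_partial \<Omega> i u g" "g \<in> L2 (lebesgue_on \<Omega>)"
    using assms(2) by (auto simp: W12_def Lp_on_2)
  from weak_partial_L2[OF assms(1) this]
  show "weak_partial \<Omega> i u \<in> L2 (lebesgue_on \<Omega>)" "has_weak_partial \<Omega> i u (weak_partial \<Omega> i u)" by auto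
qed (use assms in \<open>auto simp: W12_def Lp_on_2\<close>)

text \<open>The gradient is an explicit argument, so that formulas such as the product and chain
  rule can name a representative instead of the arbitrary \<open>weak_partial\<close>.\<close>

definition weak_gradient :: "(real^'n::finite) set \<Rightarrow> (real^'n \<Rightarrow> real) \<Rightarrow> ('n \<Rightarrow> real^'n \<Rightarrow> real) \<Rightarrow> bool" where
  "weak_gradient \<Omega> u g \<longleftrightarrow> u \<in> L2 (lebesgue_on \<Omega>) \<and>
     (\<forall>i. g i \<in> L2 (lebesgue_on \<Omega>) \<and> has_weak_partial \<Omega> i u (g i))"

lemma weak_gradientD:
  assumes "weak_gradient \<Omega> u g"
  shows "u \<in> L2 (lebesgue_on \<Omega>)" "g i \<in> L2 (lebesgue_on \<Omega>)" "has_weak_partial \<Omega> i u (g i)"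
  using assms by (auto simp: weak_gradient_def)

lemma weak_gradient_W12: "weak_gradient \<Omega> u g \<Longrightarrow> u \<in> W12 \<Omega>"
  by (auto simp: weak_gradient_def W12_def Lp_on_2)

lemma W12_weak_gradient: "open \<Omega> \<Longrightarrow> u \<in> W12 \<Omega> \<Longrightarrow> weak_gradient \<Omega> u (\<lambda>i. weak_partial \<Omega> i u)"
  by (simp add: weak_gradient_def W12_weak_partial)

lemma weak_gradient_test:
  "open \<Omega> \<Longrightarrow> \<psi> \<in> test_functions \<Omega> \<Longrightarrow> weak_gradient \<Omega> \<psi> (\<lambda>i. pd i \<psi>)"
  by (auto simp: weak_gradient_def intro: test_has_weak_partial test_function_L2 test_function_derivative)

lemma weak_gradient_diff:
  "open \<Omega> \<Longrightarrow> weak_gradient \<Omega> u g \<Longrightarrow> weak_gradient \<Omega> v h \<Longrightarrow>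
    weak_gradient \<Omega> (\<lambda>x. u x - v x) (\<lambda>i x. g i x - h i x)"
  by (auto simp: weak_gradient_def intro: has_weak_partial_diff L2_diff)

lemma W12_norm_eq:
  assumes \<Omega>: "open \<Omega>" and g: "weak_gradient \<Omega> u g"
  shows "W12_norm \<Omega> u = sqrt ((nrm (lebesgue_on \<Omega>) u)\<^sup>2 + (\<Sum>i\<in>UNIV. (nrm (lebesgue_on \<Omega>) (g i))\<^sup>2))"
proof -
  have "nrm (lebesgue_on \<Omega>) (weak_partial \<Omega> i u) = nrm (lebesgue_on \<Omega>) (g i)" for i
    using weak_partial_L2[OF \<Omega> weak_gradientD(3,2)[OF g]] L2D(1)[OF weak_gradientD(2)[OF g]]
    by (intro nrm_cong_AE) auto
  then show ?thesis by (simp add: W12_norm_def flip: nrm_power2)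
qed

lemma W12_norm_bounds:
  assumes \<Omega>: "open \<Omega>" and g: "weak_gradient \<Omega> u g"
  shows "nrm (lebesgue_on \<Omega>) u \<le> W12_norm \<Omega> u" "nrm (lebesgue_on \<Omega>) (g i) \<le> W12_norm \<Omega> u"
    and "W12_norm \<Omega> u \<le> nrm (lebesgue_on \<Omega>) u + (\<Sum>i\<in>UNIV. nrm (lebesgue_on \<Omega>) (g i))"
proof -
  let ?N = "nrm (lebesgue_on \<Omega>)"
  have s: "(?N (g i))\<^sup>2 \<le> (\<Sum>i\<in>UNIV. (?N (g i))\<^sup>2)" for i
    by (rule member_le_sum) auto
  show "?N u \<le> W12_norm \<Omega> u"
    unfolding W12_norm_eq[OF assms] by (rule real_le_rsqrt) (simp add: sum_nonneg)
  show "?N (g i) \<le> W12_norm \<Omega> u"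
    unfolding W12_norm_eq[OF assms] by (rule real_le_rsqrt) (use s[of i] in \<open>simp add: add_increasing\<close>)
  have sq: "(\<Sum>i\<in>I. (?N (g i))\<^sup>2) \<le> (\<Sum>i\<in>I. ?N (g i))\<^sup>2" if "finite I" for I
    using that
  proof induction
    case (insert i I)
    have "0 \<le> 2 * ?N (g i) * (\<Sum>i\<in>I. ?N (g i))"
      by (intro mult_nonneg_nonneg sum_nonneg) (auto simp: nrm_nonneg)
    then show ?case using insert by (simp add: power2_sum)
  qed simp
  have "0 \<le> 2 * ?N u * (\<Sum>i\<in>UNIV. ?N (g i))"
    by (intro mult_nonneg_nonneg sum_nonneg) (auto simp: nrm_nonneg)
  then have "(?N u)\<^sup>2 + (\<Sum>i\<in>UNIV. (?N (g i))\<^sup>2) \<le> (?N u + (\<Sum>i\<in>UNIV. ?N (g i)))\<^sup>2"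
    using sq[of UNIV] by (simp add: power2_sum)
  then show "W12_norm \<Omega> u \<le> ?N u + (\<Sum>i\<in>UNIV. ?N (g i))"
    unfolding W12_norm_eq[OF assms] by (intro real_le_lsqrt) (auto simp: nrm_nonneg intro!: add_nonneg_nonneg sum_nonneg)
qed

section \<open>Convergence in the Sobolev space and closedness of \<open>W12_0\<close>\<close>

definition W12_tendsto :: "(real^'n::finite) set \<Rightarrow> (nat \<Rightarrow> real^'n \<Rightarrow> real) \<Rightarrow> (nat \<Rightarrow> 'n \<Rightarrow> real^'n \<Rightarrow> real) \<Rightarrow>
    (real^'n \<Rightarrow> real) \<Rightarrow> ('n \<Rightarrow> real^'n \<Rightarrow> real) \<Rightarrow> bool" where
  "W12_tendsto \<Omega> F G f g \<longleftrightarrow> (\<forall>m. weak_gradient \<Omega> (F m) (G m)) \<and>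
     L2_tendsto (lebesgue_on \<Omega>) F f \<and> (\<forall>i. L2_tendsto (lebesgue_on \<Omega>) (\<lambda>m. G m i) (g i))"

text \<open>Both sides of the defining identity are integrals against a fixed square integrable
  function, and these pass to the limit.\<close>

lemma W12_tendsto_weak_gradient:
  assumes \<Omega>: "open \<Omega>" and t: "W12_tendsto \<Omega> F G f g"
  shows "weak_gradient \<Omega> f g"
  unfolding weak_gradient_def
proof (intro conjI allI)
  have F: "weak_gradient \<Omega> (F m) (G m)" "L2_tendsto (lebesgue_on \<Omega>) F f" "L2_tendsto (lebesgue_on \<Omega>) (\<lambda>m. G m i) (g i)" for i m
    using t by (auto simp: W12_tendsto_def)
  show fL: "f \<in> L2 (lebesgue_on \<Omega>)" and gL: "g i \<in> L2 (lebesgue_on \<Omega>)" for i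
    using L2_tendstoD(1)[OF F(2)] L2_tendstoD(1)[OF F(3)] by auto
  fix i
  show "has_weak_partial \<Omega> i f (g i)"
  proof (rule has_weak_partialI[OF \<Omega> fL gL])
    fix \<psi> assume \<psi>: "\<psi> \<in> test_functions \<Omega>"
    note T = test_function_L2[OF \<Omega> \<psi>] test_function_L2[OF \<Omega> test_function_derivative[OF \<psi>, of "axis i 1"]]
    have "(\<integral>x. F m x * pd i \<psi> x \<partial>lebesgue_on \<Omega>) = - (\<integral>x. G m i x * \<psi> x \<partial>lebesgue_on \<Omega>)" for m
      using has_weak_partialD[OF weak_gradientD(3)[OF F(1)] \<psi>] .
    with L2_tendsto_integral[OF F(2) T(2)]
    have "(\<lambda>m. - (\<integral>x. G m i x * \<psi> x \<partial>lebesgue_on \<Omega>)) \<longlonglongrightarrow> (\<integral>x. f x * pd i \<psi> x \<partial>lebesgue_on \<Omega>)"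
      by simp
    moreover have "(\<lambda>m. - (\<integral>x. G m i x * \<psi> x \<partial>lebesgue_on \<Omega>)) \<longlonglongrightarrow> - (\<integral>x. g i x * \<psi> x \<partial>lebesgue_on \<Omega>)"
      using L2_tendsto_integral[OF F(3) T(1)] by (rule tendsto_minus)
    ultimately show "(\<integral>x. f x * pd i \<psi> x \<partial>lebesgue_on \<Omega>) = - (\<integral>x. g i x * \<psi> x \<partial>lebesgue_on \<Omega>)"
      by (rule LIMSEQ_unique)
  qed
qed

lemma W12_0_approx:
  assumes \<Omega>: "open \<Omega>" and v: "v \<in> W12_0 \<Omega>" and g: "weak_gradient \<Omega> v g"
  obtains \<psi> where "\<And>m. \<psi> m \<in> test_functions \<Omega>" "W12_tendsto \<Omega> \<psi> (\<lambda>m i. pd i (\<psi> m)) v g"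
proof -
  have "\<exists>\<psi> \<in> test_functions \<Omega>. W12_norm \<Omega> (\<lambda>x. v x - \<psi> x) < inverse (real (Suc m))" for m
    using v by (simp add: W12_0_def)
  then obtain \<psi> where \<psi>: "\<And>m. \<psi> m \<in> test_functions \<Omega>"
      "\<And>m. W12_norm \<Omega> (\<lambda>x. v x - \<psi> m x) < inverse (real (Suc m))"
    by metis
  have b: "nrm (lebesgue_on \<Omega>) (\<lambda>x. v x - \<psi> m x) \<le> W12_norm \<Omega> (\<lambda>x. v x - \<psi> m x)"
    "nrm (lebesgue_on \<Omega>) (\<lambda>x. g i x - pd i (\<psi> m) x) \<le> W12_norm \<Omega> (\<lambda>x. v x - \<psi> m x)" for m i
    using W12_norm_bounds[OF \<Omega> weak_gradient_diff[OF \<Omega> g weak_gradient_test[OF \<Omega> \<psi>(1)[of m]]]] by auto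
  have "W12_tendsto \<Omega> \<psi> (\<lambda>m i. pd i (\<psi> m)) v g"
    unfolding W12_tendsto_def
  proof (intro conjI allI)
    show "weak_gradient \<Omega> (\<psi> m) (\<lambda>i. pd i (\<psi> m))" for m by (rule weak_gradient_test[OF \<Omega> \<psi>(1)])
    show "L2_tendsto (lebesgue_on \<Omega>) \<psi> v"
    proof (rule L2_tendsto_null_bound[OF _ _ LIMSEQ_inverse_real_of_nat])
      show "nrm (lebesgue_on \<Omega>) (\<lambda>x. \<psi> m x - v x) \<le> inverse (real (Suc m))" for m
        using b(1)[where m=m] \<psi>(2)[of m] by (subst nrm_minus_commute) linarith
    qed (use g in \<open>auto dest: weak_gradientD intro: test_function_L2 \<Omega> \<psi>\<close>)
    show "L2_tendsto (lebesgue_on \<Omega>) (\<lambda>m. pd i (\<psi> m)) (g i)" for i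
    proof (rule L2_tendsto_null_bound[OF _ _ LIMSEQ_inverse_real_of_nat])
      show "nrm (lebesgue_on \<Omega>) (\<lambda>x. pd i (\<psi> m) x - g i x) \<le> inverse (real (Suc m))" for m
        using b(2)[where m=m and i=i] \<psi>(2)[of m] by (subst nrm_minus_commute) linarith
    qed (use g in \<open>auto dest: weak_gradientD intro: test_function_L2 test_function_derivative \<Omega> \<psi>\<close>)
  qed
  with \<psi>(1) show ?thesis by (rule that)
qed

text \<open>\<open>W12_0\<close> is defined by approximation with test functions, while the
  approximants built below are only members of \<open>W12_0\<close>. A second approximation, with
  half of the tolerance, returns to test functions.\<close>

lemma W12_0_closed:
  fixes \<Omega> :: "(real^'n::finite) set"
  assumes \<Omega>: "open \<Omega>" and t: "W12_tendsto \<Omega> F G f g" and F: "\<And>m. F m \<in> W12_0 \<Omega>"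
  shows "f \<in> W12_0 \<Omega>"
  unfolding W12_0_def
proof (intro CollectI conjI allI impI)
  let ?N = "nrm (lebesgue_on \<Omega>)"
  note wg = W12_tendsto_weak_gradient[OF \<Omega> t]
  show "f \<in> W12 \<Omega>" using wg by (rule weak_gradient_W12)
  have wF: "weak_gradient \<Omega> (F m) (G m)" for m using t by (auto simp: W12_tendsto_def)
  fix \<delta> :: real assume \<delta>: "\<delta> > 0"
  have lim: "(\<lambda>m. ?N (\<lambda>x. F m x - f x) + (\<Sum>i\<in>UNIV. ?N (\<lambda>x. G m i x - g i x))) \<longlonglongrightarrow> 0 + (\<Sum>i\<in>(UNIV::'n set). 0)"
    if "W12_tendsto \<Omega> F G f g" for F G f g
    using that by (intro tendsto_add tendsto_sum) (auto simp: W12_tendsto_def L2_tendsto_def)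
  note lim[OF t]
  then have "\<forall>\<^sub>F m in sequentially. ?N (\<lambda>x. F m x - f x) + (\<Sum>i\<in>UNIV. ?N (\<lambda>x. G m i x - g i x)) < \<delta> / 2"
    by (rule order_tendstoD) (use \<delta> in auto)
  then obtain m where m: "?N (\<lambda>x. F m x - f x) + (\<Sum>i\<in>UNIV. ?N (\<lambda>x. G m i x - g i x)) < \<delta> / 2"
    by (auto simp: eventually_sequentially)
  obtain \<phi> where \<phi>: "\<And>k. \<phi> k \<in> test_functions \<Omega>" "W12_tendsto \<Omega> \<phi> (\<lambda>m i. pd i (\<phi> m)) (F m) (G m)"
    using W12_0_approx[OF \<Omega> F wF] by metis
  from lim[OF \<phi>(2)] have "\<forall>\<^sub>F k in sequentially. ?N (\<lambda>x. \<phi> k x - F m x) + (\<Sum>i\<in>UNIV. ?N (\<lambda>x. pd i (\<phi> k) x - G m i x)) < \<delta> / 2"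
    by (rule order_tendstoD) (use \<delta> in auto)
  then obtain k where k: "?N (\<lambda>x. \<phi> k x - F m x) + (\<Sum>i\<in>UNIV. ?N (\<lambda>x. pd i (\<phi> k) x - G m i x)) < \<delta> / 2"
    by (auto simp: eventually_sequentially)
  note w\<phi> = weak_gradient_test[OF \<Omega> \<phi>(1), of k]
  have "W12_norm \<Omega> (\<lambda>x. f x - \<phi> k x) \<le> ?N (\<lambda>x. f x - \<phi> k x) + (\<Sum>i\<in>UNIV. ?N (\<lambda>x. g i x - pd i (\<phi> k) x))"
    by (rule W12_norm_bounds(3)[OF \<Omega> weak_gradient_diff[OF \<Omega> wg w\<phi>]])
  also have "\<dots> \<le> (?N (\<lambda>x. f x - F m x) + ?N (\<lambda>x. F m x - \<phi> k x))
      + (\<Sum>i\<in>UNIV. ?N (\<lambda>x. g i x - G m i x) + ?N (\<lambda>x. G m i x - pd i (\<phi> k) x))"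
    by (intro add_mono sum_mono nrm_triangle3 L2_diff weak_gradientD[OF wg] weak_gradientD[OF wF] weak_gradientD[OF w\<phi>])
  also have "\<dots> < \<delta>"
    using m k by (simp add: sum.distrib nrm_minus_commute[of _ f "F m"] nrm_minus_commute[of _ "F m" "\<phi> k"]
        nrm_minus_commute[of _ "g _" "G m _"] nrm_minus_commute[of _ "G m _" "pd _ (\<phi> k)"])
  finally show "\<exists>\<psi>\<in>test_functions \<Omega>. W12_norm \<Omega> (\<lambda>x. f x - \<psi> x) < \<delta>" using \<phi>(1) by blast
qed

lemma test_function_W12_0:
  assumes \<Omega>: "open \<Omega>" and \<psi>: "\<psi> \<in> test_functions \<Omega>"
  shows "\<psi> \<in> W12_0 \<Omega>"
proof -
  have z: "(\<lambda>x. 0) \<in> test_functions \<Omega>"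
    by (rule test_functionsI[of _ "{}"]) (auto simp: smooth_const)
  have "weak_gradient \<Omega> (\<lambda>x. \<psi> x - \<psi> x) (\<lambda>i x. pd i \<psi> x - pd i \<psi> x)"
    by (intro weak_gradient_diff weak_gradient_test \<Omega> \<psi>)
  from W12_norm_eq[OF \<Omega> this] have "W12_norm \<Omega> (\<lambda>x. \<psi> x - \<psi> x) = 0"
    by (simp add: nrm_def)
  then show ?thesis
    using weak_gradient_W12[OF weak_gradient_test[OF assms]] \<psi> by (auto simp: W12_0_def intro!: bexI[of _ \<psi>])
qed

section \<open>Products of Sobolev functions with test functions\<close>

lemma C_k_reflect: "C_k k f \<Longrightarrow> C_k k (\<lambda>y. f (a - y))"
proof (induction k arbitrary: f)
  case 0
  then show ?case by (auto intro!: continuous_on_compose2[of UNIV f] continuous_intros)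
next
  case (Suc k)
  show ?case
  proof (rule C_k_SucI)
    show "((\<lambda>y. f (a - y)) has_derivative (\<lambda>v. frechet_derivative f (at (a - y)) (- v))) (at y)" for y
      by (rule has_derivative_compose[OF _ C_kD(1)[OF Suc.prems]]) (auto intro!: derivative_eq_intros)
    show "C_k k (\<lambda>y. frechet_derivative f (at (a - y)) (- v))" for v
      using Suc.IH[OF C_kD(2)[OF Suc.prems]] .
  qed
qed

lemma smooth_reflect:
  assumes "smooth f"
  shows "smooth (\<lambda>y. f (a - y))"
    and "frechet_derivative (\<lambda>y. f (a - y)) (at y) v = - frechet_derivative f (at (a - y)) v"
proof -
  show "smooth (\<lambda>y. f (a - y))" using assms by (simp add: smooth_def C_k_reflect)
  have "((\<lambda>y. f (a - y)) has_derivative (\<lambda>v. frechet_derivative f (at (a - y)) (- v))) (at y)"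
    by (rule has_derivative_compose[OF _ smooth_has_derivative[OF assms]]) (auto intro!: derivative_eq_intros)
  then have "frechet_derivative (\<lambda>y. f (a - y)) (at y) v = frechet_derivative f (at (a - y)) (- v)"
    by (rule frechet_derivative_eqI)
  also have "\<dots> = - frechet_derivative f (at (a - y)) v"
    using has_derivative_linear[OF smooth_has_derivative[OF assms]] by (rule linear_neg)
  finally show "frechet_derivative (\<lambda>y. f (a - y)) (at y) v = - frechet_derivative f (at (a - y)) v" .
qed

text \<open>The closed r-neighbourhood of K is the sum of K and a closed ball, hence compact. It
  holds the supports of all mollifications of radius at most r of functions supported in K.\<close>

lemma compact_neighbourhood:
  fixes K \<Omega> :: "'a::euclidean_space set"
  assumes "compact K" "open \<Omega>" "K \<subseteq> \<Omega>"
  obtains r where "r > 0" "compact {x. \<exists>y\<in>K. dist x y \<le> r}" "{x. \<exists>y\<in>K. dist x y \<le> r} \<subseteq> \<Omega>"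
proof -
  obtain d where d: "d > 0" "\<forall>x\<in>K. \<forall>y\<in>-\<Omega>. d \<le> dist x y"
    using separate_compact_closed[OF assms(1), of "- \<Omega>"] assms by auto
  have "{x. \<exists>y\<in>K. dist x y \<le> d / 2} = {y + z | y z. y \<in> K \<and> z \<in> cball 0 (d / 2)}"
  proof (intro set_eqI iffI)
    fix x assume "x \<in> {x. \<exists>y\<in>K. dist x y \<le> d / 2}"
    then obtain y where "y \<in> K" "dist x y \<le> d / 2" by auto
    then have "x = y + (x - y)" "x - y \<in> cball 0 (d / 2)" by (auto simp: dist_norm norm_minus_commute)
    then show "x \<in> {y + z | y z. y \<in> K \<and> z \<in> cball 0 (d / 2)}" using \<open>y \<in> K\<close> by blast
  next
    fix x assume "x \<in> {y + z | y z. y \<in> K \<and> z \<in> cball 0 (d / 2)}"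
    then obtain y z where "x = y + z" "y \<in> K" "norm z \<le> d / 2" by auto
    then show "x \<in> {x. \<exists>y\<in>K. dist x y \<le> d / 2}" by (auto simp: dist_norm intro!: bexI[of _ y])
  qed
  then have "compact {x. \<exists>y\<in>K. dist x y \<le> d / 2}"
    by (simp only: compact_sums[OF assms(1) compact_cball])
  moreover have "{x. \<exists>y\<in>K. dist x y \<le> d / 2} \<subseteq> \<Omega>"
  proof
    fix x assume "x \<in> {x. \<exists>y\<in>K. dist x y \<le> d / 2}"
    then obtain y where "y \<in> K" "dist x y \<le> d / 2" by auto
    then show "x \<in> \<Omega>" using d by (force simp: dist_commute)
  qed
  ultimately show ?thesis using d(1) by (intro that[of "d / 2"]) auto
qed

text \<open>Mollifications converge over the whole space to a Borel representative; the convergence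
  is carried back to \<Omega> and to the original function f0.\<close>

lemma L2_tendsto_lebesgue_on:
  fixes F :: "nat \<Rightarrow> 'a::euclidean_space \<Rightarrow> real"
  assumes \<Omega>: "open \<Omega>" and t: "L2_tendsto lborel F f"
    and z: "\<And>m x. x \<notin> \<Omega> \<Longrightarrow> F m x = 0" "\<And>x. x \<notin> \<Omega> \<Longrightarrow> f x = 0"
    and f0: "f0 \<in> L2 (lebesgue_on \<Omega>)" "AE x in lebesgue_on \<Omega>. f0 x = f x"
  shows "L2_tendsto (lebesgue_on \<Omega>) F f0"
proof (rule L2_tendsto_null_bound[OF _ f0(1) L2_tendstoD(3)[OF t]])
  note T = L2_tendstoD[OF t]
  have m: "F m \<in> borel_measurable (lebesgue_on \<Omega>)" "f \<in> borel_measurable (lebesgue_on \<Omega>)" for m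
    using T(4) T(5)[of m] by (auto intro!: measurable_restrict_space1 measurable_completion)
  show "F m \<in> L2 (lebesgue_on \<Omega>)" for m
  proof -
    have "(\<lambda>x. (F m x)\<^sup>2) \<in> borel_measurable borel" "x \<notin> \<Omega> \<Longrightarrow> (F m x)\<^sup>2 = 0" for x
      using T(5)[of m] z(1) by auto
    from integral_lebesgue_on_borel(2)[OF \<Omega> this] L2D(2)[OF T(2)[of m]]
    have "integrable (lebesgue_on \<Omega>) (\<lambda>x. (F m x)\<^sup>2)" by blast
    then show ?thesis using m(1) unfolding L2_def by blast
  qed
  show "nrm (lebesgue_on \<Omega>) (\<lambda>x. F m x - f0 x) \<le> nrm lborel (\<lambda>x. F m x - f x)" for m
  proof -
    have "nrm (lebesgue_on \<Omega>) (\<lambda>x. F m x - f0 x) = nrm (lebesgue_on \<Omega>) (\<lambda>x. F m x - f x)"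
    proof (rule nrm_cong_AE)
      show "AE x in lebesgue_on \<Omega>. F m x - f0 x = F m x - f x" using f0(2) by eventually_elim simp
    qed (use m L2D(1)[OF f0(1)] in \<open>auto intro!: borel_measurable_diff\<close>)
    also have "\<dots> = nrm lborel (\<lambda>x. F m x - f x)"
    proof -
      have "(\<lambda>x. (F m x - f x)\<^sup>2) \<in> borel_measurable borel" "x \<notin> \<Omega> \<Longrightarrow> (F m x - f x)\<^sup>2 = 0" for x
        using T(4) T(5)[of m] z by auto
      from integral_lebesgue_on_borel(1)[OF \<Omega> this]
      have "(\<integral>x. (F m x - f x)\<^sup>2 \<partial>lebesgue_on \<Omega>) = (\<integral>x. (F m x - f x)\<^sup>2 \<partial>lborel)" by blast
      then show ?thesis by (simp only: nrm_def)
    qed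
    finally show ?thesis by simp
  qed
qed

lemma borel_representative_L2:
  fixes f :: "'a::euclidean_space \<Rightarrow> real"
  assumes \<Omega>: "open \<Omega>" and f: "f \<in> L2 (lebesgue_on \<Omega>)" and K: "compact K" "K \<subseteq> \<Omega>" "\<And>x. x \<notin> K \<Longrightarrow> f x = 0"
  obtains f' where "f' \<in> L2 lborel" "\<And>x. x \<notin> K \<Longrightarrow> f' x = 0" "AE x in lebesgue_on \<Omega>. f x = f' x"
proof -
  obtain h where h: "h \<in> borel_measurable borel" "\<And>x. x \<notin> \<Omega> \<Longrightarrow> h x = 0" "AE x in lebesgue_on \<Omega>. f x = h x"
    using borel_representative[OF \<Omega> L2D(1)[OF f]] by metis
  define f' where "f' x = h x * indicator K x" for x
  have m: "f' \<in> borel_measurable borel"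
    unfolding f'_def using h(1) K(1) by (intro borel_measurable_times borel_measurable_indicator) (auto simp: borel_compact)
  have z: "f' x = 0" if "x \<notin> K" for x using that by (simp add: f'_def)
  have ae: "AE x in lebesgue_on \<Omega>. f x = f' x"
    using h(3) by eventually_elim (use K(3) in \<open>auto simp: f'_def indicator_def\<close>)
  have m': "f' \<in> borel_measurable (lebesgue_on \<Omega>)"
    using m by (auto intro!: measurable_restrict_space1 measurable_completion)
  have "f' \<in> L2 (lebesgue_on \<Omega>)"
    by (rule L2_bound[OF f m', of 1]) (use ae in auto)
  moreover have "(\<lambda>x. (f' x)\<^sup>2) \<in> borel_measurable borel" "x \<notin> \<Omega> \<Longrightarrow> (f' x)\<^sup>2 = 0" for x
    using m z K(2) by auto
  ultimately have "integrable lborel (\<lambda>x. (f' x)\<^sup>2)"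
    using integral_lebesgue_on_borel(2)[OF \<Omega>, of "\<lambda>x. (f' x)\<^sup>2"] L2D(2) by blast
  then have "f' \<in> L2 lborel" using m by (simp add: L2_def)
  then show ?thesis using z ae by (rule that)
qed

text \<open>The product has compact support in \<Omega>, so mollifying it with small radius gives
  test functions. Their gradients are the mollified weak gradient, and both converge in mean square.
  This is the only place where approximants are constructed by hand.\<close>

lemma W12_mult_test:
  fixes \<Omega> :: "(real^'n::finite) set"
  assumes \<Omega>: "open \<Omega>" and g: "weak_gradient \<Omega> v g" and \<eta>: "\<eta> \<in> test_functions \<Omega>"
  shows "(\<lambda>x. v x * \<eta> x) \<in> W12_0 \<Omega>"
    and "weak_gradient \<Omega> (\<lambda>x. v x * \<eta> x) (\<lambda>i x. g i x * \<eta> x + v x * pd i \<eta> x)"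
proof -
  let ?M = "lebesgue_on \<Omega>"
  define f where "f x = v x * \<eta> x" for x
  define h where "h i x = g i x * \<eta> x + v x * pd i \<eta> x" for i x
  note v = weak_gradientD[OF g]
  obtain K where K: "compact K" "K \<subseteq> \<Omega>" "\<And>x. x \<notin> K \<Longrightarrow> \<eta> x = 0"
    using test_functionsE[OF \<eta>] by metis
  have \<eta>s: "smooth \<eta>" using \<eta> by (rule test_functions_smooth)
  have pz: "pd i \<eta> x = 0" if "x \<notin> K" for i x
    using frechet_derivative_zero_outside[OF K(1,3) that] .
  have tb: "(\<lambda>x. u x * \<phi> x) \<in> L2 ?M" if u\<phi>: "u \<in> L2 ?M" "\<phi> \<in> test_functions \<Omega>" for u \<phi>
  proof -
    obtain B where "\<And>x. \<bar>\<phi> x\<bar> \<le> B" using test_function_bounded[OF u\<phi>(2)] by blast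
    from L2_mult_bounded[OF u\<phi>(1) L2D(1)[OF test_function_L2[OF \<Omega> u\<phi>(2)]] this]
    show ?thesis by (simp add: mult.commute)
  qed
  have fL: "f \<in> L2 ?M" using tb[OF v(1) \<eta>] by (simp add: f_def[abs_def])
  have hL: "h i \<in> L2 ?M" for i
    using L2_add[OF tb[OF v(2) \<eta>] tb[OF v(1) test_function_derivative[OF \<eta>]]] by (simp add: h_def[abs_def])
  have fz: "f x = 0" "h i x = 0" if "x \<notin> K" for x i
    using that K(3) pz by (auto simp: f_def h_def)
  \<comment> \<open>The support of \<psi> is unrestricted: \<eta> already provides compact support,
    so \<eta> \<psi> is an admissible test function. This freedom is used below with \<psi> a
    translated mollifier, for arbitrary x.\<close>
  have id: "(\<integral>x. f x * pd i \<psi> x \<partial>?M) = - (\<integral>x. h i x * \<psi> x \<partial>?M)" if \<psi>: "smooth \<psi>" for i \<psi>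
  proof -
    note t1 = test_function_mult[OF \<eta> \<psi>]
    note t2 = test_function_mult[OF \<eta> smooth_derivative[OF \<psi>, of "axis i 1"]]
    note t3 = test_function_mult[OF test_function_derivative[OF \<eta>, of "axis i 1"] \<psi>]
    have i2: "integrable ?M (\<lambda>x. v x * (\<eta> x * pd i \<psi> x))"
      by (rule L2_mult_integrable[OF v(1) test_function_L2[OF \<Omega> t2]])
    have i3: "integrable ?M (\<lambda>x. v x * (pd i \<eta> x * \<psi> x))"
      by (rule L2_mult_integrable[OF v(1) test_function_L2[OF \<Omega> t3]])
    have i1: "integrable ?M (\<lambda>x. g i x * (\<eta> x * \<psi> x))"
      by (rule L2_mult_integrable[OF v(2) test_function_L2[OF \<Omega> t1]])
    have "(\<integral>x. v x * (\<eta> x * pd i \<psi> x) \<partial>?M) + (\<integral>x. v x * (pd i \<eta> x * \<psi> x) \<partial>?M)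
        = (\<integral>x. v x * pd i (\<lambda>x. \<eta> x * \<psi> x) x \<partial>?M)"
      using i2 i3 by (simp add: frechet_derivative_mult_smooth[OF \<eta>s \<psi>] distrib_left)
    also have "\<dots> = - (\<integral>x. g i x * (\<eta> x * \<psi> x) \<partial>?M)"
      by (rule has_weak_partialD[OF v(3) t1])
    finally have "(\<integral>x. v x * (\<eta> x * pd i \<psi> x) \<partial>?M)
        = - ((\<integral>x. g i x * (\<eta> x * \<psi> x) \<partial>?M) + (\<integral>x. v x * (pd i \<eta> x * \<psi> x) \<partial>?M))" by simp
    also have "(\<integral>x. g i x * (\<eta> x * \<psi> x) \<partial>?M) + (\<integral>x. v x * (pd i \<eta> x * \<psi> x) \<partial>?M) = (\<integral>x. h i x * \<psi> x \<partial>?M)"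
      using i1 i3 by (simp add: h_def algebra_simps flip: Bochner_Integration.integral_add)
    finally show ?thesis by (simp add: f_def mult.assoc)
  qed
  have wg: "weak_gradient \<Omega> f h"
    unfolding weak_gradient_def
    by (intro conjI allI has_weak_partialI \<Omega> fL hL id test_functions_smooth)
  obtain fb where fb: "fb \<in> L2 lborel" "\<And>x. x \<notin> K \<Longrightarrow> fb x = 0" "AE x in ?M. f x = fb x"
    using borel_representative_L2[OF \<Omega> fL K(1,2) fz(1)] by metis
  have "\<exists>hb. hb \<in> L2 lborel \<and> (\<forall>x. x \<notin> K \<longrightarrow> hb x = 0) \<and> (AE x in ?M. h i x = hb x)" for i
    using borel_representative_L2[OF \<Omega> hL K(1,2) fz(2)] by metis
  then obtain hb where hb: "\<And>i. hb i \<in> L2 lborel" "\<And>i x. x \<notin> K \<Longrightarrow> hb i x = 0" "\<And>i. AE x in ?M. h i x = hb i x"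
    by metis
  obtain r where r: "r > 0" "compact {x. \<exists>y\<in>K. dist x y \<le> r}" "{x. \<exists>y\<in>K. dist x y \<le> r} \<subseteq> \<Omega>"
    by (rule compact_neighbourhood[OF K(1) \<Omega> K(2)])
  define R where "R m = r * inverse (real (Suc m))" for m
  have R: "0 < R m" "R m \<le> r" for m using r(1) by (auto simp: R_def field_simps)
  have R0: "R \<longlonglongrightarrow> 0"
    using tendsto_mult_left[OF LIMSEQ_inverse_real_of_nat, of r] by (simp add: R_def[abs_def])
  obtain \<rho> where \<rho>: "\<And>m. mollifier (R m) (\<rho> m :: real^'n \<Rightarrow> real)"
    using mollifier_exists[OF R(1)] by metis
  have \<rho>t: "\<rho> m \<in> test_functions UNIV" for m using \<rho> by (simp add: mollifier_def)
  note fbi = L2_compact_support_integrable[OF fb(1) K(1) fb(2)]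
  define \<psi> where "\<psi> m = conv fb (\<rho> m)" for m
  have cz: "conv F (\<rho> m) x = 0" if "x \<notin> {x. \<exists>y\<in>K. dist x y \<le> r}" "\<And>x. x \<notin> K \<Longrightarrow> F x = 0" for F m x
    by (rule conv_zero_outside[OF \<rho> that(2)]) (use that(1) R(2)[of m] in force)+
  have \<psi>t: "\<psi> m \<in> test_functions \<Omega>" for m
    unfolding \<psi>_def using smooth_conv[OF fbi \<rho>t] r(2,3) cz[OF _ fb(2)] by (rule test_functionsI)
  \<comment> \<open>The derivative of the convolution falls on the mollifier, the reflection turns
    the derivative in x into minus the derivative in y, and the identity above moves it to the weak
    gradient.\<close>
  have pd\<psi>: "pd i (\<psi> m) x = conv (hb i) (\<rho> m) x" for i m x
  proof -
    have \<rho>s: "smooth (\<rho> m)" using \<rho>t by (rule test_functions_smooth)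
    note s = smooth_reflect(1)[OF \<rho>s, of x] and s' = smooth_reflect(2)[OF \<rho>s, of x]
    have [measurable]: "(\<lambda>y. \<rho> m (x - y)) \<in> borel_measurable borel" "fb \<in> borel_measurable borel" "hb i \<in> borel_measurable borel"
       "(\<lambda>y. pd i (\<rho> m) (x - y)) \<in> borel_measurable borel"
      using s fb(1) hb(1)[of i] smooth_borel[OF smooth_reflect(1)[OF smooth_derivative[OF \<rho>s]]]
      by (auto intro: smooth_borel)
    have M: "F \<in> borel_measurable ?M" if "F \<in> borel_measurable borel" for F :: "real^'n \<Rightarrow> real"
      using that by (auto intro!: measurable_restrict_space1 measurable_completion)
    have mM: "fb \<in> borel_measurable ?M" "hb i \<in> borel_measurable ?M" "f \<in> borel_measurable ?M" "h i \<in> borel_measurable ?M"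
      "(\<lambda>y. \<rho> m (x - y)) \<in> borel_measurable ?M" "(\<lambda>y. pd i (\<rho> m) (x - y)) \<in> borel_measurable ?M"
      using fL hL by (auto intro: M)
    have "pd i (\<psi> m) x = conv fb (pd i (\<rho> m)) x"
      unfolding \<psi>_def by (rule frechet_derivative_eqI[OF conv_has_derivative[OF fbi \<rho>t]])
    also have "\<dots> = - (\<integral>y. fb y * pd i (\<lambda>y. \<rho> m (x - y)) y \<partial>lborel)"
      by (simp add: conv_def s')
    also have "(\<integral>y. fb y * pd i (\<lambda>y. \<rho> m (x - y)) y \<partial>lborel) = (\<integral>y. fb y * pd i (\<lambda>y. \<rho> m (x - y)) y \<partial>?M)"
      by (rule integral_lebesgue_on_borel(1)[symmetric, OF \<Omega>]) (use fb(2) K(2) s' in auto)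
    also have "\<dots> = (\<integral>y. f y * pd i (\<lambda>y. \<rho> m (x - y)) y \<partial>?M)"
    proof (rule integral_cong_AE)
      show "AE y in ?M. fb y * pd i (\<lambda>y. \<rho> m (x - y)) y = f y * pd i (\<lambda>y. \<rho> m (x - y)) y"
        using fb(3) by eventually_elim simp
    qed (use mM in \<open>auto simp: s' intro!: borel_measurable_times\<close>)
    also have "\<dots> = - (\<integral>y. h i y * \<rho> m (x - y) \<partial>?M)" by (rule id[OF s])
    also have "(\<integral>y. h i y * \<rho> m (x - y) \<partial>?M) = (\<integral>y. hb i y * \<rho> m (x - y) \<partial>?M)"
    proof (rule integral_cong_AE)
      show "AE y in ?M. h i y * \<rho> m (x - y) = hb i y * \<rho> m (x - y)"
        using hb(3)[of i] by eventually_elim simp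
    qed (use mM in \<open>auto intro!: borel_measurable_times\<close>)
    also have "\<dots> = (\<integral>y. hb i y * \<rho> m (x - y) \<partial>lborel)"
      by (rule integral_lebesgue_on_borel(1)[OF \<Omega>]) (use hb(2) K(2) in auto)
    finally show ?thesis by (simp add: conv_def)
  qed
  have "W12_tendsto \<Omega> \<psi> (\<lambda>m i. pd i (\<psi> m)) f h"
    unfolding W12_tendsto_def
  proof (intro conjI allI)
    show "weak_gradient \<Omega> (\<psi> m) (\<lambda>i. pd i (\<psi> m))" for m
      by (rule weak_gradient_test[OF \<Omega> \<psi>t])
    have off: "x \<notin> {x. \<exists>y\<in>K. dist x y \<le> r}" if "x \<notin> \<Omega>" for x using r(3) that by auto
    show "L2_tendsto ?M \<psi> f"
      unfolding \<psi>_def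
      by (rule L2_tendsto_lebesgue_on[OF \<Omega> conv_L2_tendsto[OF fb(1) K(1) fb(2) \<rho> R0] cz[OF off fb(2)] _ fL fb(3)])
        (use fb(2) K(2) in auto)
    show "L2_tendsto ?M (\<lambda>m. pd i (\<psi> m)) (h i)" for i
      unfolding pd\<psi>
      by (rule L2_tendsto_lebesgue_on[OF \<Omega> conv_L2_tendsto[OF hb(1) K(1) hb(2) \<rho> R0] cz[OF off hb(2)] _ hL hb(3)])
        (use hb(2) K(2) in auto)
  qed
  then have "f \<in> W12_0 \<Omega>"
    by (rule W12_0_closed[OF \<Omega>]) (rule test_function_W12_0[OF \<Omega> \<psi>t])
  then show "(\<lambda>x. v x * \<eta> x) \<in> W12_0 \<Omega>" by (simp add: f_def[abs_def])
  show "weak_gradient \<Omega> (\<lambda>x. v x * \<eta> x) (\<lambda>i x. g i x * \<eta> x + v x * pd i \<eta> x)"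
    using wg by (simp add: f_def[abs_def] h_def[abs_def])
qed

section \<open>Truncation\<close>

lemma L2_tendsto_const: "f \<in> L2 M \<Longrightarrow> L2_tendsto M (\<lambda>m. f) f"
  by (simp add: L2_tendsto_def nrm_def)

lemma L2_lipschitz_compose:
  assumes "f \<in> L2 M" "h \<in> borel_measurable borel" "\<And>s t. \<bar>h s - h t\<bar> \<le> B * \<bar>s - t\<bar>" "h 0 = (0::real)"
  shows "(\<lambda>x. h (f x)) \<in> L2 M"
proof (rule L2_bound[OF assms(1)])
  show "AE x in M. \<bar>h (f x)\<bar> \<le> B * \<bar>f x\<bar>" using assms(3)[of _ 0] assms(4) by simp
  show "(\<lambda>x. h (f x)) \<in> borel_measurable M"
    using measurable_compose[OF L2D(1)[OF assms(1)] assms(2)] .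
qed

lemma lipschitz_continuous:
  fixes h :: "real \<Rightarrow> real"
  assumes "\<And>s t. \<bar>h s - h t\<bar> \<le> B * \<bar>s - t\<bar>"
  shows "continuous_on UNIV h"
proof -
  have "(max B 0)-lipschitz_on UNIV h"
  proof (rule lipschitz_onI)
    show "dist (h s) (h t) \<le> max B 0 * dist s t" for s t
      using assms[of s t] mult_right_mono[of B "max B 0" "\<bar>s - t\<bar>"] by (simp add: dist_real_def)
  qed simp
  then show ?thesis by (rule lipschitz_on_continuous_on)
qed

text \<open>On the support of a test function, \<open>u\<close> agrees with the product of \<open>u\<close> and a cutoff function,
  which is a limit of test functions.\<close>

lemma weak_gradient_compose:
  fixes \<Omega> :: "(real^'n::finite) set"
  assumes \<Omega>: "open \<Omega>" and g: "weak_gradient \<Omega> u g"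
    and h: "\<And>t. (h has_real_derivative h' t) (at t)" "\<And>t. \<bar>h' t\<bar> \<le> B" "h 0 = 0"
    and h': "\<And>s t. \<bar>h' s - h' t\<bar> \<le> B' * \<bar>s - t\<bar>" "h' 0 = 0"
  shows "weak_gradient \<Omega> (\<lambda>x. h (u x)) (\<lambda>i x. h' (u x) * g i x)"
proof -
  let ?M = "lebesgue_on \<Omega>"
  note v = weak_gradientD[OF g]
  note hl = bounded_derivative_lipschitz[OF h(1,2)]
  have hm: "h \<in> borel_measurable borel" "h' \<in> borel_measurable borel" and h'c: "continuous_on UNIV h'"
    using lipschitz_continuous[OF hl] lipschitz_continuous[OF h'(1)] by (auto intro: borel_measurable_continuous_onI)
  note huL = L2_lipschitz_compose[OF v(1) hm(1) hl h(3)]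
  have h'm: "(\<lambda>x. h' (u x)) \<in> borel_measurable ?M"
    using measurable_compose[OF L2D(1)[OF v(1)] hm(2)] .
  have gL: "(\<lambda>x. h' (u x) * g i x) \<in> L2 ?M" for i
    using L2_mult_bounded[OF v(2) h'm h(2)] .
  show ?thesis
    unfolding weak_gradient_def
  proof (intro conjI allI huL gL has_weak_partialI \<Omega>)
    fix i \<psi> assume \<psi>: "\<psi> \<in> test_functions \<Omega>"
    note T = test_function_L2[OF \<Omega> \<psi>] test_function_L2[OF \<Omega> test_function_derivative[OF \<psi>, of "axis i 1"]]
    obtain K where K: "compact K" "K \<subseteq> \<Omega>" "\<And>x. x \<notin> K \<Longrightarrow> \<psi> x = 0"
      using test_functionsE[OF \<psi>] by metis
    have pz: "pd i \<psi> x = 0" if "x \<notin> K" for x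
      using frechet_derivative_zero_outside[OF K(1,3) that] .
    obtain \<eta> where \<eta>: "\<eta> \<in> test_functions \<Omega>" "\<And>x. x \<in> K \<Longrightarrow> \<eta> x = 1"
        "\<And>x v. x \<in> K \<Longrightarrow> frechet_derivative \<eta> (at x) v = 0"
      using cutoff_exists[OF \<Omega> K(1,2)] by metis
    define w where "w x = u x * \<eta> x" for x
    define G where "G i x = g i x * \<eta> x + u x * pd i \<eta> x" for i x
    have w: "w \<in> W12_0 \<Omega>" "weak_gradient \<Omega> w G"
      using W12_mult_test[OF \<Omega> g \<eta>(1)] by (simp_all add: w_def[abs_def] G_def[abs_def])
    obtain \<phi> where \<phi>: "\<And>m. \<phi> m \<in> test_functions \<Omega>" "W12_tendsto \<Omega> \<phi> (\<lambda>m i. pd i (\<phi> m)) w G"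
      using W12_0_approx[OF \<Omega> w] by metis
    have \<phi>w: "L2_tendsto ?M \<phi> w" "L2_tendsto ?M (\<lambda>m. pd i (\<phi> m)) (G i)"
      using \<phi>(2) by (auto simp: W12_tendsto_def)
    have wL: "w \<in> L2 ?M" using w(2) by (rule weak_gradientD)
    \<comment> \<open>Only the first derivative of h is controlled, so h composed with a test
      function is known to be C^1 and no more; classical integration by parts still covers
      it.\<close>
    have id: "(\<integral>x. h (\<phi> m x) * pd i \<psi> x \<partial>?M) = - (\<integral>x. h' (\<phi> m x) * pd i (\<phi> m) x * \<psi> x \<partial>?M)" for m
    proof -
      have c: "C_k 1 (\<phi> m)" using \<phi>(1) by (intro smooth_C_k test_functions_smooth)
      have "(\<integral>x. h (\<phi> m x) * pd i \<psi> x \<partial>?M) = - (\<integral>x. pd i (\<lambda>x. h (\<phi> m x)) x * \<psi> x \<partial>?M)"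
        using C_1_compose(1)[OF h(1) h'c c] by (rule integration_by_parts[OF \<Omega> _ \<psi>])
      then show ?thesis by (simp add: C_1_compose(2)[OF h(1) h'c c])
    qed
    have "L2_tendsto ?M (\<lambda>m x. h (\<phi> m x)) (\<lambda>x. h (w x))"
      using \<phi>w(1) hm(1) hl L2_lipschitz_compose[OF wL hm(1) hl h(3)] by (rule L2_tendsto_lipschitz)
    from L2_tendsto_integral[OF this T(2)]
    have 1: "(\<lambda>m. \<integral>x. h (\<phi> m x) * pd i \<psi> x \<partial>?M) \<longlonglongrightarrow> (\<integral>x. h (w x) * pd i \<psi> x \<partial>?M)" .
    have "L2_tendsto ?M (\<lambda>m x. h' (\<phi> m x)) (\<lambda>x. h' (w x))"
      using \<phi>w(1) hm(2) h'(1) L2_lipschitz_compose[OF wL hm(2) h'(1,2)] by (rule L2_tendsto_lipschitz)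
    from L2_tendsto_mult_bounded[OF this \<phi>w(2) h(2) h(2)]
    have "L2_tendsto ?M (\<lambda>m x. h' (\<phi> m x) * pd i (\<phi> m) x) (\<lambda>x. h' (w x) * G i x)" .
    from tendsto_minus[OF L2_tendsto_integral[OF this T(1)]]
    have 2: "(\<lambda>m. \<integral>x. h (\<phi> m x) * pd i \<psi> x \<partial>?M) \<longlonglongrightarrow> - (\<integral>x. h' (w x) * G i x * \<psi> x \<partial>?M)"
      by (simp add: id)
    have 3: "h (w x) * pd i \<psi> x = h (u x) * pd i \<psi> x" for x
      using \<eta> pz by (cases "x \<in> K") (auto simp: w_def)
    have 4: "h' (w x) * G i x * \<psi> x = h' (u x) * g i x * \<psi> x" for x
      using \<eta> K(3) by (cases "x \<in> K") (auto simp: w_def G_def)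
    show "(\<integral>x. h (u x) * pd i \<psi> x \<partial>?M) = - (\<integral>x. h' (u x) * g i x * \<psi> x \<partial>?M)"
      using LIMSEQ_unique[OF 1 2] by (simp only: 3 4)
  qed
qed

lemma finite_measure_lebesgue_on:
  fixes \<Omega> :: "'a::euclidean_space set"
  assumes "open \<Omega>" "bounded \<Omega>"
  shows "finite_measure (lebesgue_on \<Omega>)"
proof
  have "emeasure (lebesgue_on \<Omega>) \<Omega> = emeasure lborel \<Omega>"
    using assms(1) by (subst emeasure_restrict_space) (auto simp: borel_open)
  then show "emeasure (lebesgue_on \<Omega>) (space (lebesgue_on \<Omega>)) \<noteq> \<infinity>"
    using emeasure_bounded_finite[OF assms(2)] by (simp add: space_restrict_space less_top[symmetric])
qed

lemma (in finite_measure) L2_bounded: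
  assumes "f \<in> borel_measurable M" "\<And>x. \<bar>f x\<bar> \<le> B"
  shows "f \<in> L2 M"
proof -
  have "(f x)\<^sup>2 \<le> B\<^sup>2" for x using power_mono[OF assms(2)[of x], of 2] by simp
  then have "integrable M (\<lambda>x. (f x)\<^sup>2)"
    using assms(1) by (intro integrable_const_bound[of _ "B\<^sup>2"]) auto
  then show ?thesis using assms(1) by (simp add: L2_def)
qed

text \<open>Here \<open>h (u x) = h (u x) * ramp d (w x)\<close> with \<open>w = (\<bar>u\<bar> - s)\<^sub>+\<close> and \<open>d = k - s\<close>, and \<open>w\<close> is approximated by
  test functions.\<close>

lemma truncation_W12_0:
  fixes \<Omega> :: "(real^'n::finite) set"
  assumes \<Omega>: "open \<Omega>" "bounded \<Omega>" and g: "weak_gradient \<Omega> u g"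
    and w: "(\<lambda>x. max (\<bar>u x\<bar> - s) 0) \<in> W12_0 \<Omega>" and "s < k"
    and h: "\<And>t. (h has_real_derivative h' t) (at t)" "\<And>t. \<bar>h' t\<bar> \<le> B" "\<And>t. \<bar>h t\<bar> \<le> C"
    and h': "\<And>s t. \<bar>h' s - h' t\<bar> \<le> B' * \<bar>s - t\<bar>"
    and z: "\<And>t. \<bar>t\<bar> \<le> k \<Longrightarrow> h t = 0" "\<And>t. \<bar>t\<bar> \<le> k \<Longrightarrow> h' t = 0" and "0 \<le> k"
  shows "(\<lambda>x. h (u x)) \<in> W12_0 \<Omega>" "weak_gradient \<Omega> (\<lambda>x. h (u x)) (\<lambda>i x. h' (u x) * g i x)"
proof -
  let ?M = "lebesgue_on \<Omega>"
  interpret finite_measure ?M using \<Omega> by (rule finite_measure_lebesgue_on)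
  define d where "d = k - s"
  have d: "d > 0" using \<open>s < k\<close> by (simp add: d_def)
  define w where "w x = max (\<bar>u x\<bar> - s) 0" for x
  have w0: "w \<in> W12_0 \<Omega>" using w by (simp add: w_def[abs_def])
  have h0: "h 0 = 0" "h' 0 = 0" using z \<open>0 \<le> k\<close> by auto
  show wg: "weak_gradient \<Omega> (\<lambda>x. h (u x)) (\<lambda>i x. h' (u x) * g i x)"
    by (rule weak_gradient_compose[OF \<Omega>(1) g h(1,2) h0(1) h' h0(2)])
  note hu = weak_gradientD[OF wg]
  have "w \<in> W12 \<Omega>" using w0 by (simp add: W12_0_def)
  then obtain gw where gw: "weak_gradient \<Omega> w gw" using W12_weak_gradient[OF \<Omega>(1)] by blast
  note wL = weak_gradientD(1)[OF gw]
  obtain \<psi> where \<psi>: "\<And>m. \<psi> m \<in> test_functions \<Omega>" "W12_tendsto \<Omega> \<psi> (\<lambda>m i. pd i (\<psi> m)) w gw"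
    using W12_0_approx[OF \<Omega>(1) w0 gw] by metis
  have \<psi>w: "L2_tendsto ?M \<psi> w" "L2_tendsto ?M (\<lambda>m. pd i (\<psi> m)) (gw i)" for i
    using \<psi>(2) by (auto simp: W12_tendsto_def)
  obtain B1 where B1: "\<And>t. \<bar>ramp d t\<bar> \<le> B1" using ramp_bounded by blast
  obtain B2 where B2: "\<And>t. \<bar>ramp' d t\<bar> \<le> B2" using ramp'_bounded by blast
  obtain B3 where B3: "\<And>s t. \<bar>ramp' d s - ramp' d t\<bar> \<le> B3 * \<bar>s - t\<bar>" using ramp'_lipschitz by blast
  note cl = bounded_derivative_lipschitz[OF ramp_has_derivative B2]
  have cm: "ramp d \<in> borel_measurable borel" "ramp' d \<in> borel_measurable borel"
    using lipschitz_continuous[OF cl] lipschitz_continuous[OF B3] by (auto intro: borel_measurable_continuous_onI)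
  define c where "c m x = ramp d (\<psi> m x)" for m x
  have ct: "c m \<in> test_functions \<Omega>" "pd i (c m) x = ramp' d (\<psi> m x) * pd i (\<psi> m) x" for m i x
    using test_function_ramp[OF \<psi>(1) d] by (simp_all add: c_def[abs_def])
  have c1: "L2_tendsto ?M c (\<lambda>x. ramp d (w x))"
    unfolding c_def
    using \<psi>w(1) cm(1) cl L2_lipschitz_compose[OF wL cm(1) cl ramp_0[OF d]] by (rule L2_tendsto_lipschitz)
  \<comment> \<open>\<open>ramp' d\<close> does not vanish at 0, so square integrability of the
    composition comes from its boundedness and the finite measure of \<Omega>.\<close>
  have c2: "L2_tendsto ?M (\<lambda>m x. ramp' d (\<psi> m x)) (\<lambda>x. ramp' d (w x))"
    using \<psi>w(1) cm(2) B3
  proof (rule L2_tendsto_lipschitz)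
    show "(\<lambda>x. ramp' d (w x)) \<in> L2 ?M"
      using measurable_compose[OF L2D(1)[OF wL] cm(2)] B2 by (rule L2_bounded)
  qed
  \<comment> \<open>On |u| > k one has w > k - s = d, where the ramp is constant. Since h vanishes
    on the remaining set, the term with the gradient of w disappears in the limit.\<close>
  have cw: "ramp d (w x) = 1" "ramp' d (w x) = 0" if "\<not> \<bar>u x\<bar> \<le> k" for x
    using that by (auto simp: w_def d_def intro!: ramp_eq)
  have e1: "ramp d (w x) * h (u x) = h (u x)" "ramp d (w x) * (h' (u x) * g i x) = h' (u x) * g i x"
    "h (u x) * ramp' d (w x) = 0" for x i
    using cw[of x] z[of "u x"] by (cases "\<bar>u x\<bar> \<le> k"; simp)+
  \<comment> \<open>Each approximant is a Sobolev function times a test function and so lies in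
    \<open>W12_0\<close> whatever the boundary values of u; what remains is the convergence and
    closedness.\<close>
  have V: "(\<lambda>x. h (u x) * c m x) \<in> W12_0 \<Omega>"
    "weak_gradient \<Omega> (\<lambda>x. h (u x) * c m x) (\<lambda>i x. (h' (u x) * g i x) * c m x + h (u x) * pd i (c m) x)" for m
    using W12_mult_test[OF \<Omega>(1) wg ct(1)] by auto
  have "W12_tendsto \<Omega> (\<lambda>m x. h (u x) * c m x)
      (\<lambda>m i x. (h' (u x) * g i x) * c m x + h (u x) * pd i (c m) x)
      (\<lambda>x. h (u x)) (\<lambda>i x. h' (u x) * g i x)"
    unfolding W12_tendsto_def
  proof (intro conjI allI V(2))
    have cB: "\<bar>c m x\<bar> \<le> B1" for m x using B1 by (simp add: c_def)
    have "L2_tendsto ?M (\<lambda>m x. c m x * h (u x)) (\<lambda>x. ramp d (w x) * h (u x))"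
      by (rule L2_tendsto_mult_bounded[OF c1 L2_tendsto_const[OF hu(1)] cB B1])
    then show "L2_tendsto ?M (\<lambda>m x. h (u x) * c m x) (\<lambda>x. h (u x))"
      unfolding e1 by (simp add: mult.commute)
    fix i
    have 1: "L2_tendsto ?M (\<lambda>m x. c m x * (h' (u x) * g i x)) (\<lambda>x. ramp d (w x) * (h' (u x) * g i x))"
      by (rule L2_tendsto_mult_bounded[OF c1 L2_tendsto_const[OF hu(2)] cB B1])
    have C0: "0 \<le> C" using h(3)[of 0] by linarith
    have bd: "\<bar>h (u x) * ramp' d t\<bar> \<le> C * B2" for x t
      unfolding abs_mult by (intro mult_mono h(3) B2 C0) auto
    have "L2_tendsto ?M (\<lambda>m x. h (u x) * ramp' d (\<psi> m x)) (\<lambda>x. h (u x) * ramp' d (w x))"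
      by (rule L2_tendsto_mult_bounded[OF L2_tendsto_const[OF hu(1)] c2 h(3) h(3)])
    from L2_tendsto_mult_bounded[OF this \<psi>w(2)[of i] bd bd]
    have 2: "L2_tendsto ?M (\<lambda>m x. h (u x) * ramp' d (\<psi> m x) * pd i (\<psi> m) x) (\<lambda>x. h (u x) * ramp' d (w x) * gw i x)" .
    show "L2_tendsto ?M (\<lambda>m x. (h' (u x) * g i x) * c m x + h (u x) * pd i (c m) x) (\<lambda>x. h' (u x) * g i x)"
      using L2_tendsto_add[OF 1 2] unfolding e1 ct(2) by (simp add: mult_ac)
  qed
  then show "(\<lambda>x. h (u x)) \<in> W12_0 \<Omega>"
    by (rule W12_0_closed[OF \<Omega>(1)]) (rule V(1))
qed

section \<open>The Loomis--Whitney and Sobolev inequalities\<close>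

lemma powr_inverse_power: "(x::real) > 0 \<Longrightarrow> m > 0 \<Longrightarrow> (x powr (1 / real m)) ^ m = x"
  by (simp add: powr_powr flip: powr_realpow)

text \<open>The inequality of arithmetic and geometric means for the quotients g j / b j. The right
  side is linear in g, so it can be integrated; the positive weights b are free until then.\<close>

lemma ennreal_power_le_geometric:
  fixes g :: "'i \<Rightarrow> ennreal" and h :: ennreal and b :: "'i \<Rightarrow> real" and a :: real
  assumes J: "finite J" "J \<noteq> {}" and b: "\<And>j. j \<in> J \<Longrightarrow> b j > 0" and a: "a > 0"
    and h: "h ^ card J \<le> ennreal a * (\<Prod>j\<in>J. g j)"
  shows "h \<le> ennreal ((a * (\<Prod>j\<in>J. b j)) powr (1 / card J)) * (\<Sum>j\<in>J. ennreal (1 / (card J * b j)) * g j)"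
proof -
  let ?m = "card J"
  have m: "?m > 0" using J by (simp add: card_gt_0_iff)
  define \<kappa> where "\<kappa> = (a * (\<Prod>j\<in>J. b j)) powr (1 / ?m)"
  have P: "(\<Prod>j\<in>J. b j) > 0" using b by (intro prod_pos) auto
  have \<kappa>: "\<kappa> > 0" "\<kappa> ^ ?m = a * (\<Prod>j\<in>J. b j)"
    using a P m unfolding \<kappa>_def by (auto intro!: powr_inverse_power)
  show ?thesis
  proof (cases "\<exists>j\<in>J. g j = \<infinity>")
    case True
    then obtain j where j: "j \<in> J" "g j = \<infinity>" by auto
    have "ennreal (1 / (?m * b j)) * g j = \<infinity>"
      using j b[OF j(1)] m by (simp add: ennreal_mult_top)
    then have "(\<Sum>j\<in>J. ennreal (1 / (?m * b j)) * g j) = \<infinity>"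
      using J j(1) by (auto simp: ennreal_sum_eq_top)
    then show ?thesis using \<kappa>(1) by (simp add: ennreal_mult_top flip: \<kappa>_def)
  next
    case False
    define r where "r j = enn2real (g j)" for j
    have r: "g j = ennreal (r j)" "r j \<ge> 0" if "j \<in> J" for j
      using False that by (auto simp: r_def less_top)
    have pr: "(\<Prod>j\<in>J. g j) = ennreal (\<Prod>j\<in>J. r j)"
      using r by (subst prod_ennreal[symmetric]) auto
    have hm: "h ^ ?m \<le> ennreal (a * (\<Prod>j\<in>J. r j))"
      using h[unfolded pr] a r by (simp add: prod_nonneg flip: ennreal_mult)
    then have "h \<noteq> \<infinity>" using m by (auto simp: top_power_ennreal top_unique)
    then obtain t where t: "h = ennreal t" "t \<ge> 0" by (cases h) auto
    have tm: "t ^ ?m \<le> a * (\<Prod>j\<in>J. r j)"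
      using hm t a r by (simp add: ennreal_power prod_nonneg)
    define s where "s = (\<Sum>j\<in>J. r j / b j / ?m)"
    have s0: "s \<ge> 0" unfolding s_def using r b by (intro sum_nonneg) (auto simp: less_imp_le)
    have q: "r j / b j \<ge> 0" if "j \<in> J" for j using r b that by (simp add: less_imp_le)
    have "(\<Prod>j\<in>J. r j / b j) powr (1 / ?m) \<le> s"
      unfolding s_def using arith_geom_mean[OF J q] by simp
    then have "((\<Prod>j\<in>J. r j / b j) powr (1 / ?m)) ^ ?m \<le> s ^ ?m"
      by (intro power_mono) auto
    moreover have "((\<Prod>j\<in>J. r j / b j) powr (1 / ?m)) ^ ?m = (\<Prod>j\<in>J. r j / b j)"
    proof (cases "(\<Prod>j\<in>J. r j / b j) = 0")
      case False
      then have "(\<Prod>j\<in>J. r j / b j) > 0" using prod_nonneg[of J "\<lambda>j. r j / b j"] q by force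
      then show ?thesis using m by (rule powr_inverse_power)
    qed (use m in simp)
    ultimately have "(\<Prod>j\<in>J. r j / b j) \<le> s ^ ?m" by simp
    then have "a * (\<Prod>j\<in>J. b j) * (\<Prod>j\<in>J. r j / b j) \<le> a * (\<Prod>j\<in>J. b j) * s ^ ?m"
      using a P by (intro mult_left_mono) auto
    moreover have "(\<Prod>j\<in>J. b j) * (\<Prod>j\<in>J. r j / b j) = (\<Prod>j\<in>J. r j)"
    proof (subst prod.distrib[symmetric], rule prod.cong[OF refl])
      show "b j * (r j / b j) = r j" if "j \<in> J" for j using b[OF that] by simp
    qed
    ultimately have "t ^ ?m \<le> (\<kappa> * s) ^ ?m"
      using tm \<kappa>(2) by (simp add: power_mult_distrib mult.assoc)
    then have "t \<le> \<kappa> * s" using t(2) \<kappa>(1) s0 m by (simp add: power_mono_iff)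
    moreover have "(\<Sum>j\<in>J. ennreal (1 / (?m * b j)) * g j) = ennreal s"
    proof -
      have "(\<Sum>j\<in>J. ennreal (1 / (?m * b j)) * g j) = (\<Sum>j\<in>J. ennreal (r j / b j / ?m))"
        using r b by (intro sum.cong refl) (auto simp: mult.commute simp flip: ennreal_mult')
      also have "\<dots> = ennreal s"
        unfolding s_def using q by (intro sum_ennreal divide_nonneg_nonneg[of "_ / _"]) auto
      finally show ?thesis .
    qed
    ultimately show ?thesis
      using t \<kappa>(1) s0 by (simp add: ennreal_leI flip: \<kappa>_def ennreal_mult)
  qed
qed

text \<open>Hoelder's inequality for \<open>card J\<close> factors with equal exponents, raised to
  the power \<open>card J\<close>. In the linearised bound the weights are the integrals of the g j,
  so that each summand integrates to 1 / \<open>card J\<close>.\<close>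

lemma nn_integral_geometric_mean:
  fixes g :: "'i \<Rightarrow> 'a \<Rightarrow> ennreal"
  assumes J: "finite J" "J \<noteq> {}" and [measurable]: "\<And>j. j \<in> J \<Longrightarrow> g j \<in> borel_measurable M"
    and [measurable]: "h \<in> borel_measurable M"
    and h: "\<And>x. x \<in> space M \<Longrightarrow> h x ^ card J \<le> A * (\<Prod>j\<in>J. g j x)"
  shows "(\<integral>\<^sup>+x. h x \<partial>M) ^ card J \<le> A * (\<Prod>j\<in>J. \<integral>\<^sup>+x. g j x \<partial>M)"
proof -
  let ?m = "card J"
  have m: "?m > 0" using J by (simp add: card_gt_0_iff)
  have zero: "(\<integral>\<^sup>+x. h x \<partial>M) ^ ?m = 0" if "AE x in M. A * (\<Prod>j\<in>J. g j x) = 0"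
  proof -
    have "AE x in M. h x = 0"
      using that AE_space
    proof eventually_elim
      case (elim x)
      then have "h x ^ ?m \<le> 0" using h[of x] by metis
      then show ?case by (simp add: power_eq_0_iff)
    qed
    then have "(\<integral>\<^sup>+x. h x \<partial>M) = 0" by (subst nn_integral_0_iff_AE) auto
    then show ?thesis using m by simp
  qed
  \<comment> \<open>The weights require A and all integrals to lie strictly between 0 and infinity.
    If A or one of the integrals is 0, then h vanishes almost everywhere; if the right side is
    infinite, nothing is left to show.\<close>
  consider "A = 0" | j where "j \<in> J" "(\<integral>\<^sup>+x. g j x \<partial>M) = 0"
    | "A * (\<Prod>j\<in>J. \<integral>\<^sup>+x. g j x \<partial>M) = \<infinity>"
    | "A \<noteq> 0" "A \<noteq> \<infinity>" "\<And>j. j \<in> J \<Longrightarrow> (\<integral>\<^sup>+x. g j x \<partial>M) \<noteq> 0" "\<And>j. j \<in> J \<Longrightarrow> (\<integral>\<^sup>+x. g j x \<partial>M) \<noteq> \<infinity>"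
    using J(1) by (auto simp: ennreal_mult_eq_top_iff ennreal_prod_eq_top)
  then show ?thesis
  proof cases
    case 1
    then have "AE x in M. A * (\<Prod>j\<in>J. g j x) = 0" by simp
    from zero[OF this] show ?thesis by (simp only: zero_le)
  next
    case 2
    then have "AE x in M. g j x = 0" by (subst (asm) nn_integral_0_iff_AE) auto
    then have "AE x in M. A * (\<Prod>j\<in>J. g j x) = 0"
      by eventually_elim (use J 2 in auto)
    from zero[OF this] show ?thesis by (simp only: zero_le)
  next
    case 3
    then show ?thesis by simp
  next
    case 4
    define a where "a = enn2real A"
    define b where "b j = enn2real (\<integral>\<^sup>+x. g j x \<partial>M)" for j
    have a: "A = ennreal a" "a > 0" using 4(1,2) by (auto simp: a_def less_top enn2real_positive_iff zero_less_iff_neq_zero)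
    have b: "(\<integral>\<^sup>+x. g j x \<partial>M) = ennreal (b j)" "b j > 0" if "j \<in> J" for j
      using 4(3,4)[OF that] by (auto simp: b_def less_top enn2real_positive_iff zero_less_iff_neq_zero)
    define \<kappa> where "\<kappa> = (a * (\<Prod>j\<in>J. b j)) powr (1 / ?m)"
    have P: "(\<Prod>j\<in>J. b j) > 0" using b by (intro prod_pos) auto
    have \<kappa>: "\<kappa> > 0" "\<kappa> ^ ?m = a * (\<Prod>j\<in>J. b j)"
      using a P m unfolding \<kappa>_def by (auto intro!: powr_inverse_power)
    have "(\<integral>\<^sup>+x. h x \<partial>M) \<le> (\<integral>\<^sup>+x. ennreal \<kappa> * (\<Sum>j\<in>J. ennreal (1 / (?m * b j)) * g j x) \<partial>M)"
    proof (rule nn_integral_mono)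
      fix x assume "x \<in> space M"
      then show "h x \<le> ennreal \<kappa> * (\<Sum>j\<in>J. ennreal (1 / (?m * b j)) * g j x)"
        unfolding \<kappa>_def using h a(1) by (intro ennreal_power_le_geometric[OF J b(2) a(2)]) auto
    qed
    also have "\<dots> = ennreal \<kappa> * (\<Sum>j\<in>J. ennreal (1 / (?m * b j)) * (\<integral>\<^sup>+x. g j x \<partial>M))"
      by (simp add: nn_integral_cmult nn_integral_sum)
    also have "(\<Sum>j\<in>J. ennreal (1 / (?m * b j)) * (\<integral>\<^sup>+x. g j x \<partial>M)) = (\<Sum>j\<in>J. ennreal (1 / ?m))"
    proof (rule sum.cong[OF refl])
      fix j assume j: "j \<in> J"
      have "ennreal (1 / (?m * b j)) * ennreal (b j) = ennreal (1 / (?m * b j) * b j)"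
        by (rule ennreal_mult[symmetric]) (use b[OF j] in \<open>auto simp: less_imp_le\<close>)
      then show "ennreal (1 / (?m * b j)) * (\<integral>\<^sup>+x. g j x \<partial>M) = ennreal (1 / ?m)"
        using b[OF j] by simp
    qed
    also have "\<dots> = 1" using m by (simp add: ennreal_of_nat_eq_real_of_nat flip: ennreal_mult)
    finally have "(\<integral>\<^sup>+x. h x \<partial>M) ^ ?m \<le> ennreal \<kappa> ^ ?m" by (intro power_mono) auto
    also have "\<dots> = A * (\<Prod>j\<in>J. \<integral>\<^sup>+x. g j x \<partial>M)"
    proof -
      have "(\<Prod>j\<in>J. \<integral>\<^sup>+x. g j x \<partial>M) = (\<Prod>j\<in>J. ennreal (b j))" using b by (intro prod.cong) auto
      also have "\<dots> = ennreal (\<Prod>j\<in>J. b j)" using b by (intro prod_ennreal) (auto simp: less_imp_le)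
      finally show ?thesis using \<kappa> a P by (simp add: ennreal_power flip: ennreal_mult)
    qed
    finally show ?thesis .
  qed
qed

text \<open>Each hypothesis on \<open>g i\<close> says that the integral of \<open>g i\<close> over lines parallel to the \<open>i\<close>-th axis
  dominates the indicator of the corresponding projection of \<open>E\<close>.\<close>

lemma Loomis_Whitney_PiM:
  fixes g :: "'i \<Rightarrow> ('i \<Rightarrow> real) \<Rightarrow> ennreal"
  assumes I: "finite I" "I \<noteq> {}"
    and E: "E \<in> sets (Pi\<^sub>M I (\<lambda>_. lborel))" "E \<noteq> {}"
    and g: "\<And>i. i \<in> I \<Longrightarrow> g i \<in> borel_measurable (Pi\<^sub>M I (\<lambda>_. lborel))"
    and line: "\<And>i x. i \<in> I \<Longrightarrow> x \<in> E \<Longrightarrow> 1 \<le> (\<integral>\<^sup>+t. g i (x(i := t)) \<partial>lborel)"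
  shows "emeasure (Pi\<^sub>M I (\<lambda>_. lborel)) E ^ (card I - 1) \<le> (\<Prod>i\<in>I. \<integral>\<^sup>+x. g i x \<partial>Pi\<^sub>M I (\<lambda>_. lborel))"
  using I E g line
proof (induction I arbitrary: E g rule: finite_ne_induct)
  case (singleton i)
  interpret product_sigma_finite "\<lambda>_::'i. lborel :: real measure" ..
  \<comment> \<open>With a single coordinate the exponent is 0 and the left side is 1, so a point of
    E is needed to bound the integral from below.\<close>
  obtain x where x: "x \<in> E" using singleton by auto
  then have xs: "x \<in> space (Pi\<^sub>M {i} (\<lambda>_. lborel :: real measure))"
    using sets.sets_into_space[OF singleton(1)] by auto
  have "x(i := t) = (\<lambda>k. undefined)(i := t)" for t
    using xs by (auto simp: space_PiM PiE_def extensional_def fun_eq_iff)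
  then have "1 \<le> (\<integral>\<^sup>+t. g i ((\<lambda>k. undefined)(i := t)) \<partial>lborel)"
    using singleton(4)[OF _ x, of i] by (simp only: singleton_iff simp_thms)
  also have "\<dots> = (\<integral>\<^sup>+x. g i x \<partial>Pi\<^sub>M {i} (\<lambda>_. lborel))"
    using product_nn_integral_insert[of "{}" i "g i"] singleton(3)[of i] by (simp add: nn_integral_empty)
  finally show ?case by simp
next
  case (insert j I)
  interpret product_sigma_finite "\<lambda>_::'i. lborel :: real measure" ..
  let ?P = "Pi\<^sub>M I (\<lambda>_. lborel :: real measure)" and ?Q = "Pi\<^sub>M (insert j I) (\<lambda>_. lborel :: real measure)"
  note fin = \<open>finite I\<close> and ne = \<open>I \<noteq> {}\<close> and j = \<open>j \<notin> I\<close>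
  note [measurable] = insert.prems(1)
  have gm [measurable]: "g i \<in> borel_measurable ?Q" if "i \<in> insert j I" for i using insert.prems(3) that by auto
  have upd: "(\<lambda>x. x(j := t)) \<in> measurable ?P ?Q" for t
    by (rule measurable_fun_upd[where J=I]) auto
  define Et where "Et t = {x \<in> space ?P. x(j := t) \<in> E}" for t
  define G where "G i t = (\<integral>\<^sup>+x. g i (x(j := t)) \<partial>?P)" for i t
  have Et: "Et t \<in> sets ?P" for t
  proof -
    have "Et t = (\<lambda>x. x(j := t)) -` E \<inter> space ?P" by (auto simp: Et_def)
    then show ?thesis using measurable_sets[OF upd insert.prems(1)] by simp
  qed
  have EI: "emeasure ?Q E = (\<integral>\<^sup>+t. emeasure ?P (Et t) \<partial>lborel)"
  proof -
    have "emeasure ?Q E = (\<integral>\<^sup>+x. indicator E x \<partial>?Q)" by simp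
    also have "\<dots> = (\<integral>\<^sup>+t. (\<integral>\<^sup>+x. indicator E (x(j := t)) \<partial>?P) \<partial>lborel)"
      by (rule product_nn_integral_insert_rev[OF fin j]) measurable
    also have "\<dots> = (\<integral>\<^sup>+t. (\<integral>\<^sup>+x. indicator (Et t) x \<partial>?P) \<partial>lborel)"
      by (intro nn_integral_cong) (auto simp: Et_def indicator_def)
    finally show ?thesis using Et by simp
  qed
  have Gm: "G i \<in> borel_measurable lborel" if "i \<in> I" for i
  proof -
    have "(\<lambda>(t, x). g i (x(j := t))) \<in> borel_measurable (lborel \<Otimes>\<^sub>M ?P)"
      using measurable_compose[OF measurable_compose[OF measurable_pair_swap' measurable_add_dim] gm[of i]] that
      by (simp add: split_beta')
    then show ?thesis
      unfolding G_def[abs_def] by (rule sigma_finite_measure.borel_measurable_nn_integral[rotated])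
        (rule sigma_finite[OF fin])
  qed
  have Em: "(\<lambda>t. emeasure ?P (Et t)) \<in> borel_measurable lborel"
  proof -
    have "(\<lambda>(t, x). indicator E (x(j := t)) :: ennreal) \<in> borel_measurable (lborel \<Otimes>\<^sub>M ?P)"
      using measurable_compose[OF measurable_compose[OF measurable_pair_swap' measurable_add_dim] borel_measurable_indicator[OF insert.prems(1)]]
      by (simp add: split_beta')
    then have "(\<lambda>t. \<integral>\<^sup>+x. indicator E (x(j := t)) \<partial>?P) \<in> borel_measurable lborel"
      by (rule sigma_finite_measure.borel_measurable_nn_integral[rotated])
        (rule sigma_finite[OF fin])
    also have "(\<lambda>t. \<integral>\<^sup>+x. indicator E (x(j := t)) \<partial>?P) = (\<lambda>t. \<integral>\<^sup>+x. indicator (Et t) x \<partial>?P)"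
      by (intro ext nn_integral_cong) (auto simp: Et_def indicator_def)
    finally show ?thesis using Et by simp
  qed
  let ?A = "\<integral>\<^sup>+x. g j x \<partial>?Q"
  \<comment> \<open>One factor of the power is bounded by the projection along the new coordinate j,
    whose size does not depend on t; the other factors come from the induction hypothesis for the
    slice.\<close>
  have slice: "emeasure ?P (Et t) ^ card I \<le> ?A * (\<Prod>i\<in>I. G i t)" for t
  proof (cases "Et t = {}")
    case True
    have "card I > 0" using fin ne by (simp add: card_gt_0_iff)
    then have "emeasure ?P (Et t) ^ card I = 0" using True by simp
    then show ?thesis by (simp only: zero_le)
  next
    case False
    have 1: "emeasure ?P (Et t) ^ (card I - 1) \<le> (\<Prod>i\<in>I. G i t)"
      unfolding G_def
    proof (rule insert.IH[OF Et False])
      show "(\<lambda>x. g i (x(j := t))) \<in> borel_measurable ?P" if "i \<in> I" for i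
        using measurable_compose[OF upd gm[of i]] that by simp
      show "1 \<le> (\<integral>\<^sup>+s. g i (x(i := s, j := t)) \<partial>lborel)" if "i \<in> I" "x \<in> Et t" for i x
      proof -
        have "i \<noteq> j" using that j by auto
        then have eq: "x(i := s, j := t) = (x(j := t))(i := s)" for s by (rule fun_upd_twist)
        have "x(j := t) \<in> E" using that(2) unfolding Et_def by blast
        from insert.prems(4)[OF insertI2[OF that(1)] this] show ?thesis by (simp only: eq)
      qed
    qed
    have 2: "emeasure ?P (Et t) \<le> ?A"
    proof -
      have "emeasure ?P (Et t) = (\<integral>\<^sup>+x. indicator (Et t) x \<partial>?P)" using Et by simp
      also have "\<dots> \<le> (\<integral>\<^sup>+x. (\<integral>\<^sup>+s. g j (x(j := s)) \<partial>lborel) \<partial>?P)"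
      proof (rule nn_integral_mono)
        fix x
        show "indicator (Et t) x \<le> (\<integral>\<^sup>+s. g j (x(j := s)) \<partial>lborel)"
        proof (cases "x \<in> Et t")
          case True
          then have "x(j := t) \<in> E" unfolding Et_def by blast
          from insert.prems(4)[OF insertI1 this] show ?thesis
            using True by (simp only: fun_upd_upd indicator_simps)
        qed simp
      qed
      also have "\<dots> = ?A"
        by (rule product_nn_integral_insert[symmetric, OF fin j]) (rule gm, simp)
      finally show ?thesis .
    qed
    have "emeasure ?P (Et t) ^ card I = emeasure ?P (Et t) * emeasure ?P (Et t) ^ (card I - 1)"
      using fin ne by (simp add: card_gt_0_iff flip: power_Suc)
    also have "\<dots> \<le> ?A * (\<Prod>i\<in>I. G i t)" using 1 2 by (intro mult_mono) auto
    finally show ?thesis .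
  qed
  have "emeasure ?Q E ^ card I \<le> ?A * (\<Prod>i\<in>I. \<integral>\<^sup>+t. G i t \<partial>lborel)"
    unfolding EI using fin ne Gm Em slice by (rule nn_integral_geometric_mean)
  also have "(\<Prod>i\<in>I. \<integral>\<^sup>+t. G i t \<partial>lborel) = (\<Prod>i\<in>I. \<integral>\<^sup>+x. g i x \<partial>?Q)"
    unfolding G_def by (intro prod.cong refl product_nn_integral_insert_rev[symmetric] fin j) (auto intro: gm)
  finally show ?case using fin j by simp
qed

lemma nn_integral_lborel_shift:
  fixes f :: "real \<Rightarrow> ennreal"
  assumes "f \<in> borel_measurable borel"
  shows "(\<integral>\<^sup>+t. f (t - c) \<partial>lborel) = (\<integral>\<^sup>+t. f t \<partial>lborel)"
  using lborel_nn_integral_reflect(2)[OF assms] .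

text \<open>Lebesgue measure is the image of a product of one-dimensional measures under T. Changing
  the coordinate b moves T x along b, and translation invariance in t removes the offset.\<close>

lemma Loomis_Whitney:
  fixes E :: "'a::euclidean_space set" and g :: "'a \<Rightarrow> 'a \<Rightarrow> ennreal"
  assumes E: "E \<in> sets borel" "E \<noteq> {}"
    and g: "\<And>b. b \<in> Basis \<Longrightarrow> g b \<in> borel_measurable borel"
    and line: "\<And>b x. b \<in> Basis \<Longrightarrow> x \<in> E \<Longrightarrow> 1 \<le> (\<integral>\<^sup>+t. g b (x + t *\<^sub>R b) \<partial>lborel)"
  shows "emeasure lborel E ^ (DIM('a) - 1) \<le> (\<Prod>b\<in>Basis. \<integral>\<^sup>+x. g b x \<partial>lborel)"
proof -
  let ?P = "Pi\<^sub>M (Basis :: 'a set) (\<lambda>_. lborel :: real measure)"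
  define T :: "('a \<Rightarrow> real) \<Rightarrow> 'a" where "T f = (\<Sum>b\<in>Basis. f b *\<^sub>R b)" for f
  have T [measurable]: "T \<in> measurable ?P borel" unfolding T_def[abs_def] by measurable
  have D: "(lborel :: 'a measure) = distr ?P borel T" unfolding T_def[abs_def] by (rule lborel_eq)
  define E' where "E' = T -` E \<inter> space ?P"
  have E'1: "E' \<in> sets ?P" unfolding E'_def using E(1) by measurable
  have eE: "emeasure lborel E = emeasure ?P E'"
    unfolding E'_def by (subst D, rule emeasure_distr) (use E in auto)
  have E'2: "E' \<noteq> {}"
  proof -
    obtain x where x: "x \<in> E" using E by auto
    have "T (\<lambda>b\<in>Basis. x \<bullet> b) = x" by (simp add: T_def euclidean_representation)
    then have "(\<lambda>b\<in>Basis. x \<bullet> b) \<in> E'" using x by (auto simp: E'_def space_PiM)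
    then show ?thesis by auto
  qed
  have "emeasure ?P E' ^ (card (Basis :: 'a set) - 1) \<le> (\<Prod>b\<in>Basis. \<integral>\<^sup>+x. g b (T x) \<partial>?P)"
  proof (rule Loomis_Whitney_PiM[OF _ _ E'1 E'2])
    show "(\<lambda>x. g b (T x)) \<in> borel_measurable ?P" if "b \<in> Basis" for b
      using measurable_compose[OF T g[OF that]] .
    show "1 \<le> (\<integral>\<^sup>+t. g b (T (x(b := t))) \<partial>lborel)" if b: "b \<in> Basis" "x \<in> E'" for b x
    proof -
      have Tb: "T (x(b := t)) = T x + (t - x b) *\<^sub>R b" for t
      proof -
        have "T (x(b := t)) = t *\<^sub>R b + (\<Sum>c\<in>Basis - {b}. x c *\<^sub>R c)"
          unfolding T_def using b(1) by (subst sum.remove[of _ b]) (auto intro!: sum.cong)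
        moreover have "T x = x b *\<^sub>R b + (\<Sum>c\<in>Basis - {b}. x c *\<^sub>R c)"
          unfolding T_def using b(1) by (subst sum.remove[of _ b]) auto
        ultimately show ?thesis by (simp add: algebra_simps)
      qed
      have "(\<lambda>t. g b (T x + t *\<^sub>R b)) \<in> borel_measurable borel"
        by (rule measurable_compose[OF _ g[OF b(1)]]) measurable
      from nn_integral_lborel_shift[OF this, of "x b"]
      have "(\<integral>\<^sup>+t. g b (T (x(b := t))) \<partial>lborel) = (\<integral>\<^sup>+t. g b (T x + t *\<^sub>R b) \<partial>lborel)"
        by (simp add: Tb)
      then show ?thesis using line[OF b(1), of "T x"] b(2) by (simp add: E'_def)
    qed
  qed auto
  also have "(\<Prod>b\<in>Basis. \<integral>\<^sup>+x. g b (T x) \<partial>?P) = (\<Prod>b\<in>Basis. \<integral>\<^sup>+x. g b x \<partial>lborel)"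
    by (intro prod.cong refl) (subst D, subst nn_integral_distr, auto simp: g)
  finally show ?thesis by (simp add: eE)
qed

section \<open>The Sobolev inequality of weak type\<close>

lemma line_integral_bound:
  fixes f :: "'a::euclidean_space \<Rightarrow> real"
  assumes f: "C_k 1 f" and K: "compact K" "\<And>x. x \<notin> K \<Longrightarrow> f x = 0" and b: "norm b = 1"
  shows "ennreal \<bar>f x\<bar> \<le> (\<integral>\<^sup>+t. ennreal \<bar>frechet_derivative f (at (x + t *\<^sub>R b)) b\<bar> \<partial>lborel)"
proof -
  have f1: "C_k (Suc 0) f" using f by simp
  obtain R where R: "\<And>x. x \<in> K \<Longrightarrow> norm x \<le> R"
    using K(1) compact_imp_bounded bounded_iff by metis
  \<comment> \<open>T is so large that x - T b lies outside the support; the fundamental theorem of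
    calculus on [-T, 0] then gives f x itself.\<close>
  define T where "T = \<bar>R\<bar> + norm x + 1"
  have T: "T > 0" by (simp add: T_def add_nonneg_pos)
  have "norm (x + (- T) *\<^sub>R b) > R"
  proof -
    have "T = norm (T *\<^sub>R b)" using b T by simp
    also have "\<dots> \<le> norm (T *\<^sub>R b - x) + norm x" by (metis add.commute diff_add_cancel norm_triangle_ineq)
    finally have "T - norm x \<le> norm (x - T *\<^sub>R b)" by (simp add: norm_minus_commute)
    then have "\<bar>R\<bar> + 1 \<le> norm (x - T *\<^sub>R b)" unfolding T_def by linarith
    then show ?thesis by simp
  qed
  then have z: "f (x + (- T) *\<^sub>R b) = 0" using R K(2) by force
  define D where "D t = frechet_derivative f (at (x + t *\<^sub>R b)) b" for t
  have Dc: "continuous_on UNIV D"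
    unfolding D_def by (rule continuous_on_compose2[OF C_k_continuous[OF C_kD(2)[OF f1]]]) (auto intro!: continuous_intros)
  have der: "((\<lambda>t. f (x + t *\<^sub>R b)) has_real_derivative D t) (at t)" for t
  proof -
    have "((\<lambda>t. x + t *\<^sub>R b) has_derivative (\<lambda>s. s *\<^sub>R b)) (at t)" by (auto intro!: derivative_eq_intros)
    from has_derivative_compose[OF this C_kD(1)[OF f1]]
    have "((\<lambda>t. f (x + t *\<^sub>R b)) has_derivative (\<lambda>s. frechet_derivative f (at (x + t *\<^sub>R b)) (s *\<^sub>R b))) (at t)" .
    moreover have "frechet_derivative f (at (x + t *\<^sub>R b)) (s *\<^sub>R b) = D t * s" for s
      using has_derivative_linear[OF C_kD(1)[OF f1]] by (simp add: linear_scale D_def)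
    ultimately show ?thesis by (simp add: has_field_derivative_def)
  qed
  have Dco: "isCont D t" for t using Dc by (simp add: continuous_on_eq_continuous_at)
  have I: "has_bochner_integral lborel (\<lambda>t. D t * indicator {- T .. 0} t) (f (x + 0 *\<^sub>R b) - f (x + (- T) *\<^sub>R b))"
    by (rule has_bochner_integral_FTC_Icc_real) (use T der Dco in auto)
  have "ennreal \<bar>f x\<bar> = ennreal (norm (\<integral>t. D t * indicator {- T .. 0} t \<partial>lborel))"
    using has_bochner_integral_integral_eq[OF I] z by simp
  also have "\<dots> \<le> (\<integral>\<^sup>+t. norm (D t * indicator {- T .. 0} t) \<partial>lborel)"
    using I by (intro integral_norm_bound_ennreal) (auto simp: has_bochner_integral_iff)
  also have "\<dots> \<le> (\<integral>\<^sup>+t. ennreal \<bar>D t\<bar> \<partial>lborel)"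
    by (intro nn_integral_mono ennreal_leI) (auto simp: indicator_def)
  finally show ?thesis by (simp add: D_def)
qed

lemma Basis_axis: "(Basis :: (real^'n::finite) set) = range (\<lambda>i. axis i 1)"
  by (auto simp: Basis_vec_def)

lemma prod_Basis_axis: "(\<Prod>b\<in>Basis. f (b::real^'n::finite)) = (\<Prod>i\<in>UNIV. f (axis i 1))"
  unfolding Basis_axis by (subst prod.reindex) (auto simp: inj_on_def axis_eq_axis)

text \<open>Where |\<psi>| > \<beta>, the integral of |D_i \<psi>| / \<beta> along each coordinate
  line is at least 1, so these functions are admissible in Loomis-Whitney. The weak form suffices
  for the iteration, since truncations are constant in modulus beyond the upper level.\<close>

lemma Sobolev_weak_type_test:
  fixes \<Omega> :: "(real^'n::finite) set"
  assumes \<Omega>: "open \<Omega>" and \<psi>: "\<psi> \<in> test_functions \<Omega>" and \<beta>: "\<beta> > 0" and n: "CARD('n) \<ge> 2"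
  shows "\<beta> ^ CARD('n) * (measure (lebesgue_on \<Omega>) {x \<in> \<Omega>. \<bar>\<psi> x\<bar> > \<beta>}) ^ (CARD('n) - 1)
    \<le> (\<Prod>i\<in>UNIV. \<integral>x. \<bar>pd i \<psi> x\<bar> \<partial>lebesgue_on \<Omega>)"
proof -
  let ?I = "\<lambda>i. \<integral>x. \<bar>pd i \<psi> x\<bar> \<partial>lebesgue_on \<Omega>"
  define E where "E = {x. \<bar>\<psi> x\<bar> > \<beta>}"
  obtain K where K: "compact K" "K \<subseteq> \<Omega>" "\<And>x. x \<notin> K \<Longrightarrow> \<psi> x = 0"
    using test_functionsE[OF \<psi>] by metis
  have s: "smooth \<psi>" using \<psi> by (rule test_functions_smooth)
  have [measurable]: "\<psi> \<in> borel_measurable borel" "pd i \<psi> \<in> borel_measurable borel" for i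
    using s by (auto intro!: smooth_borel smooth_derivative)
  have E: "E \<in> sets borel" unfolding E_def by measurable
  have EK: "E \<subseteq> K" using K(3) \<beta> by (force simp: E_def)
  have EO: "{x \<in> \<Omega>. \<bar>\<psi> x\<bar> > \<beta>} = E" using EK K(2) by (auto simp: E_def)
  have pz: "pd i \<psi> x = 0" if "x \<notin> K" for i x
    using frechet_derivative_zero_outside[OF K(1,3) that] .
  have Ieq: "ennreal (?I i) = (\<integral>\<^sup>+x. ennreal \<bar>pd i \<psi> x\<bar> \<partial>lborel)" for i
  proof -
    have i: "integrable lborel (\<lambda>x. \<bar>pd i \<psi> x\<bar>)"
      by (rule integrable_abs, rule integrable_compact_support[OF smooth_continuous[OF smooth_derivative[OF s]] K(1) pz])
    have "?I i = (\<integral>x. \<bar>pd i \<psi> x\<bar> \<partial>lborel)"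
      by (rule integral_lebesgue_on_borel(1)[OF \<Omega>]) (use pz K(2) in auto)
    then show ?thesis using nn_integral_eq_integral[OF i] by simp
  qed
  have mE: "emeasure lborel E = ennreal (measure (lebesgue_on \<Omega>) {x \<in> \<Omega>. \<bar>\<psi> x\<bar> > \<beta>})"
  proof -
    have "emeasure lborel E < \<infinity>"
      using emeasure_bounded_finite[OF bounded_subset[OF compact_imp_bounded[OF K(1)] EK]] .
    then have "emeasure lborel E = ennreal (measure lborel E)"
      by (simp add: emeasure_eq_ennreal_measure)
    also have "measure lborel E = measure (lebesgue_on \<Omega>) E"
      using E EK K(2) \<Omega> by (subst measure_restrict_space) (auto simp: measure_completion)
    finally show ?thesis by (simp only: EO)
  qed
  show ?thesis
  proof (cases "E = {}")
    case True
    \<comment> \<open>The exponent n - 1 is positive, so an empty superlevel set contributes 0 and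
      not 0^0 = 1.\<close>
    have "(0::real) ^ (CARD('n) - 1) = 0" using n by (intro zero_power) auto
    moreover have "0 \<le> (\<Prod>i\<in>UNIV. ?I i)" by (intro prod_nonneg) auto
    moreover have "measure (lebesgue_on \<Omega>) {x \<in> \<Omega>. \<bar>\<psi> x\<bar> > \<beta>} = 0" using True by (simp only: EO) simp
    ultimately show ?thesis by (simp only: mult_zero_right)
  next
    case ne: False
    have "emeasure lborel E ^ (DIM(real^'n) - 1)
        \<le> (\<Prod>b\<in>Basis. \<integral>\<^sup>+x. ennreal (\<bar>frechet_derivative \<psi> (at x) b\<bar> / \<beta>) \<partial>lborel)"
    proof (rule Loomis_Whitney[OF E ne])
      fix b :: "real^'n" assume b: "b \<in> Basis"
      have [measurable]: "(\<lambda>x. frechet_derivative \<psi> (at x) b) \<in> borel_measurable borel"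
        using s by (intro smooth_borel smooth_derivative)
      show "(\<lambda>x. ennreal (\<bar>frechet_derivative \<psi> (at x) b\<bar> / \<beta>)) \<in> borel_measurable borel" by measurable
      fix x assume "x \<in> E"
      then have x: "\<beta> < \<bar>\<psi> x\<bar>" by (simp add: E_def)
      have m: "(\<lambda>t. ennreal \<bar>frechet_derivative \<psi> (at (x + t *\<^sub>R b)) b\<bar>) \<in> borel_measurable lborel"
        by measurable
      have "1 \<le> ennreal (1 / \<beta>) * ennreal \<bar>\<psi> x\<bar>"
        using x \<beta> by (simp add: field_simps flip: ennreal_mult)
      also have "\<dots> \<le> ennreal (1 / \<beta>) * (\<integral>\<^sup>+t. ennreal \<bar>frechet_derivative \<psi> (at (x + t *\<^sub>R b)) b\<bar> \<partial>lborel)"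
        by (intro mult_left_mono line_integral_bound[OF smooth_C_k[OF s] K(1,3)]) (use b in auto)
      also have "\<dots> = (\<integral>\<^sup>+t. ennreal (1 / \<beta>) * ennreal \<bar>frechet_derivative \<psi> (at (x + t *\<^sub>R b)) b\<bar> \<partial>lborel)"
        using m by (rule nn_integral_cmult[symmetric])
      also have "\<dots> = (\<integral>\<^sup>+t. ennreal (\<bar>frechet_derivative \<psi> (at (x + t *\<^sub>R b)) b\<bar> / \<beta>) \<partial>lborel)"
        using \<beta> by (intro nn_integral_cong) (simp add: mult.commute flip: ennreal_mult)
      finally show "1 \<le> (\<integral>\<^sup>+t. ennreal (\<bar>frechet_derivative \<psi> (at (x + t *\<^sub>R b)) b\<bar> / \<beta>) \<partial>lborel)" .
    qed
    also have "\<dots> = (\<Prod>i\<in>UNIV. \<integral>\<^sup>+x. ennreal (\<bar>pd i \<psi> x\<bar> / \<beta>) \<partial>lborel)" by (rule prod_Basis_axis)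
    also have "\<dots> = (\<Prod>i\<in>(UNIV :: 'n set). ennreal (?I i / \<beta>))"
    proof (rule prod.cong[OF refl])
      fix i :: 'n
      have "(\<integral>\<^sup>+x. ennreal (\<bar>pd i \<psi> x\<bar> / \<beta>) \<partial>lborel) = (\<integral>\<^sup>+x. ennreal (1 / \<beta>) * ennreal \<bar>pd i \<psi> x\<bar> \<partial>lborel)"
        using \<beta> by (intro nn_integral_cong) (simp add: mult.commute flip: ennreal_mult)
      also have "\<dots> = ennreal (1 / \<beta>) * ennreal (?I i)"
        unfolding Ieq by (rule nn_integral_cmult) measurable
      also have "\<dots> = ennreal (?I i / \<beta>)" using \<beta> by (simp flip: ennreal_mult)
      finally show "(\<integral>\<^sup>+x. ennreal (\<bar>pd i \<psi> x\<bar> / \<beta>) \<partial>lborel) = ennreal (?I i / \<beta>)" .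
    qed
    also have "\<dots> = ennreal (\<Prod>i\<in>(UNIV :: 'n set). ?I i / \<beta>)"
      using \<beta> by (intro prod_ennreal) auto
    finally have "(measure (lebesgue_on \<Omega>) {x \<in> \<Omega>. \<bar>\<psi> x\<bar> > \<beta>}) ^ (CARD('n) - 1) \<le> (\<Prod>i\<in>(UNIV :: 'n set). ?I i / \<beta>)"
      using \<beta> by (simp add: mE ennreal_power prod_nonneg)
    also have "\<dots> = (\<Prod>i\<in>UNIV. ?I i) / \<beta> ^ CARD('n)" by (simp add: prod_dividef)
    finally show ?thesis using \<beta> by (simp add: field_simps)
  qed
qed

text \<open>Measures of superlevel sets are not continuous under mean square convergence. Lowering
  the level to \<beta>' < \<beta> for the approximating test functions makes the excess a set where
  \<psi> m and v differ by at least \<beta> - \<beta>', which Chebyshev's inequality controls;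
  afterwards \<beta>' tends to \<beta>.\<close>

lemma Sobolev_weak_type:
  fixes \<Omega> :: "(real^'n::finite) set"
  assumes \<Omega>: "open \<Omega>" "bounded \<Omega>" and v: "v \<in> W12_0 \<Omega>" and g: "weak_gradient \<Omega> v g"
    and \<beta>: "\<beta> > 0" and n: "CARD('n) \<ge> 2"
  shows "\<beta> ^ CARD('n) * (measure (lebesgue_on \<Omega>) {x \<in> \<Omega>. \<bar>v x\<bar> > \<beta>}) ^ (CARD('n) - 1)
    \<le> (\<Prod>i\<in>UNIV. \<integral>x. \<bar>g i x\<bar> \<partial>lebesgue_on \<Omega>)"
proof -
  let ?M = "lebesgue_on \<Omega>" and ?N = "CARD('n)"
  interpret finite_measure ?M using \<Omega> by (rule finite_measure_lebesgue_on)
  have sp: "space ?M = \<Omega>" by (simp add: space_restrict_space)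
  define \<mu> where "\<mu> = measure ?M {x \<in> \<Omega>. \<bar>v x\<bar> > \<beta>}"
  obtain \<psi> where \<psi>: "\<And>m. \<psi> m \<in> test_functions \<Omega>" "W12_tendsto \<Omega> \<psi> (\<lambda>m i. pd i (\<psi> m)) v g"
    using W12_0_approx[OF \<Omega>(1) v g] by metis
  have \<psi>v: "L2_tendsto ?M \<psi> v" "L2_tendsto ?M (\<lambda>m. pd i (\<psi> m)) (g i)" for i
    using \<psi>(2) by (auto simp: W12_tendsto_def)
  have [measurable]: "v \<in> borel_measurable ?M" "\<psi> m \<in> borel_measurable ?M" for m
    using \<psi>v(1) L2_tendstoD(4,5) by blast+
  have lim: "(\<lambda>m. \<integral>x. \<bar>pd i (\<psi> m) x\<bar> \<partial>?M) \<longlonglongrightarrow> (\<integral>x. \<bar>g i x\<bar> \<partial>?M)" for i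
  proof -
    have "L2_tendsto ?M (\<lambda>m x. \<bar>pd i (\<psi> m) x\<bar>) (\<lambda>x. \<bar>g i x\<bar>)"
    proof (rule L2_tendsto_lipschitz[OF \<psi>v(2)])
      show "\<bar>\<bar>s\<bar> - \<bar>t\<bar>\<bar> \<le> 1 * \<bar>s - t\<bar>" for s t :: real using abs_triangle_ineq3[of s t] by simp
      show "(\<lambda>x. \<bar>g i x\<bar>) \<in> L2 ?M"
        by (rule L2_bound[OF weak_gradientD(2)[OF g], of _ 1]) (use L2D(1)[OF weak_gradientD(2)[OF g]] in auto)
    qed simp
    from L2_tendsto_integral[OF this L2_bounded[of "\<lambda>x. 1" 1]] show ?thesis by simp
  qed
  have main: "\<beta>' ^ ?N * \<mu> ^ (?N - 1) \<le> (\<Prod>i\<in>UNIV. \<integral>x. \<bar>g i x\<bar> \<partial>?M)" if \<beta>': "0 < \<beta>'" "\<beta>' < \<beta>" for \<beta>'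
  proof -
    \<comment> \<open>The Chebyshev bound for the set where the approximation is off by at least
      \<beta> - \<beta>'.\<close>
    define e where "e m = (nrm ?M (\<lambda>x. \<psi> m x - v x))\<^sup>2 / (\<beta> - \<beta>')\<^sup>2" for m
    have e0: "e \<longlonglongrightarrow> 0"
      using tendsto_divide[OF tendsto_power[OF L2_tendstoD(3)[OF \<psi>v(1)], of 2] tendsto_const[of "(\<beta> - \<beta>')\<^sup>2"]] \<beta>'
      by (simp add: e_def[abs_def])
    have \<mu>le: "\<mu> \<le> measure ?M {x \<in> \<Omega>. \<bar>\<psi> m x\<bar> > \<beta>'} + e m" for m
    proof -
      have "\<mu> \<le> measure ?M ({x \<in> space ?M. \<bar>\<psi> m x\<bar> > \<beta>'} \<union> {x \<in> space ?M. (\<psi> m x - v x)\<^sup>2 \<ge> (\<beta> - \<beta>')\<^sup>2})"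
        unfolding \<mu>_def
      proof (rule finite_measure_mono)
        show "{x \<in> \<Omega>. \<bar>v x\<bar> > \<beta>} \<subseteq> {x \<in> space ?M. \<bar>\<psi> m x\<bar> > \<beta>'} \<union> {x \<in> space ?M. (\<psi> m x - v x)\<^sup>2 \<ge> (\<beta> - \<beta>')\<^sup>2}"
        proof
          fix x assume x: "x \<in> {x \<in> \<Omega>. \<bar>v x\<bar> > \<beta>}"
          show "x \<in> {x \<in> space ?M. \<bar>\<psi> m x\<bar> > \<beta>'} \<union> {x \<in> space ?M. (\<psi> m x - v x)\<^sup>2 \<ge> (\<beta> - \<beta>')\<^sup>2}"
          proof (cases "\<bar>\<psi> m x\<bar> > \<beta>'")
            case False
            then have "\<bar>\<beta> - \<beta>'\<bar> \<le> \<bar>\<psi> m x - v x\<bar>" using x \<beta>' by auto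
            then have "(\<beta> - \<beta>')\<^sup>2 \<le> (\<psi> m x - v x)\<^sup>2" by (simp add: abs_le_square_iff)
            then show ?thesis using x by (simp add: sp)
          qed (use x in \<open>simp add: sp\<close>)
        qed
      qed measurable
      also have "\<dots> \<le> measure ?M {x \<in> space ?M. \<bar>\<psi> m x\<bar> > \<beta>'} + measure ?M {x \<in> space ?M. (\<psi> m x - v x)\<^sup>2 \<ge> (\<beta> - \<beta>')\<^sup>2}"
        by (rule measure_Un_le) measurable
      also have "measure ?M {x \<in> space ?M. (\<psi> m x - v x)\<^sup>2 \<ge> (\<beta> - \<beta>')\<^sup>2} \<le> e m"
        unfolding e_def nrm_power2
        by (rule integral_Markov_inequality_measure[of _ _ "{}"])
          (use \<beta>' L2D(2)[OF L2_diff[OF L2_tendstoD(2,1)[OF \<psi>v(1)]]] in auto)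
      finally show ?thesis by (simp add: sp)
    qed
    \<comment> \<open>The difference \<mu> - e m can be negative for small m, where taking powers is
      not monotone; the maximum with 0 repairs this and disappears in the limit.\<close>
    have "\<beta>' ^ ?N * max 0 (\<mu> - e m) ^ (?N - 1) \<le> (\<Prod>i\<in>UNIV. \<integral>x. \<bar>pd i (\<psi> m) x\<bar> \<partial>?M)" for m
    proof -
      have "max 0 (\<mu> - e m) ^ (?N - 1) \<le> measure ?M {x \<in> \<Omega>. \<bar>\<psi> m x\<bar> > \<beta>'} ^ (?N - 1)"
        using \<mu>le[of m] by (intro power_mono) auto
      then have "\<beta>' ^ ?N * max 0 (\<mu> - e m) ^ (?N - 1) \<le> \<beta>' ^ ?N * measure ?M {x \<in> \<Omega>. \<bar>\<psi> m x\<bar> > \<beta>'} ^ (?N - 1)"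
        using \<beta>' by (intro mult_left_mono) auto
      also have "\<dots> \<le> (\<Prod>i\<in>UNIV. \<integral>x. \<bar>pd i (\<psi> m) x\<bar> \<partial>?M)"
        by (rule Sobolev_weak_type_test[OF \<Omega>(1) \<psi>(1) \<beta>'(1) n])
      finally show ?thesis .
    qed
    moreover have "(\<lambda>m. \<beta>' ^ ?N * max 0 (\<mu> - e m) ^ (?N - 1)) \<longlonglongrightarrow> \<beta>' ^ ?N * max 0 (\<mu> - 0) ^ (?N - 1)"
      by (intro tendsto_intros e0)
    moreover have "(\<lambda>m. \<Prod>i\<in>UNIV. \<integral>x. \<bar>pd i (\<psi> m) x\<bar> \<partial>?M) \<longlonglongrightarrow> (\<Prod>i\<in>UNIV. \<integral>x. \<bar>g i x\<bar> \<partial>?M)"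
      by (intro tendsto_prod lim)
    ultimately have "\<beta>' ^ ?N * max 0 (\<mu> - 0) ^ (?N - 1) \<le> (\<Prod>i\<in>UNIV. \<integral>x. \<bar>g i x\<bar> \<partial>?M)"
      by (intro LIMSEQ_le) auto
    moreover have "\<mu> \<ge> 0" by (simp add: \<mu>_def)
    ultimately show ?thesis by (simp add: max_def)
  qed
  have "(\<lambda>k. (\<beta> - \<beta> / 2 * inverse (real (Suc k))) ^ ?N * \<mu> ^ (?N - 1)) \<longlonglongrightarrow> (\<beta> - \<beta> / 2 * 0) ^ ?N * \<mu> ^ (?N - 1)"
    by (intro tendsto_intros LIMSEQ_inverse_real_of_nat)
  moreover have "(\<beta> - \<beta> / 2 * inverse (real (Suc k))) ^ ?N * \<mu> ^ (?N - 1) \<le> (\<Prod>i\<in>UNIV. \<integral>x. \<bar>g i x\<bar> \<partial>?M)" for k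
  proof (rule main)
    have "\<beta> / 2 * inverse (real (Suc k)) \<le> \<beta> / 2 * 1"
      using \<beta> by (intro mult_left_mono) (auto simp: field_simps)
    then show "0 < \<beta> - \<beta> / 2 * inverse (real (Suc k))" using \<beta> by linarith
    show "\<beta> - \<beta> / 2 * inverse (real (Suc k)) < \<beta>" using \<beta> by (simp add: zero_less_mult_iff)
  qed
  ultimately have "(\<beta> - \<beta> / 2 * 0) ^ ?N * \<mu> ^ (?N - 1) \<le> (\<Prod>i\<in>UNIV. \<integral>x. \<bar>g i x\<bar> \<partial>?M)"
    by (intro LIMSEQ_le_const2) auto
  then show ?thesis by (simp add: \<mu>_def)
qed

section \<open>Energy estimates\<close>

text \<open>\<open>trunc k a\<close> is the odd function of class \<open>C\<^sup>1\<close> with values in \<open>[-a, a]\<close> whose derivative is a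
  piecewise linear hat on \<open>k \<le> \<bar>t\<bar> \<le> k + 2 * a\<close>, so that the truncation needs only the chain rule
  for functions with Lipschitz derivative.\<close>

definition trunc_pos :: "real \<Rightarrow> real \<Rightarrow> real \<Rightarrow> real" where
  "trunc_pos k a t = ((max 0 (t - k))\<^sup>2 - 2 * (max 0 (t - k - a))\<^sup>2 + (max 0 (t - k - 2 * a))\<^sup>2) / (2 * a)"

definition trunc_pos' :: "real \<Rightarrow> real \<Rightarrow> real \<Rightarrow> real" where
  "trunc_pos' k a t = (max 0 (t - k) - 2 * max 0 (t - k - a) + max 0 (t - k - 2 * a)) / a"

definition trunc :: "real \<Rightarrow> real \<Rightarrow> real \<Rightarrow> real" where
  "trunc k a t = trunc_pos k a t - trunc_pos k a (- t)"

definition trunc' :: "real \<Rightarrow> real \<Rightarrow> real \<Rightarrow> real" where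
  "trunc' k a t = trunc_pos' k a t + trunc_pos' k a (- t)"

text \<open>The squared positive part has a Lipschitz derivative, including at the corner. The
  numerator of \<open>trunc_pos\<close> is a second difference of such squares with step a, and the
  same difference of positive parts is the hat.\<close>

lemma max_square_has_derivative:
  "((\<lambda>t. (max 0 (t - r))\<^sup>2) has_real_derivative 2 * max 0 (t - r)) (at (t::real))"
proof (cases t r rule: linorder_cases)
  case less
  have "((\<lambda>t. 0) has_real_derivative 0) (at t)" by simp
  then have "((\<lambda>t. (max 0 (t - r))\<^sup>2) has_real_derivative 0) (at t)"
    by (rule has_field_derivative_transform_within[where d="r - t"]) (use less in \<open>auto simp: dist_real_def\<close>)
  then show ?thesis using less by simp
next
  case greater
  have "((\<lambda>t. (t - r)\<^sup>2) has_real_derivative 2 * (t - r)) (at t)"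
    by (auto intro!: derivative_eq_intros)
  then have "((\<lambda>t. (max 0 (t - r))\<^sup>2) has_real_derivative 2 * (t - r)) (at t)"
    by (rule has_field_derivative_transform_within[where d="t - r"]) (use greater in \<open>auto simp: dist_real_def\<close>)
  then show ?thesis using greater by simp
next
  case equal
  have "((\<lambda>h. ((max 0 (r + h - r))\<^sup>2 - (max 0 (r - r))\<^sup>2) / h) \<longlongrightarrow> 0) (at 0)"
  proof (rule Lim_null_comparison)
    show "\<forall>\<^sub>F h in at 0. norm (((max 0 (r + h - r))\<^sup>2 - (max 0 (r - r))\<^sup>2) / h) \<le> \<bar>h\<bar>"
      by (intro always_eventually) (auto simp: max_def power2_eq_square)
    show "((\<lambda>h. \<bar>h\<bar>) \<longlongrightarrow> 0) (at (0::real))"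
      using tendsto_rabs[OF tendsto_ident_at[of 0 UNIV]] by simp
  qed
  then show ?thesis using equal by (simp add: DERIV_def)
qed

lemma trunc_pos_has_derivative:
  "a > 0 \<Longrightarrow> (trunc_pos k a has_real_derivative trunc_pos' k a t) (at t)"
  unfolding trunc_pos_def[abs_def] trunc_pos'_def diff_diff_eq
  by (rule derivative_eq_intros max_square_has_derivative refl | simp add: field_simps)+

lemma trunc_pos_cases:
  assumes "a > 0"
  shows "t \<le> k \<Longrightarrow> trunc_pos k a t = 0" "t \<le> k \<Longrightarrow> trunc_pos' k a t = 0"
    "k + 2 * a \<le> t \<Longrightarrow> trunc_pos k a t = a" "k + 2 * a \<le> t \<Longrightarrow> trunc_pos' k a t = 0"
    "0 \<le> trunc_pos' k a t" "trunc_pos' k a t \<le> 1"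
proof -
  show "t \<le> k \<Longrightarrow> trunc_pos k a t = 0" "t \<le> k \<Longrightarrow> trunc_pos' k a t = 0"
    using assms by (auto simp: trunc_pos_def trunc_pos'_def)
  show "trunc_pos k a t = a" if "k + 2 * a \<le> t"
  proof -
    have "max 0 (t - k) = t - k" "max 0 (t - k - a) = t - k - a" "max 0 (t - k - 2 * a) = t - k - 2 * a"
      using assms that by auto
    then have "trunc_pos k a t = ((t - k)\<^sup>2 - 2 * (t - k - a)\<^sup>2 + (t - k - 2 * a)\<^sup>2) / (2 * a)"
      by (simp only: trunc_pos_def)
    also have "(t - k)\<^sup>2 - 2 * (t - k - a)\<^sup>2 + (t - k - 2 * a)\<^sup>2 = a * (2 * a)"
      by (simp add: power2_eq_square algebra_simps)
    finally show ?thesis using assms by simp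
  qed
  show "k + 2 * a \<le> t \<Longrightarrow> trunc_pos' k a t = 0" "0 \<le> trunc_pos' k a t" "trunc_pos' k a t \<le> 1"
    using assms by (auto simp: trunc_pos'_def max_def divide_simps)
qed

lemma trunc_pos_bounds:
  assumes "a > 0"
  shows "0 \<le> trunc_pos k a t" "trunc_pos k a t \<le> a"
proof -
  have mono: "trunc_pos k a s \<le> trunc_pos k a t" if "s \<le> t" for s t
    using that by (rule DERIV_nonneg_imp_nondecreasing)
      (use trunc_pos_has_derivative[OF assms] trunc_pos_cases(5)[OF assms] in blast)
  show "0 \<le> trunc_pos k a t"
    using mono[of "min k t" t] trunc_pos_cases(1)[OF assms, of "min k t" k] by simp
  show "trunc_pos k a t \<le> a"
    using mono[of t "max t (k + 2 * a)"] trunc_pos_cases(3)[OF assms, of k "max t (k + 2 * a)"] by simp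
qed

lemma trunc_pos'_lipschitz:
  assumes "a > 0"
  shows "\<bar>trunc_pos' k a s - trunc_pos' k a t\<bar> \<le> 4 / a * \<bar>s - t\<bar>"
proof -
  have m: "\<bar>max 0 (s - r) - max 0 (t - r)\<bar> \<le> \<bar>s - t\<bar>" for r by (simp add: max_def)
  have "\<bar>trunc_pos' k a s - trunc_pos' k a t\<bar>
     = \<bar>(max 0 (s - k) - max 0 (t - k)) - 2 * (max 0 (s - (k + a)) - max 0 (t - (k + a)))
      + (max 0 (s - (k + 2 * a)) - max 0 (t - (k + 2 * a)))\<bar> / a"
    using assms by (simp add: trunc_pos'_def diff_divide_distrib[symmetric] add_divide_distrib[symmetric] algebra_simps)
  also have "\<dots> \<le> (4 * \<bar>s - t\<bar>) / a"
  proof (rule divide_right_mono)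
    have "\<bar>X - 2 * Y + Z\<bar> \<le> 4 * d" if "\<bar>X\<bar> \<le> d" "\<bar>Y\<bar> \<le> d" "\<bar>Z\<bar> \<le> d" for X Y Z d :: real
      using that unfolding abs_le_iff by linarith
    from this[OF m[of k] m[of "k + a"] m[of "k + 2 * a"]]
    show "\<bar>(max 0 (s - k) - max 0 (t - k)) - 2 * (max 0 (s - (k + a)) - max 0 (t - (k + a)))
      + (max 0 (s - (k + 2 * a)) - max 0 (t - (k + 2 * a)))\<bar> \<le> 4 * \<bar>s - t\<bar>" .
  qed (use assms in simp)
  finally show ?thesis by simp
qed

lemma trunc_has_derivative:
  assumes "a > 0" shows "(trunc k a has_real_derivative trunc' k a t) (at t)"
proof -
  have "((\<lambda>t. trunc_pos k a (- t)) has_real_derivative trunc_pos' k a (- t) * (-1)) (at t)"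
    by (rule DERIV_chain2[OF trunc_pos_has_derivative[OF assms]]) (auto intro!: derivative_eq_intros)
  from DERIV_diff[OF trunc_pos_has_derivative[OF assms] this] show ?thesis
    by (simp add: trunc_def[abs_def] trunc'_def)
qed

lemma trunc_props:
  assumes a: "a > 0" and k: "k \<ge> 0"
  shows "\<bar>t\<bar> \<le> k \<Longrightarrow> trunc k a t = 0" "\<bar>t\<bar> \<le> k \<Longrightarrow> trunc' k a t = 0"
    "k + 2 * a \<le> \<bar>t\<bar> \<Longrightarrow> trunc k a t = (if t > 0 then a else - a)" "k + 2 * a \<le> \<bar>t\<bar> \<Longrightarrow> trunc' k a t = 0"
    "0 \<le> trunc' k a t" "trunc' k a t \<le> 1" "\<bar>trunc k a t\<bar> \<le> a" "0 \<le> t * trunc k a t"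
    "\<bar>trunc' k a s - trunc' k a t\<bar> \<le> 8 / a * \<bar>s - t\<bar>"
    "t \<ge> 0 \<Longrightarrow> 0 \<le> trunc k a t" "t \<le> 0 \<Longrightarrow> trunc k a t \<le> 0"
proof -
  note c = trunc_pos_cases[OF a] and b = trunc_pos_bounds[OF a]
  show "\<bar>t\<bar> \<le> k \<Longrightarrow> trunc k a t = 0" "\<bar>t\<bar> \<le> k \<Longrightarrow> trunc' k a t = 0"
    by (auto simp: trunc_def trunc'_def c(1,2))
  show "k + 2 * a \<le> \<bar>t\<bar> \<Longrightarrow> trunc k a t = (if t > 0 then a else - a)" "k + 2 * a \<le> \<bar>t\<bar> \<Longrightarrow> trunc' k a t = 0"
    using a k by (auto simp: trunc_def trunc'_def c(1-4) abs_if split: if_splits)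
  \<comment> \<open>Since k is nonnegative, at most one of the two halves is active at any t;
    otherwise the bound would only be 2.\<close>
  have or: "t \<le> k \<or> - t \<le> k" using k by linarith
  show "0 \<le> trunc' k a t" by (simp add: trunc'_def c(5))
  show "trunc' k a t \<le> 1" using or by (auto simp: trunc'_def c(2) c(6))
  show p: "t \<ge> 0 \<Longrightarrow> 0 \<le> trunc k a t" and q: "t \<le> 0 \<Longrightarrow> trunc k a t \<le> 0"
    using k b by (auto simp: trunc_def c(1))
  show "\<bar>trunc k a t\<bar> \<le> a" using b[of k t] b[of k "- t"] by (simp add: trunc_def)
  show "0 \<le> t * trunc k a t"
    using p q by (cases "t \<ge> 0") (auto simp: zero_le_mult_iff)
  show "\<bar>trunc' k a s - trunc' k a t\<bar> \<le> 8 / a * \<bar>s - t\<bar>"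
  proof -
    have "\<bar>trunc' k a s - trunc' k a t\<bar> \<le> \<bar>trunc_pos' k a s - trunc_pos' k a t\<bar> + \<bar>trunc_pos' k a (- s) - trunc_pos' k a (- t)\<bar>"
      by (simp add: trunc'_def)
    also have "\<dots> \<le> 4 / a * \<bar>s - t\<bar> + 4 / a * \<bar>- s - (- t)\<bar>"
      by (intro add_mono trunc_pos'_lipschitz a)
    also have "\<dots> = 8 / a * \<bar>s - t\<bar>" by (simp add: abs_minus_commute)
    finally show ?thesis .
  qed
qed

text \<open>After its plateau this truncation decreases to zero with slope \<open>\<delta>\<close>. Composed with \<open>u\<close> it is a
  test function for which \<open>c * u * v\<close> is bounded by a multiple of \<open>c\<close>, hence integrable.\<close>

definition slow_trunc :: "real \<Rightarrow> real \<Rightarrow> real \<Rightarrow> real \<Rightarrow> real" where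
  "slow_trunc \<delta> k a t = trunc k a t - \<delta> * trunc (k + 2 * a) (a / \<delta>) t"

definition slow_trunc' :: "real \<Rightarrow> real \<Rightarrow> real \<Rightarrow> real \<Rightarrow> real" where
  "slow_trunc' \<delta> k a t = trunc' k a t - \<delta> * trunc' (k + 2 * a) (a / \<delta>) t"

text \<open>Three of these facts drive the energy estimate: the sign agrees with that of t, the
  function is 0 again beyond k + 2a + 2a/\<delta>, and the price in the derivative is at most
  \<delta>. The descent has slope at most \<delta> and total height a, hence the width
  2a/\<delta>.\<close>

lemma slow_trunc_props:
  assumes a: "a > 0" and k: "k \<ge> 0" and \<delta>: "0 < \<delta>" "\<delta> < 1"
  shows "(slow_trunc \<delta> k a has_real_derivative slow_trunc' \<delta> k a t) (at t)"
    and "\<bar>t\<bar> \<le> k \<Longrightarrow> slow_trunc \<delta> k a t = 0" "\<bar>t\<bar> \<le> k \<Longrightarrow> slow_trunc' \<delta> k a t = 0"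
    and "\<bar>slow_trunc' \<delta> k a t\<bar> \<le> 2" "trunc' k a t - \<delta> \<le> slow_trunc' \<delta> k a t"
    and "\<bar>slow_trunc \<delta> k a t\<bar> \<le> a" "0 \<le> t * slow_trunc \<delta> k a t"
    and "k + 2 * a + 2 * (a / \<delta>) \<le> \<bar>t\<bar> \<Longrightarrow> slow_trunc \<delta> k a t = 0"
    and "\<bar>slow_trunc' \<delta> k a s - slow_trunc' \<delta> k a t\<bar> \<le> (8 / a + \<delta> * (8 / (a / \<delta>))) * \<bar>s - t\<bar>"
proof -
  have a2: "a / \<delta> > 0" "k + 2 * a \<ge> 0" using a k \<delta> by auto
  note p = trunc_props[OF a k] and q = trunc_props[OF a2]
  show "(slow_trunc \<delta> k a has_real_derivative slow_trunc' \<delta> k a t) (at t)"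
    unfolding slow_trunc_def[abs_def] slow_trunc'_def
    by (auto intro!: derivative_eq_intros trunc_has_derivative a a2(1))
  show "\<bar>t\<bar> \<le> k \<Longrightarrow> slow_trunc \<delta> k a t = 0" "\<bar>t\<bar> \<le> k \<Longrightarrow> slow_trunc' \<delta> k a t = 0"
    using a by (simp_all add: slow_trunc_def slow_trunc'_def p(1,2) q(1,2))
  have d: "0 \<le> \<delta> * trunc' (k + 2 * a) (a / \<delta>) t" "\<delta> * trunc' (k + 2 * a) (a / \<delta>) t \<le> \<delta> * 1" for t
    using \<delta> q(5,6) by (auto intro!: mult_left_mono)
  show "\<bar>slow_trunc' \<delta> k a t\<bar> \<le> 2" "trunc' k a t - \<delta> \<le> slow_trunc' \<delta> k a t"
    using d(1)[of t] d(2)[of t] p(5)[of t] p(6)[of t] \<delta> unfolding slow_trunc'_def abs_le_iff by linarith+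
  have da: "\<bar>\<delta> * trunc (k + 2 * a) (a / \<delta>) t\<bar> \<le> a" for t
  proof -
    have "\<bar>\<delta> * trunc (k + 2 * a) (a / \<delta>) t\<bar> \<le> \<delta> * (a / \<delta>)"
      unfolding abs_mult using \<delta> q(7)[of t] by (intro mult_mono) auto
    then show ?thesis using \<delta> by simp
  qed
  have sgn: "t \<ge> 0 \<Longrightarrow> 0 \<le> slow_trunc \<delta> k a t" "t \<ge> 0 \<Longrightarrow> slow_trunc \<delta> k a t \<le> a"
    "t \<le> 0 \<Longrightarrow> slow_trunc \<delta> k a t \<le> 0" "t \<le> 0 \<Longrightarrow> - a \<le> slow_trunc \<delta> k a t"
  proof -
    show "0 \<le> slow_trunc \<delta> k a t" if "t \<ge> 0"
      using that p(3)[of t] p(10)[of t] q(1)[of t] da[of t] a k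
      by (cases "k + 2 * a \<le> \<bar>t\<bar>") (auto simp: slow_trunc_def)
    show "slow_trunc \<delta> k a t \<le> a" if "t \<ge> 0"
      using that p(7)[of t] mult_nonneg_nonneg[OF less_imp_le[OF \<delta>(1)] q(10)[of t]] by (simp add: slow_trunc_def)
    show "slow_trunc \<delta> k a t \<le> 0" if "t \<le> 0"
      using that p(3)[of t] p(11)[of t] q(1)[of t] da[of t] a k
      by (cases "k + 2 * a \<le> \<bar>t\<bar>") (auto simp: slow_trunc_def)
    show "- a \<le> slow_trunc \<delta> k a t" if "t \<le> 0"
      using that p(7)[of t] mult_nonneg_nonpos[OF less_imp_le[OF \<delta>(1)] q(11)[of t]] by (simp add: slow_trunc_def)
  qed
  show "\<bar>slow_trunc \<delta> k a t\<bar> \<le> a" using sgn a by (cases "t \<ge> 0") auto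
  show "0 \<le> t * slow_trunc \<delta> k a t"
    using sgn by (cases "t \<ge> 0") (auto simp: zero_le_mult_iff)
  show "slow_trunc \<delta> k a t = 0" if "k + 2 * a + 2 * (a / \<delta>) \<le> \<bar>t\<bar>"
  proof -
    have "k + 2 * a \<le> \<bar>t\<bar>" using that a2 by linarith
    then show ?thesis using p(3)[of t] q(3)[OF that] \<delta> by (simp add: slow_trunc_def)
  qed
  show "\<bar>slow_trunc' \<delta> k a s - slow_trunc' \<delta> k a t\<bar> \<le> (8 / a + \<delta> * (8 / (a / \<delta>))) * \<bar>s - t\<bar>"
  proof -
    have "\<bar>slow_trunc' \<delta> k a s - slow_trunc' \<delta> k a t\<bar> \<le> \<bar>trunc' k a s - trunc' k a t\<bar>
        + \<delta> * \<bar>trunc' (k + 2 * a) (a / \<delta>) s - trunc' (k + 2 * a) (a / \<delta>) t\<bar>"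
    proof -
      have "slow_trunc' \<delta> k a s - slow_trunc' \<delta> k a t = (trunc' k a s - trunc' k a t)
        - \<delta> * (trunc' (k + 2 * a) (a / \<delta>) s - trunc' (k + 2 * a) (a / \<delta>) t)"
        by (simp add: slow_trunc'_def algebra_simps)
      also have "\<bar>\<dots>\<bar> \<le> \<bar>trunc' k a s - trunc' k a t\<bar> + \<bar>\<delta> * (trunc' (k + 2 * a) (a / \<delta>) s - trunc' (k + 2 * a) (a / \<delta>) t)\<bar>"
        by (rule abs_triangle_ineq4)
      finally show ?thesis using \<delta> by (simp add: abs_mult)
    qed
    also have "\<dots> \<le> 8 / a * \<bar>s - t\<bar> + \<delta> * (8 / (a / \<delta>) * \<bar>s - t\<bar>)"
      using \<delta> by (intro add_mono mult_left_mono p(9) q(9)) auto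
    finally show ?thesis by (simp add: algebra_simps)
  qed
qed

section \<open>Energy and decay estimates for a weak solution\<close>

lemma (in finite_measure) integrable_of_powr:
  fixes f :: "'a \<Rightarrow> real" and p :: real
  assumes "f \<in> borel_measurable M" "integrable M (\<lambda>x. \<bar>f x\<bar> powr p)" "p \<ge> 1"
  shows "integrable M f"
proof (rule Bochner_Integration.integrable_bound)
  show "integrable M (\<lambda>x. 1 + \<bar>f x\<bar> powr p)" using assms(2) by simp
  have "t \<le> 1 + t powr p" if "t \<ge> 0" for t :: real
  proof (cases "t \<le> 1")
    case False
    then have "t powr 1 \<le> t powr p" using assms(3) by (intro powr_mono) auto
    then show ?thesis using that by simp
  qed (simp add: add_increasing2)
  then show "AE x in M. norm (f x) \<le> norm (1 + \<bar>f x\<bar> powr p)" by simp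
qed (use assms in auto)

lemma integrable_mult_AE_bounded:
  fixes f g :: "'a \<Rightarrow> real"
  assumes "integrable M g" "f \<in> borel_measurable M" "AE x in M. \<bar>f x\<bar> \<le> B"
  shows "integrable M (\<lambda>x. f x * g x)"
proof (rule Bochner_Integration.integrable_bound)
  show "integrable M (\<lambda>x. B * \<bar>g x\<bar>)" using assms(1) by simp
  show "AE x in M. norm (f x * g x) \<le> norm (B * \<bar>g x\<bar>)"
    using assms(3)
  proof eventually_elim
    case (elim x)
    then have "\<bar>f x\<bar> * \<bar>g x\<bar> \<le> \<bar>B\<bar> * \<bar>g x\<bar>" by (intro mult_right_mono) auto
    then show ?case by (simp add: abs_mult)
  qed
qed (use assms in auto)

text \<open>Of \<phi> only integrability is assumed here, and it enters the estimates only through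
  its integrals \<open>F\<close> over superlevel sets; the Orlicz norm is brought in later to bound
  these.\<close>

locale elliptic_solution =
  fixes \<Omega> :: "(real^'n::finite) set" and a :: "'n \<Rightarrow> 'n \<Rightarrow> real^'n \<Rightarrow> real"
    and c \<phi> u :: "real^'n \<Rightarrow> real" and \<epsilon> :: real
  assumes card: "CARD('n) \<ge> 3" and open_dom: "open \<Omega>" and bounded_dom: "bounded \<Omega>" and \<epsilon>: "\<epsilon> > 0"
    and a: "\<And>i j. a i j \<in> Linf_on \<Omega>" and c: "c \<in> Lp_on (real CARD('n) / 2) \<Omega>"
    and c_nonneg: "AE x in lebesgue_on \<Omega>. c x \<ge> 0"
    and elliptic: "uniformly_elliptic \<Omega> a \<epsilon>"
    and solution: "W12_weak_solution \<Omega> a c \<phi> u"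
    and \<phi>: "integrable (lebesgue_on \<Omega>) \<phi>"
begin

abbreviation "M \<equiv> lebesgue_on \<Omega>"

definition g :: "'n \<Rightarrow> real^'n \<Rightarrow> real" where
  "g i = weak_partial \<Omega> i u"

definition R :: "real^'n \<Rightarrow> real" where
  "R x = (\<Sum>i\<in>UNIV. \<Sum>j\<in>UNIV. a i j x * g i x * g j x)"

definition \<mu> :: "real \<Rightarrow> real" where
  "\<mu> k = measure M {x \<in> \<Omega>. \<bar>u x\<bar> > k}"

definition F :: "real \<Rightarrow> real" where
  "F k = (\<integral>x. \<bar>\<phi> x\<bar> * indicator {x. \<bar>u x\<bar> > k} x \<partial>M)"

sublocale finite_measure M
  using open_dom bounded_dom by (rule finite_measure_lebesgue_on)

lemma space_M: "space M = \<Omega>"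
  by (simp add: space_restrict_space)

lemma u_gradient: "weak_gradient \<Omega> u g"
  using W12_weak_gradient[OF open_dom] solution unfolding W12_weak_solution_def g_def[abs_def] by blast

lemma measurables [measurable]: "u \<in> borel_measurable M" "g i \<in> borel_measurable M" "c \<in> borel_measurable M"
  "\<phi> \<in> borel_measurable M" "a i j \<in> borel_measurable M"
  using weak_gradientD[OF u_gradient] c \<phi> a[of i j] by (auto simp: Lp_on_def Linf_on_def)

lemma c_integrable: "integrable M c"
  using c card by (intro integrable_of_powr[of c "real CARD('n) / 2"]) (auto simp: Lp_on_def)

lemma g_mult_integrable: "integrable M (\<lambda>x. g i x * g j x)"
  by (rule L2_mult_integrable[OF weak_gradientD(2)[OF u_gradient] weak_gradientD(2)[OF u_gradient]])

lemma R_integrable: "integrable M R"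
proof -
  have "integrable M (\<lambda>x. a i j x * (g i x * g j x))" for i j
  proof -
    obtain K where "AE x in M. \<bar>a i j x\<bar> \<le> K" using a[of i j] by (auto simp: Linf_on_def)
    then show ?thesis by (rule integrable_mult_AE_bounded[OF g_mult_integrable measurables(5)])
  qed
  then show ?thesis unfolding R_def[abs_def] mult.assoc by (intro Bochner_Integration.integrable_sum)
qed

lemma R_elliptic: "AE x in M. \<epsilon> * (\<Sum>i\<in>UNIV. (g i x)\<^sup>2) \<le> R x"
  using elliptic unfolding uniformly_elliptic_def
proof eventually_elim
  case (elim x)
  have "(norm (\<chi> i. g i x))\<^sup>2 = (\<Sum>i\<in>UNIV. (g i x)\<^sup>2)"
    by (simp add: norm_vec_def L2_set_def sum_nonneg)
  with elim[rule_format, of "\<chi> i. g i x"] show ?case by (simp add: R_def)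
qed

text \<open>Testing with v = \<open>slow_trunc \<delta> k h\<close> composed with u, the zero order
  term has the sign of c u v, which is nonnegative, and may be dropped. The right side is at most h
  F(k) because |v| \<le> h and v = 0 where |u| \<le> k. The descending part of v costs at most
  \<delta> times the full energy, which vanishes as \<delta> tends to 0.\<close>

lemma energy:
  assumes w: "(\<lambda>x. max (\<bar>u x\<bar> - s) 0) \<in> W12_0 \<Omega>" and k: "s < k" "0 \<le> k" and h: "h > 0"
  shows "\<epsilon> * (\<integral>x. trunc' k h (u x) * (\<Sum>i\<in>UNIV. (g i x)\<^sup>2) \<partial>M) \<le> h * F k"
proof -
  note tp = trunc_props[OF h k(2)]
  have R0: "AE x in M. 0 \<le> R x"
    using R_elliptic
  proof eventually_elim
    case (elim x)
    have "0 \<le> \<epsilon> * (\<Sum>i\<in>UNIV. (g i x)\<^sup>2)" using \<epsilon> by (intro mult_nonneg_nonneg sum_nonneg) auto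
    then show ?case using elim by (rule order_trans)
  qed
  have tc: "continuous_on UNIV (trunc' k h)" by (rule lipschitz_continuous[OF tp(9)])
  have tm [measurable]: "trunc' k h \<in> borel_measurable borel"
    using tc by (rule borel_measurable_continuous_onI)
  have tum: "(\<lambda>x. trunc' k h (u x)) \<in> borel_measurable M"
    using measurable_compose[OF measurables(1) tm] .
  have tR: "integrable M (\<lambda>x. trunc' k h (u x) * R x)"
    by (rule integrable_mult_AE_bounded[OF R_integrable tum, of 1]) (use tp(5,6) in \<open>simp add: abs_of_nonneg\<close>)
  have Fi: "integrable M (\<lambda>x. \<bar>\<phi> x\<bar> * indicator {x. \<bar>u x\<bar> > k} x)"
    by (rule Bochner_Integration.integrable_bound[OF \<phi>]) (auto simp: indicator_def)
  have approx: "(\<integral>x. trunc' k h (u x) * R x \<partial>M) \<le> h * F k + \<delta> * (\<integral>x. R x \<partial>M)" if \<delta>: "0 < \<delta>" "\<delta> < 1" for \<delta>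
  proof -
    define H where "H = slow_trunc \<delta> k h"
    define H' where "H' = slow_trunc' \<delta> k h"
    note sp = slow_trunc_props[OF h k(2) \<delta>, folded H_def H'_def]
    note v = truncation_W12_0[OF open_dom bounded_dom u_gradient w k(1) sp(1,4,6,9,2,3) k(2)]
    define v where "v x = H (u x)" for x
    have v0: "v \<in> W12_0 \<Omega>" and vg: "weak_gradient \<Omega> v (\<lambda>i x. H' (u x) * g i x)"
      using v by (simp_all add: v_def[abs_def])
    have Hm: "H \<in> borel_measurable borel" "H' \<in> borel_measurable borel"
      using lipschitz_continuous[OF bounded_derivative_lipschitz[OF sp(1,4)]] lipschitz_continuous[OF sp(9)]
      by (auto intro: borel_measurable_continuous_onI)
    have [measurable]: "v \<in> borel_measurable M" "(\<lambda>x. H' (u x)) \<in> borel_measurable M"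
      unfolding v_def using measurable_compose[OF measurables(1)] Hm by auto
    have [measurable]: "weak_partial \<Omega> j v \<in> borel_measurable M" for j
      using weak_partial_L2(2)[OF open_dom weak_gradientD(3,2)[OF vg]] by auto
    \<comment> \<open>The weak formulation contains the arbitrarily chosen derivative of v; it is
      replaced by the chain rule formula outside one null set for all j.\<close>
    have "AE x in M. \<forall>j\<in>UNIV. weak_partial \<Omega> j v x = H' (u x) * g j x"
      using weak_partial_L2(1)[OF open_dom weak_gradientD(3,2)[OF vg]] by (intro AE_finite_allI) auto
    then have ae: "AE x in M. (\<Sum>i\<in>UNIV. \<Sum>j\<in>UNIV. a i j x * g i x * weak_partial \<Omega> j v x) + c x * u x * v x
        = H' (u x) * R x + c x * u x * v x"
      by eventually_elim (simp add: R_def sum_distrib_left mult_ac)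
    have "(\<integral>x. (\<Sum>i\<in>UNIV. \<Sum>j\<in>UNIV. a i j x * g i x * weak_partial \<Omega> j v x) + c x * u x * v x \<partial>M)
        = (\<integral>x. \<phi> x * v x \<partial>M)"
      using solution v0 unfolding W12_weak_solution_def g_def by blast
    moreover have "(\<integral>x. (\<Sum>i\<in>UNIV. \<Sum>j\<in>UNIV. a i j x * g i x * weak_partial \<Omega> j v x) + c x * u x * v x \<partial>M)
        = (\<integral>x. H' (u x) * R x + c x * u x * v x \<partial>M)"
      using ae R_integrable by (intro integral_cong_AE) (measurable, auto)
    ultimately have eq: "(\<integral>x. H' (u x) * R x + c x * u x * v x \<partial>M) = (\<integral>x. \<phi> x * v x \<partial>M)" by simp
    have HR: "integrable M (\<lambda>x. H' (u x) * R x)"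
      by (rule integrable_mult_AE_bounded[OF R_integrable _, of _ 2]) (use sp(4) in auto)
    \<comment> \<open>B is where the slow truncation has returned to 0; below it |u| < B and |v|
      \<le> h, so c alone has to be integrable.\<close>
    have cuv: "integrable M (\<lambda>x. c x * u x * v x)"
    proof -
      define B where "B = k + 2 * h + 2 * (h / \<delta>)"
      have B: "B \<ge> 0" using h k \<delta> by (simp add: B_def)
      have "\<bar>u x * v x\<bar> \<le> B * h" for x
      proof (cases "B \<le> \<bar>u x\<bar>")
        case True
        then show ?thesis using sp(8)[of "u x"] B h by (simp add: B_def v_def)
      next
        case False
        then show ?thesis unfolding abs_mult v_def using sp(6)[of "u x"] by (intro mult_mono) auto
      qed
      then have "integrable M (\<lambda>x. (u x * v x) * c x)"
        by (intro integrable_mult_AE_bounded[OF c_integrable, of _ "B * h"]) auto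
      then show ?thesis by (simp add: mult_ac)
    qed
    have cuv0: "0 \<le> (\<integral>x. c x * u x * v x \<partial>M)"
    proof (rule integral_nonneg_AE)
      show "AE x in M. 0 \<le> c x * u x * v x"
        using c_nonneg by eventually_elim (use sp(7) in \<open>auto simp: v_def mult.assoc intro!: mult_nonneg_nonneg\<close>)
    qed
    have "(\<integral>x. H' (u x) * R x \<partial>M) \<le> (\<integral>x. \<phi> x * v x \<partial>M)"
      using eq HR cuv cuv0 by simp
    also have "\<dots> \<le> (\<integral>x. h * (\<bar>\<phi> x\<bar> * indicator {x. \<bar>u x\<bar> > k} x) \<partial>M)"
    proof (rule integral_mono')
      show "integrable M (\<lambda>x. h * (\<bar>\<phi> x\<bar> * indicator {x. \<bar>u x\<bar> > k} x))" using Fi by simp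
      show "\<phi> x * v x \<le> h * (\<bar>\<phi> x\<bar> * indicator {x. \<bar>u x\<bar> > k} x)" for x
      proof (cases "\<bar>u x\<bar> > k")
        case True
        have "\<phi> x * v x \<le> \<bar>\<phi> x\<bar> * \<bar>v x\<bar>" by (metis abs_ge_self abs_mult)
        also have "\<dots> \<le> \<bar>\<phi> x\<bar> * h" using sp(6)[of "u x"] by (intro mult_left_mono) (auto simp: v_def)
        finally show ?thesis using True by (simp add: mult.commute)
      qed (use sp(2)[of "u x"] h in \<open>auto simp: v_def\<close>)
    qed (use h in auto)
    also have "\<dots> = h * F k" by (simp add: F_def)
    finally have "(\<integral>x. H' (u x) * R x \<partial>M) \<le> h * F k" .
    \<comment> \<open>Nonnegativity of R turns the lower bound on the slope of the test function
      into a bound under the integral.\<close>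
    moreover have "(\<integral>x. trunc' k h (u x) * R x - \<delta> * R x \<partial>M) \<le> (\<integral>x. H' (u x) * R x \<partial>M)"
    proof (rule integral_mono_AE)
      show "AE x in M. trunc' k h (u x) * R x - \<delta> * R x \<le> H' (u x) * R x"
        using R0 by eventually_elim (use sp(5) in \<open>auto simp flip: left_diff_distrib intro!: mult_right_mono\<close>)
    qed (use tR R_integrable HR in auto)
    ultimately show ?thesis using tR R_integrable by simp
  qed
  have "(\<integral>x. trunc' k h (u x) * R x \<partial>M) \<le> h * F k"
  proof (rule LIMSEQ_le_const)
    have "(\<lambda>m. h * F k + inverse (real (Suc m)) / 2 * (\<integral>x. R x \<partial>M)) \<longlonglongrightarrow> h * F k + 0 / 2 * (\<integral>x. R x \<partial>M)"
      by (intro tendsto_intros LIMSEQ_inverse_real_of_nat) simp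
    then show "(\<lambda>m. h * F k + inverse (real (Suc m)) / 2 * (\<integral>x. R x \<partial>M)) \<longlonglongrightarrow> h * F k" by simp
    show "\<exists>N. \<forall>m\<ge>N. (\<integral>x. trunc' k h (u x) * R x \<partial>M) \<le> h * F k + inverse (real (Suc m)) / 2 * (\<integral>x. R x \<partial>M)"
      by (intro exI allI impI approx) (auto simp: field_simps)
  qed
  moreover have "\<epsilon> * (\<integral>x. trunc' k h (u x) * (\<Sum>i\<in>UNIV. (g i x)\<^sup>2) \<partial>M) \<le> (\<integral>x. trunc' k h (u x) * R x \<partial>M)"
  proof -
    have "(\<integral>x. \<epsilon> * (trunc' k h (u x) * (\<Sum>i\<in>UNIV. (g i x)\<^sup>2)) \<partial>M) \<le> (\<integral>x. trunc' k h (u x) * R x \<partial>M)"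
    proof (rule integral_mono_AE'[OF tR])
      show "AE x in M. \<epsilon> * (trunc' k h (u x) * (\<Sum>i\<in>UNIV. (g i x)\<^sup>2)) \<le> trunc' k h (u x) * R x"
        using R_elliptic
      proof eventually_elim
        case (elim x)
        from mult_left_mono[OF elim tp(5)[of "u x"]] show ?case by (simp add: mult_ac)
      qed
      show "AE x in M. 0 \<le> trunc' k h (u x) * R x"
        using R0 by eventually_elim (use tp(5) in auto)
    qed
    then show ?thesis by simp
  qed
  ultimately show ?thesis by linarith
qed

text \<open>The gradient of the truncation lives on A(k), so Cauchy-Schwarz against the indicator of
  A(k) yields the factor \<mu>(k) beside the energy. The weak-type Sobolev inequality is applied to
  the truncation itself, which has modulus h on A(k + 2h).\<close>

lemma decay:
  assumes w: "(\<lambda>x. max (\<bar>u x\<bar> - s) 0) \<in> W12_0 \<Omega>" and k: "s < k" "0 \<le> k" and h: "h > 0"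
  shows "(sqrt h / 2) ^ CARD('n) * \<mu> (k + 2 * h) ^ (CARD('n) - 1) \<le> sqrt (\<mu> k * F k / \<epsilon>) ^ CARD('n)"
proof -
  note tp = trunc_props[OF h k(2)]
  let ?N = "CARD('n)"
  define X where "X = \<mu> k * F k / \<epsilon>"
  have F0: "F k \<ge> 0" and \<mu>0: "\<mu> k \<ge> 0" by (auto simp: F_def \<mu>_def)
  have tB: "\<bar>trunc' k h t\<bar> \<le> 1" for t using tp(5,6)[of t] by simp
  note v = truncation_W12_0[OF open_dom bounded_dom u_gradient w k(1) trunc_has_derivative[OF h] tB tp(7,9,1,2) k(2)]
  note vL = weak_gradientD(2)[OF v(2)]
  have tm: "trunc' k h \<in> borel_measurable borel"
    using lipschitz_continuous[OF tp(9)] by (rule borel_measurable_continuous_onI)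
  have [measurable]: "(\<lambda>x. trunc' k h (u x)) \<in> borel_measurable M"
    using measurable_compose[OF measurables(1) tm] .
  have grad: "(\<integral>x. \<bar>trunc' k h (u x) * g i x\<bar> \<partial>M) \<le> sqrt (h * X)" for i
  proof -
    define A where "A = {x \<in> \<Omega>. \<bar>u x\<bar> > k}"
    have A [measurable]: "A \<in> sets M"
    proof -
      have "{x \<in> space M. \<bar>u x\<bar> > k} \<in> sets M" by measurable
      then show ?thesis by (simp add: A_def space_M)
    qed
    have 1: "(\<lambda>x. indicator A x :: real) \<in> L2 M"
      by (rule L2_bounded[of _ 1]) (auto simp: indicator_def)
    have 2: "(\<lambda>x. \<bar>trunc' k h (u x) * g i x\<bar>) \<in> L2 M"
      by (rule L2_bound[OF vL[of i], of _ 1]) auto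
    have "(\<integral>x. \<bar>trunc' k h (u x) * g i x\<bar> \<partial>M) = (\<integral>x. indicator A x * \<bar>trunc' k h (u x) * g i x\<bar> \<partial>M)"
      using tp(2) by (intro Bochner_Integration.integral_cong) (auto simp: A_def indicator_def space_M not_less)
    also have "\<dots> \<le> nrm M (indicator A) * nrm M (\<lambda>x. \<bar>trunc' k h (u x) * g i x\<bar>)"
      using Cauchy_Schwarz_L2[OF 1 2] by simp
    also have "nrm M (indicator A) = sqrt (\<mu> k)"
    proof -
      have "(indicator A x :: real)\<^sup>2 = indicator A x" for x by (simp add: indicator_def)
      moreover have "A \<inter> \<Omega> = A" by (auto simp: A_def)
      ultimately show ?thesis using A by (simp add: nrm_def \<mu>_def space_M flip: A_def)
    qed
    also have "nrm M (\<lambda>x. \<bar>trunc' k h (u x) * g i x\<bar>) \<le> sqrt (h * F k / \<epsilon>)"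
      unfolding nrm_def
    proof (rule real_sqrt_le_mono)
      have gi: "integrable M (\<lambda>x. trunc' k h (u x) * (\<Sum>i\<in>UNIV. (g i x)\<^sup>2))"
        by (rule integrable_mult_AE_bounded[of _ _ _ 1])
          (use tB g_mult_integrable in \<open>auto simp: power2_eq_square\<close>)
      have "(\<integral>x. \<bar>trunc' k h (u x) * g i x\<bar>\<^sup>2 \<partial>M) \<le> (\<integral>x. trunc' k h (u x) * (\<Sum>i\<in>UNIV. (g i x)\<^sup>2) \<partial>M)"
      proof (rule integral_mono'[OF gi])
        fix x
        \<comment> \<open>The hat takes values in [0, 1], so its square may be replaced by the hat,
          which is the weight in the energy estimate.\<close>
        have "(trunc' k h (u x))\<^sup>2 \<le> trunc' k h (u x)"
          using mult_left_mono[OF tp(6)[of "u x"] tp(5)[of "u x"]] by (simp add: power2_eq_square)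
        moreover have "(g i x)\<^sup>2 \<le> (\<Sum>i\<in>UNIV. (g i x)\<^sup>2)" by (rule member_le_sum) auto
        ultimately show "\<bar>trunc' k h (u x) * g i x\<bar>\<^sup>2 \<le> trunc' k h (u x) * (\<Sum>i\<in>UNIV. (g i x)\<^sup>2)"
          unfolding power2_abs power_mult_distrib by (intro mult_mono tp(5)) auto
        show "0 \<le> trunc' k h (u x) * (\<Sum>i\<in>UNIV. (g i x)\<^sup>2)"
          by (intro mult_nonneg_nonneg tp(5) sum_nonneg) auto
      qed
      also have "\<dots> \<le> h * F k / \<epsilon>" using energy[OF w k h] \<epsilon> by (simp add: field_simps)
      finally show "(\<integral>x. \<bar>trunc' k h (u x) * g i x\<bar>\<^sup>2 \<partial>M) \<le> h * F k / \<epsilon>" .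
    qed
    finally have "(\<integral>x. \<bar>trunc' k h (u x) * g i x\<bar> \<partial>M) \<le> sqrt (\<mu> k) * sqrt (h * F k / \<epsilon>)"
      using \<mu>0 by (simp add: mult_left_mono)
    also have "\<dots> = sqrt (h * X)" by (simp add: X_def mult_ac flip: real_sqrt_mult)
    finally show ?thesis .
  qed
  \<comment> \<open>The truncation reaches modulus h but never exceeds it, while the Sobolev
    inequality counts points strictly above a level; hence the level h / 2.\<close>
  have sub: "\<mu> (k + 2 * h) \<le> measure M {x \<in> \<Omega>. \<bar>trunc k h (u x)\<bar> > h / 2}"
    unfolding \<mu>_def
  proof (rule finite_measure_mono)
    show "{x \<in> \<Omega>. \<bar>u x\<bar> > k + 2 * h} \<subseteq> {x \<in> \<Omega>. \<bar>trunc k h (u x)\<bar> > h / 2}"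
      using tp(3) h by (auto split: if_splits)
    have "trunc k h \<in> borel_measurable borel"
      using lipschitz_continuous[OF bounded_derivative_lipschitz[OF trunc_has_derivative[OF h] tB]]
      by (rule borel_measurable_continuous_onI)
    from measurable_compose[OF measurables(1) this] have [measurable]: "(\<lambda>x. trunc k h (u x)) \<in> borel_measurable M" .
    have "{x \<in> space M. \<bar>trunc k h (u x)\<bar> > h / 2} \<in> sets M" by measurable
    then show "{x \<in> \<Omega>. \<bar>trunc k h (u x)\<bar> > h / 2} \<in> sets M" by (simp add: space_M)
  qed
  have "(h / 2) ^ ?N * \<mu> (k + 2 * h) ^ (?N - 1)
      \<le> (h / 2) ^ ?N * measure M {x \<in> \<Omega>. \<bar>trunc k h (u x)\<bar> > h / 2} ^ (?N - 1)"
    using h sub by (intro mult_left_mono power_mono) (auto simp: \<mu>_def)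
  also have "\<dots> \<le> (\<Prod>i\<in>(UNIV::'n set). \<integral>x. \<bar>trunc' k h (u x) * g i x\<bar> \<partial>M)"
    by (rule Sobolev_weak_type[OF open_dom bounded_dom v]) (use h card in auto)
  also have "\<dots> \<le> (\<Prod>i\<in>(UNIV::'n set). sqrt (h * X))"
    using grad by (intro prod_mono) auto
  also have "\<dots> = sqrt h ^ ?N * sqrt X ^ ?N" by (simp add: real_sqrt_mult power_mult_distrib)
  finally have "(h / 2) ^ ?N * \<mu> (k + 2 * h) ^ (?N - 1) \<le> sqrt h ^ ?N * sqrt X ^ ?N" .
  \<comment> \<open>The energy carries only sqrt h per derivative against h / 2 from the level; one
    factor sqrt h cancels and sqrt h / 2 is left.\<close>
  moreover have "(h / 2) ^ ?N = sqrt h ^ ?N * (sqrt h / 2) ^ ?N"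
    using h by (simp flip: power_mult_distrib)
  ultimately have "sqrt h ^ ?N * ((sqrt h / 2) ^ ?N * \<mu> (k + 2 * h) ^ (?N - 1)) \<le> sqrt h ^ ?N * sqrt X ^ ?N"
    by (simp add: mult.assoc)
  then show ?thesis using h by (simp add: X_def)
qed

end

section \<open>The Orlicz norm and the iteration\<close>

lemma Phi_nonneg: "0 \<le> Phi p q t"
  by (simp add: Phi_def)

text \<open>The quotient \<open>Phi p q t\<close> / t is nondecreasing, so t > T implies t \<le>
  \<open>Phi p q t\<close> / (T^(p-1) ln(1 + T)^q), and otherwise t \<le> T. Applied to |\<phi>| /
  lam, the first alternative integrates to at most the reciprocal of that denominator, the second to
  T times the measure of A. The height T is left free for the iteration.\<close>

lemma LlogL_integral_bound:
  fixes \<Omega> :: "'a::euclidean_space set"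
  assumes \<Omega>: "open \<Omega>" "bounded \<Omega>" and \<phi>: "\<phi> \<in> borel_measurable (lebesgue_on \<Omega>)"
    and lam: "lam \<in> LlogL_admissible p q \<Omega> \<phi>" and p: "p \<ge> 1" and q: "q \<ge> 0"
  shows "integrable (lebesgue_on \<Omega>) \<phi>"
    and "A \<in> sets (lebesgue_on \<Omega>) \<Longrightarrow> T > 0 \<Longrightarrow> (\<integral>x. \<bar>\<phi> x\<bar> * indicator A x \<partial>lebesgue_on \<Omega>)
      \<le> lam * (T * measure (lebesgue_on \<Omega>) A + T powr (1 - p) * ln (1 + T) powr (- q))"
proof -
  let ?M = "lebesgue_on \<Omega>"
  interpret finite_measure ?M using \<Omega> by (rule finite_measure_lebesgue_on)
  note [measurable] = \<phi>
  have l: "lam > 0" and nn: "(\<integral>\<^sup>+x. ennreal (Phi p q (\<bar>\<phi> x\<bar> / lam)) \<partial>?M) \<le> 1"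
    using lam by (auto simp: LlogL_admissible_def)
  have Pm [measurable]: "(\<lambda>x. Phi p q (\<bar>\<phi> x\<bar> / lam)) \<in> borel_measurable ?M"
    unfolding Phi_def by measurable
  have Pi: "integrable ?M (\<lambda>x. Phi p q (\<bar>\<phi> x\<bar> / lam))"
    using nn by (intro integrableI_bounded) (auto simp: Phi_nonneg intro: le_less_trans)
  have P1: "(\<integral>x. Phi p q (\<bar>\<phi> x\<bar> / lam) \<partial>?M) \<le> 1"
  proof -
    have "ennreal (\<integral>x. Phi p q (\<bar>\<phi> x\<bar> / lam) \<partial>?M) \<le> 1"
      using nn nn_integral_eq_integral[OF Pi] by (simp add: Phi_nonneg)
    then show ?thesis by simp
  qed
  have pt: "t \<le> T + T powr (1 - p) * ln (1 + T) powr (- q) * Phi p q t" if "T > 0" "t \<ge> 0" for T t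
  proof (cases "t \<le> T")
    case True
    have "0 \<le> T powr (1 - p) * ln (1 + T) powr (- q) * Phi p q t"
      by (intro mult_nonneg_nonneg Phi_nonneg) auto
    then show ?thesis using True by linarith
  next
    case False
    have T: "ln (1 + T) > 0" using that by simp
    have "T powr (p - 1) \<le> t powr (p - 1)" using False that p by (intro powr_mono2) auto
    moreover have "ln (1 + T) powr q \<le> ln (1 + t) powr q" using False that q by (intro powr_mono2) auto
    ultimately have "T powr (p - 1) * ln (1 + T) powr q \<le> t powr (p - 1) * ln (1 + t) powr q"
      by (intro mult_mono) auto
    then have "t * (T powr (p - 1) * ln (1 + T) powr q) \<le> t * (t powr (p - 1) * ln (1 + t) powr q)"
      using that by (intro mult_left_mono) auto
    also have "\<dots> = Phi p q t"
      using False that by (simp add: Phi_def powr_diff)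
    finally have "T powr (1 - p) * ln (1 + T) powr (- q) * (t * (T powr (p - 1) * ln (1 + T) powr q))
        \<le> T powr (1 - p) * ln (1 + T) powr (- q) * Phi p q t"
      by (intro mult_left_mono) auto
    moreover have "T powr (1 - p) * ln (1 + T) powr (- q) * (t * (T powr (p - 1) * ln (1 + T) powr q))
        = t * (T powr (1 - p) * T powr (p - 1)) * (ln (1 + T) powr (- q) * ln (1 + T) powr q)"
      by (simp add: mult_ac)
    moreover have "T powr (1 - p) * T powr (p - 1) = 1" "ln (1 + T) powr (- q) * ln (1 + T) powr q = 1"
      using that T by (simp_all flip: powr_add)
    ultimately show ?thesis using that by simp
  qed
  \<comment> \<open>The pointwise split at height 1 dominates \<phi> by a constant plus a multiple
    of the integrable \<open>Phi\<close> term.\<close>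
  show i: "integrable ?M \<phi>"
  proof (rule Bochner_Integration.integrable_bound)
    show "integrable ?M (\<lambda>x. lam * (1 + 1 powr (1 - p) * ln (1 + 1) powr (- q) * Phi p q (\<bar>\<phi> x\<bar> / lam)))"
      using Pi by (intro integrable_mult_right Bochner_Integration.integrable_add) auto
    have "\<bar>\<phi> x\<bar> \<le> lam * (1 + 1 powr (1 - p) * ln (1 + 1) powr (- q) * Phi p q (\<bar>\<phi> x\<bar> / lam))" for x
      using mult_left_mono[OF pt[of 1 "\<bar>\<phi> x\<bar> / lam"], of lam] l by simp
    then show "AE x in ?M. norm (\<phi> x) \<le> norm (lam * (1 + 1 powr (1 - p) * ln (1 + 1) powr (- q) * Phi p q (\<bar>\<phi> x\<bar> / lam)))"
      by (intro AE_I2) (metis abs_ge_self order_trans real_norm_def)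
  qed measurable
  assume A: "A \<in> sets ?M" and T: "T > 0"
  define L where "L = T powr (1 - p) * ln (1 + T) powr (- q)"
  have L: "L \<ge> 0" by (simp add: L_def)
  have "(\<integral>x. \<bar>\<phi> x\<bar> * indicator A x \<partial>?M) \<le> (\<integral>x. lam * (T * indicator A x + L * Phi p q (\<bar>\<phi> x\<bar> / lam)) \<partial>?M)"
  proof (rule integral_mono')
    show "integrable ?M (\<lambda>x. lam * (T * indicator A x + L * Phi p q (\<bar>\<phi> x\<bar> / lam)))"
      using A Pi by (intro integrable_mult_right Bochner_Integration.integrable_add)
        (auto intro!: integrable_mult_right integrable_real_indicator simp: less_top[symmetric])
    show "\<bar>\<phi> x\<bar> * indicator A x \<le> lam * (T * indicator A x + L * Phi p q (\<bar>\<phi> x\<bar> / lam))" for x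
      using mult_left_mono[OF pt[OF T, of "\<bar>\<phi> x\<bar> / lam"], of lam] l L Phi_nonneg[of p q "\<bar>\<phi> x\<bar> / lam"]
      by (auto simp: indicator_def L_def)
    show "0 \<le> lam * (T * indicator A x + L * Phi p q (\<bar>\<phi> x\<bar> / lam))" for x
      using l L T by (intro mult_nonneg_nonneg add_nonneg_nonneg Phi_nonneg) auto
  qed
  also have "\<dots> = lam * (T * measure ?M A + L * (\<integral>x. Phi p q (\<bar>\<phi> x\<bar> / lam) \<partial>?M))"
  proof -
    have "integrable ?M (\<lambda>x. T * indicator A x)" using A
      by (intro integrable_mult_right integrable_real_indicator) (auto simp: less_top[symmetric])
    moreover have "A \<inter> space ?M = A" using sets.sets_into_space[OF A] by auto
    ultimately show ?thesis using Pi by simp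
  qed
  also have "\<dots> \<le> lam * (T * measure ?M A + L * 1)"
    using l L P1 by (intro mult_left_mono add_left_mono) auto
  finally show "(\<integral>x. \<bar>\<phi> x\<bar> * indicator A x \<partial>?M) \<le> lam * (T * measure ?M A + T powr (1 - p) * ln (1 + T) powr (- q))"
    by (simp add: L_def)
qed

text \<open>The argument is the splitting height used at stage j of the iteration. Its logarithm is
  of order j, which converts the logarithmic factor of the Orlicz space into the power
  j^(-q).\<close>

lemma ln_growth:
  fixes \<alpha> :: real
  assumes "\<alpha> > 0"
  shows "\<exists>c>0. \<forall>j\<ge>1::nat. c * real j \<le> ln (1 + exp (real j) * real j powr (- \<alpha>))"
proof -
  have "((\<lambda>x. ln (1 + exp x * x powr (- \<alpha>)) / x) \<longlongrightarrow> 1) at_top"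
    using assms by real_asymp
  then have "((\<lambda>j. ln (1 + exp (real j) * real j powr (- \<alpha>)) / real j) \<longlongrightarrow> 1) sequentially"
    by (rule filterlim_compose[OF _ filterlim_real_sequentially])
  then have "\<forall>\<^sub>F j in sequentially. ln (1 + exp (real j) * real j powr (- \<alpha>)) / real j > 1 / 2"
    by (rule order_tendstoD) simp
  then obtain J where J: "\<And>j. j \<ge> J \<Longrightarrow> ln (1 + exp (real j) * real j powr (- \<alpha>)) / real j > 1 / 2"
    by (auto simp: eventually_sequentially)
  \<comment> \<open>The ratio tends to 1 and so exceeds 1/2 from J on; the finitely many earlier
    ratios are positive and enter through the minimum.\<close>
  define c where "c = Min (insert (1 / 2) ((\<lambda>j. ln (1 + exp (real j) * real j powr (- \<alpha>)) / real j) ` {1..J}))"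
  have "ln (1 + exp (real j) * real j powr (- \<alpha>)) > 0" if "j \<ge> 1" for j
    using that by (intro ln_gt_zero) auto
  then have "c > 0" unfolding c_def by (subst Min_gr_iff) auto
  moreover have "c * real j \<le> ln (1 + exp (real j) * real j powr (- \<alpha>))" if "j \<ge> 1" for j
  proof -
    have "c \<le> ln (1 + exp (real j) * real j powr (- \<alpha>)) / real j"
    proof (cases "j \<le> J")
      case True
      then show ?thesis unfolding c_def using that by (intro Min_le) auto
    next
      case False
      have "c \<le> 1 / 2" unfolding c_def by (intro Min_le) auto
      then show ?thesis using J[of j] False by linarith
    qed
    then show ?thesis using that by (simp add: field_simps)
  qed
  ultimately show ?thesis by blast
qed

text \<open>The equation for h is the condition that the decay estimate, with \<mu>(k) F(k) /
  \<epsilon> replaced by X, becomes an equality at the target value y: then the n-th power of sqrt X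
  is (sqrt h / 2)^n y^(n-1), and the common factor cancels.\<close>

lemma iteration_step:
  fixes h X y m :: real
  assumes n: "n \<ge> 2" and pos: "h > 0" "y > 0" "m \<ge> 0"
    and hX: "h * y powr (2 * real (n - 1) / real n) = 4 * X"
    and le: "(sqrt h / 2) ^ n * m ^ (n - 1) \<le> sqrt X ^ n"
  shows "m \<le> y"
proof -
  have "sqrt X = sqrt h / 2 * y powr (real (n - 1) / real n)"
  proof -
    have "y powr (2 * real (n - 1) / real n) = (y powr (real (n - 1) / real n))\<^sup>2"
      using pos by (simp add: power2_eq_square flip: powr_add)
    then have "X = (sqrt h / 2 * y powr (real (n - 1) / real n))\<^sup>2"
      using hX pos by (simp add: power_mult_distrib power_divide)
    then show ?thesis using pos by simp
  qed
  then have "sqrt X ^ n = (sqrt h / 2) ^ n * (y powr (real (n - 1) / real n)) ^ n"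
    by (simp only: power_mult_distrib)
  also have "(y powr (real (n - 1) / real n)) ^ n = y powr (real (n - 1))"
    using pos n by (simp add: powr_powr flip: powr_realpow)
  also have "\<dots> = y ^ (n - 1)" by (rule powr_realpow[OF pos(2)])
  finally have "(sqrt h / 2) ^ n * m ^ (n - 1) \<le> (sqrt h / 2) ^ n * y ^ (n - 1)" using le by simp
  then have "m ^ (n - 1) \<le> y ^ (n - 1)" using pos by simp
  then show ?thesis using n pos by (simp add: power_mono_iff)
qed

section \<open>The iteration over levels\<close>

context elliptic_solution
begin

lemma \<mu>_antimono: "k \<le> l \<Longrightarrow> \<mu> l \<le> \<mu> k"
proof -
  assume "k \<le> l"
  have "{x \<in> space M. \<bar>u x\<bar> > k} \<in> sets M" by measurable
  then show ?thesis unfolding \<mu>_def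
    using \<open>k \<le> l\<close> by (intro finite_measure_mono) (auto simp: space_M)
qed

text \<open>The levels k j increase by 2 h j, with h j = lam C0 j^(-\<alpha>), and \<mu>(k j) \<le>
  m0 exp(-p j). The constant C0 is what results from solving the equation of
  \<open>iteration_step\<close> for h j; the limit of the levels is finite because \<alpha> = q/p >
  1.\<close>

lemma sup_bound:
  fixes q lam c0 \<kappa> s :: real
  defines "p \<equiv> real CARD('n) / 2"
  defines "\<alpha> \<equiv> q / p"
  defines "m0 \<equiv> (measure M \<Omega> + 1) * exp p"
  defines "C0 \<equiv> 4 * (m0 + c0 powr (- q)) / \<epsilon> * m0 powr (1 - (2 * p - 1) / p) * exp (2 * p - 1)"
  assumes q: "q > p" and lam: "lam \<in> LlogL_admissible p q \<Omega> \<phi>"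
    and c0: "c0 > 0" "\<And>j::nat. j \<ge> 1 \<Longrightarrow> c0 * real j \<le> ln (1 + exp (real j) * real j powr (- \<alpha>))"
    and w: "(\<lambda>x. max (\<bar>u x\<bar> - s) 0) \<in> W12_0 \<Omega>" and \<kappa>: "s < \<kappa>" "0 \<le> \<kappa>"
  shows "AE x in M. \<bar>u x\<bar> \<le> \<kappa> + 2 * C0 * (\<Sum>j. real j powr (- \<alpha>)) * lam"
proof -
  define K where "K = m0 + c0 powr (- q)"
  have p: "p \<ge> 3 / 2" "CARD('n) = 2 * p" using card by (auto simp: p_def)
  have \<alpha>: "\<alpha> > 1" "\<alpha> * p = q" using q p by (auto simp: \<alpha>_def)
  have l: "lam > 0" using lam by (simp add: LlogL_admissible_def)
  have m0: "m0 > 0" by (simp add: m0_def add_nonneg_pos)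
  have K: "K > 0" using m0 by (simp add: K_def add_pos_nonneg)
  have C0: "C0 > 0" using K m0 \<epsilon> by (simp add: C0_def K_def[symmetric])
  have summ: "summable (\<lambda>j. real j powr (- \<alpha>))" using \<alpha>(1) by (simp add: summable_real_powr_iff)
  define h where "h j = lam * C0 * real j powr (- \<alpha>)" for j :: nat
  define y where "y j = m0 * exp (- p * real j)" for j :: nat
  have h: "h j > 0" if "j \<ge> 1" for j using that l C0 by (simp add: h_def)
  have y: "y j > 0" for j using m0 by (simp add: y_def)
  have Fb: "F k \<le> lam * K * exp (- (p - 1) * real j) * real j powr (- \<alpha>)" if k: "\<mu> k \<le> y j" and j: "j \<ge> 1" for k j
  proof -
    \<comment> \<open>This height balances the two terms of the Orlicz estimate: both become
      exp(-(p-1) j) j^(-\<alpha>) up to the constants m0 and c0^(-q), whose sum is K.\<close>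
    define T where "T = exp (real j) * real j powr (- \<alpha>)"
    have T: "T > 0" using j by (simp add: T_def)
    have A: "{x \<in> space M. \<bar>u x\<bar> > k} \<in> sets M" by measurable
    have "F k = (\<integral>x. \<bar>\<phi> x\<bar> * indicator {x \<in> space M. \<bar>u x\<bar> > k} x \<partial>M)"
      unfolding F_def by (intro Bochner_Integration.integral_cong) (auto simp: indicator_def)
    also have "\<dots> \<le> lam * (T * measure M {x \<in> space M. \<bar>u x\<bar> > k} + T powr (1 - p) * ln (1 + T) powr (- q))"
      using p q by (intro LlogL_integral_bound(2)[OF open_dom bounded_dom measurables(4) lam _ _ A T]) auto
    also have "measure M {x \<in> space M. \<bar>u x\<bar> > k} = \<mu> k" by (simp add: \<mu>_def space_M)
    also have "lam * (T * \<mu> k + T powr (1 - p) * ln (1 + T) powr (- q))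
        \<le> lam * (m0 * exp (- (p - 1) * real j) * real j powr (- \<alpha>)
          + c0 powr (- q) * exp (- (p - 1) * real j) * real j powr (- \<alpha>))"
    proof (intro mult_left_mono add_mono)
      have "T * \<mu> k \<le> T * y j" using T k by (intro mult_left_mono) auto
      also have "\<dots> = m0 * (exp (real j) * exp (- p * real j)) * real j powr (- \<alpha>)"
        by (simp add: T_def y_def mult_ac)
      also have "exp (real j) * exp (- p * real j) = exp (- (p - 1) * real j)"
        by (simp add: algebra_simps flip: exp_add)
      finally show "T * \<mu> k \<le> m0 * exp (- (p - 1) * real j) * real j powr (- \<alpha>)" .
      have "ln (1 + T) powr (- q) \<le> (c0 * real j) powr (- q)"
        using c0 j q p by (intro powr_mono2') (auto simp: T_def)
      then have "T powr (1 - p) * ln (1 + T) powr (- q) \<le> T powr (1 - p) * (c0 * real j) powr (- q)"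
        by (intro mult_left_mono) auto
      also have "\<dots> = exp (- (p - 1) * real j) * c0 powr (- q) * (real j powr (- \<alpha> * (1 - p)) * real j powr (- q))"
      proof -
        have "T powr (1 - p) = exp (real j) powr (1 - p) * (real j powr (- \<alpha>)) powr (1 - p)"
          unfolding T_def by (rule powr_mult)
        also have "\<dots> = exp (- (p - 1) * real j) * real j powr (- \<alpha> * (1 - p))"
          by (simp add: powr_powr exp_powr_real algebra_simps)
        finally show ?thesis using c0 by (simp add: powr_mult mult_ac)
      qed
      \<comment> \<open>The exponents add up to -\<alpha> + \<alpha> p - q, and \<alpha> p = q. This
        is the reason for the choice \<alpha> = q/p.\<close>
      also have "real j powr (- \<alpha> * (1 - p)) * real j powr (- q) = real j powr (- \<alpha>)"
        using \<alpha>(2) by (simp add: algebra_simps flip: powr_add)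
      finally show "T powr (1 - p) * ln (1 + T) powr (- q) \<le> c0 powr (- q) * exp (- (p - 1) * real j) * real j powr (- \<alpha>)"
        by (simp add: mult_ac)
    qed (use l in auto)
    also have "\<dots> = lam * K * exp (- (p - 1) * real j) * real j powr (- \<alpha>)" by (simp add: K_def algebra_simps)
    finally show ?thesis .
  qed
  define k where "k j = \<kappa> + 2 * (\<Sum>i=1..<j. h i)" for j :: nat
  have k_ge: "\<kappa> \<le> k j" for j
  proof -
    have "0 \<le> (\<Sum>i=1..<j. h i)" by (auto intro!: sum_nonneg less_imp_le[OF h])
    then show ?thesis by (simp add: k_def)
  qed
  have decay_k: "\<mu> (k j) \<le> y j" if "j \<ge> 1" for j
    using that
  proof (induction j rule: dec_induct)
    case base
    have "\<mu> (k 1) \<le> measure M \<Omega>" unfolding \<mu>_def using space_M by (intro finite_measure_mono) (auto simp: sets.top[of M, unfolded space_M])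
    \<comment> \<open>The factor exp p in m0 cancels at j = 1 and leaves the measure of \<Omega>
      plus 1; the summand 1 makes m0 positive.\<close>
    also have "\<dots> \<le> y 1"
      by (simp add: y_def m0_def mult.assoc flip: exp_add)
    finally show ?case .
  next
    case (step j)
    \<comment> \<open>The induction hypothesis bounds \<mu>(k j) by y j and, through the Orlicz
      estimate, F(k j) by the other factor.\<close>
    define X where "X = y j * (lam * K * exp (- (p - 1) * real j) * real j powr (- \<alpha>)) / \<epsilon>"
    have "\<mu> (k j + 2 * h j) \<le> y (Suc j)"
    proof (rule iteration_step[OF _ h[OF step(1)] y])
      show "CARD('n) \<ge> 2" using card by simp
      show "0 \<le> \<mu> (k j + 2 * h j)" by (simp add: \<mu>_def)
      have F0: "0 \<le> F (k j)" by (simp add: F_def)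
      have \<mu>0: "0 \<le> \<mu> (k j)" by (simp add: \<mu>_def)
      have "\<mu> (k j) * F (k j) / \<epsilon> \<le> X"
        unfolding X_def using Fb[OF step(3,1)] step(3) \<epsilon> F0 y[of j]
        by (intro divide_right_mono mult_mono) auto
      then have "sqrt (\<mu> (k j) * F (k j) / \<epsilon>) ^ CARD('n) \<le> sqrt X ^ CARD('n)"
        using F0 \<mu>0 \<epsilon> by (intro power_mono) auto
      with decay[OF w _ _ h[OF step(1)], of "k j"] k_ge[of j] \<kappa>
      show "(sqrt (h j) / 2) ^ CARD('n) * \<mu> (k j + 2 * h j) ^ (CARD('n) - 1) \<le> sqrt X ^ CARD('n)"
        by linarith
      have e: "2 * real (CARD('n) - 1) / real CARD('n) = (2 * p - 1) / p"
      proof -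
        have "real (CARD('n) - 1) = 2 * p - 1" using p(2) card by (simp add: of_nat_diff)
        then show ?thesis unfolding p(2) by (simp only: mult_divide_mult_cancel_left[of 2])
      qed
      have "y (Suc j) powr ((2 * p - 1) / p) = m0 powr ((2 * p - 1) / p) * exp (- (2 * p - 1) * (real j + 1))"
        unfolding y_def using m0 p by (simp add: powr_mult exp_powr_real field_simps)
      then have "h j * y (Suc j) powr (2 * real (CARD('n) - 1) / real CARD('n))
        = 4 * (lam * K / \<epsilon>) * (m0 powr (1 - (2 * p - 1) / p) * m0 powr ((2 * p - 1) / p))
          * (exp (2 * p - 1) * exp (- (2 * p - 1) * (real j + 1))) * real j powr (- \<alpha>)"
        unfolding e by (simp add: h_def C0_def K_def mult_ac)
      also have "m0 powr (1 - (2 * p - 1) / p) * m0 powr ((2 * p - 1) / p) = m0"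
        using m0 by (simp flip: powr_add)
      \<comment> \<open>The factor exp(2p - 1) in C0 pays for passing from stage j to j + 1; the
        remaining exponent -(2p - 1) j is the sum of the exponents of y j and of the bound on
        F.\<close>
      also have "exp (2 * p - 1) * exp (- (2 * p - 1) * (real j + 1)) = exp (- p * real j) * exp (- (p - 1) * real j)"
        by (simp add: algebra_simps flip: exp_add)
      finally show "h j * y (Suc j) powr (2 * real (CARD('n) - 1) / real CARD('n)) = 4 * X"
        by (simp add: X_def y_def mult_ac)
    qed
    moreover have "k (Suc j) = k j + 2 * h j" using step(1) by (simp add: k_def)
    ultimately show ?case by simp
  qed
  define kinf where "kinf = \<kappa> + 2 * C0 * (\<Sum>j. real j powr (- \<alpha>)) * lam"
  have k_le: "k j \<le> kinf" for j
  proof -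
    \<comment> \<open>The series starts at index 0, where \<open>0 powr (- \<alpha>)\<close> is 0,
      so it is the sum over all j \<ge> 1.\<close>
    have "(\<Sum>i=1..<j. real i powr (- \<alpha>)) \<le> (\<Sum>j. real j powr (- \<alpha>))"
      using summ by (intro sum_le_suminf) auto
    then have "(2 * C0 * lam) * (\<Sum>i=1..<j. real i powr (- \<alpha>)) \<le> (2 * C0 * lam) * (\<Sum>j. real j powr (- \<alpha>))"
      using C0 l by (intro mult_left_mono) auto
    then show ?thesis by (simp add: k_def kinf_def h_def mult_ac flip: sum_distrib_left)
  qed
  have "\<mu> kinf \<le> 0"
  proof (rule LIMSEQ_le_const)
    have "((\<lambda>x. m0 * exp (- p * x)) \<longlongrightarrow> 0) at_top" using p by real_asymp
    then show "y \<longlonglongrightarrow> 0"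
      unfolding y_def[abs_def] by (rule filterlim_compose[OF _ filterlim_real_sequentially])
    show "\<exists>N. \<forall>j\<ge>N. \<mu> kinf \<le> y j"
      using decay_k \<mu>_antimono[OF k_le] by (intro exI[of _ 1]) (auto intro: order_trans)
  qed
  then have "measure M {x \<in> space M. \<bar>u x\<bar> > kinf} = 0"
    by (simp add: \<mu>_def space_M measure_le_0_iff)
  moreover have "{x \<in> space M. \<bar>u x\<bar> > kinf} \<in> sets M" by measurable
  ultimately have "{x \<in> space M. \<bar>u x\<bar> > kinf} \<in> null_sets M"
    by (simp add: null_sets_def emeasure_eq_measure)
  then have "AE x in M. x \<notin> {x \<in> space M. \<bar>u x\<bar> > kinf}" by (rule AE_not_in)
  then show ?thesis using AE_space by eventually_elim (auto simp: kinf_def)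
qed

end

theorem theorem3p4:
  fixes \<Omega> :: "(real^'n::finite) set" and q \<epsilon> :: real
  assumes "CARD('n) \<ge> 3" and "q > real CARD('n) / 2"
    and "domain \<Omega>" and "bounded \<Omega>" and "C1_boundary \<Omega>"
    and "\<epsilon> > 0"
  shows "\<exists>C>0. \<forall>(a :: 'n \<Rightarrow> 'n \<Rightarrow> real^'n \<Rightarrow> real) c \<phi> u.
    (\<forall>i j. a i j \<in> Linf_on \<Omega>) \<longrightarrow>
    c \<in> Lp_on (real CARD('n) / 2) \<Omega> \<longrightarrow>
    \<phi> \<in> LlogL_on (real CARD('n) / 2) q \<Omega> \<longrightarrow>
    (AE x in lebesgue_on \<Omega>. c x \<ge> 0) \<longrightarrow>
    uniformly_elliptic \<Omega> a \<epsilon> \<longrightarrow>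
    W12_weak_solution \<Omega> a c \<phi> u \<longrightarrow>
    Linf_norm \<Omega> u
      \<le> Inf {ereal s | s. s \<ge> 0 \<and> (\<lambda>x. max (\<bar>u x\<bar> - s) 0) \<in> W12_0 \<Omega>}
         + ereal (C * LlogL_norm (real CARD('n) / 2) q \<Omega> \<phi>)"
proof -
  let ?M = "lebesgue_on \<Omega>"
  define p where "p = real CARD('n) / 2"
  define \<alpha> where "\<alpha> = q / p"
  have p: "p > 1" using assms(1) by (simp add: p_def)
  have \<alpha>: "\<alpha> > 1" using p assms(2) by (simp add: \<alpha>_def p_def)
  have \<Omega>: "open \<Omega>" using assms(3) by (simp add: domain_def)
  obtain c0 where c0: "c0 > 0" "\<And>j::nat. j \<ge> 1 \<Longrightarrow> c0 * real j \<le> ln (1 + exp (real j) * real j powr (- \<alpha>))"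
    using ln_growth[of \<alpha>] \<alpha> by auto
  \<comment> \<open>These are the constants of \<open>sup_bound\<close>; they are built from
    \<Omega>, n, q and \<epsilon> alone, since c0 depends only on \<alpha> = q/p.\<close>
  define m0 where "m0 = (measure ?M \<Omega> + 1) * exp p"
  define C0 where "C0 = 4 * (m0 + c0 powr (- q)) / \<epsilon> * m0 powr (1 - (2 * p - 1) / p) * exp (2 * p - 1)"
  define C where "C = 2 * C0 * (\<Sum>j. real j powr (- \<alpha>))"
  have m0: "m0 > 0" by (simp add: m0_def add_nonneg_pos)
  have "C0 > 0" using m0 assms(6) by (simp add: C0_def add_pos_nonneg)
  \<comment> \<open>The term at index 1 is positive, while the one at 0 is not.\<close>
  moreover have "(\<Sum>j. real j powr (- \<alpha>)) > 0"
    using \<alpha> by (intro suminf_pos2[of _ 1]) (auto simp: summable_real_powr_iff)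
  ultimately have C: "C > 0" by (simp add: C_def)
  show ?thesis
  proof (intro exI[of _ C] conjI allI impI C)
    fix a :: "'n \<Rightarrow> 'n \<Rightarrow> real^'n \<Rightarrow> real" and c \<phi> u
    assume H: "\<forall>i j. a i j \<in> Linf_on \<Omega>" "c \<in> Lp_on (real CARD('n) / 2) \<Omega>"
      "\<phi> \<in> LlogL_on (real CARD('n) / 2) q \<Omega>" "AE x in ?M. c x \<ge> 0"
      "uniformly_elliptic \<Omega> a \<epsilon>" "W12_weak_solution \<Omega> a c \<phi> u"
    have meas: "\<phi> \<in> borel_measurable ?M" "LlogL_admissible p q \<Omega> \<phi> \<noteq> {}"
      using H(3) by (auto simp: LlogL_on_def p_def)
    have q0: "q \<ge> 0" using assms(2) p by (simp add: p_def)
    have "integrable ?M \<phi>"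
      using meas(2) LlogL_integral_bound(1)[OF \<Omega> assms(4) meas(1) _ less_imp_le[OF p] q0] by blast
    then interpret elliptic_solution \<Omega> a c \<phi> u \<epsilon>
      using assms H \<Omega> by unfold_locales auto
    have um: "(\<lambda>x. ereal \<bar>u x\<bar>) \<in> borel_measurable ?M" by measurable
    have bound: "Linf_norm \<Omega> u \<le> ereal (s + C * LlogL_norm p q \<Omega> \<phi>)"
      if s: "s \<ge> 0" "(\<lambda>x. max (\<bar>u x\<bar> - s) 0) \<in> W12_0 \<Omega>" for s
    proof (rule ereal_le_epsilon2)
      fix e :: real assume e: "e > 0"
      \<comment> \<open>The infimum in the norm need not be used as an admissible value, and the
        iteration has to start strictly above s. An excess e / (2C) in lam and e / 2 in the level
        add up to e.\<close>
      have "Inf (LlogL_admissible p q \<Omega> \<phi>) < LlogL_norm p q \<Omega> \<phi> + e / (2 * C)"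
        using e C by (simp add: LlogL_norm_def)
      then obtain lam where lam: "lam \<in> LlogL_admissible p q \<Omega> \<phi>" "lam < LlogL_norm p q \<Omega> \<phi> + e / (2 * C)"
        using cInf_lessD[OF meas(2)] by blast
      have ae: "AE x in ?M. \<bar>u x\<bar> \<le> (s + e / 2) + C * lam"
        unfolding C_def C0_def m0_def p_def \<alpha>_def
        by (rule sup_bound) (use assms(2) lam(1) c0 s e in \<open>auto simp: p_def \<alpha>_def\<close>)
      have le: "(s + e / 2) + C * lam \<le> s + C * LlogL_norm p q \<Omega> \<phi> + e"
      proof -
        have "C * lam \<le> C * (LlogL_norm p q \<Omega> \<phi> + e / (2 * C))"
          using lam(2) C by (intro mult_left_mono) auto
        also have "\<dots> = C * LlogL_norm p q \<Omega> \<phi> + e / 2" using C by (simp add: distrib_left)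
        finally show ?thesis by simp
      qed
      from ae have "AE x in ?M. ereal \<bar>u x\<bar> \<le> ereal (s + C * LlogL_norm p q \<Omega> \<phi>) + ereal e"
        by eventually_elim (use le in simp)
      then show "Linf_norm \<Omega> u \<le> ereal (s + C * LlogL_norm p q \<Omega> \<phi>) + ereal e"
        unfolding Linf_norm_def by (rule esssup_I[OF um])
    qed
    \<comment> \<open>The norm term is a real number and can be moved across the inequality. It then
      suffices to bound each member of the set, which also covers the empty set with infimum
      infinity.\<close>
    have "Linf_norm \<Omega> u - ereal (C * LlogL_norm p q \<Omega> \<phi>)
        \<le> Inf {ereal s | s. s \<ge> 0 \<and> (\<lambda>x. max (\<bar>u x\<bar> - s) 0) \<in> W12_0 \<Omega>}"
      using bound by (intro Inf_greatest) (auto simp: ereal_minus_le)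
    then show "Linf_norm \<Omega> u
      \<le> Inf {ereal s | s. s \<ge> 0 \<and> (\<lambda>x. max (\<bar>u x\<bar> - s) 0) \<in> W12_0 \<Omega>}
         + ereal (C * LlogL_norm (real CARD('n) / 2) q \<Omega> \<phi>)"
      by (simp add: ereal_minus_le p_def)
  qed
qed

end
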